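(* Let $\alpha>0$ be fixed. Let $\Omega\colon\mathbb{R}\to\mathbb{R}_+$ be a continual diagram and let $a<a_0<b_0<b$ be real numbers such that: (i) the restriction of $\Omega$ to $[a,b]$ is $(1-\delta)$-Lipschitz for some constant $\delta>0$; (ii) the restriction of the transition measure $\mu_\Omega$ to $[a,b]$ is absolutely continuous with a density bounded from above by some constant. Let $(\omega_n)_{n\ge 1}$ be a sequence of continual diagrams such that \[ d(\Omega,\omega_n)=o\left(\frac{1}{n^{\alpha}\log n}\right) \quad (n\to\infty).\] Then \[ \sup_{z\in[a_0,b_0]}\big|K_{\omega_n}(z)-K_{\Omega}(z)\big| = o\left(\frac{1}{n^{\alpha}}\right).\]
   Context: A continual diagram is a function $\omega\colon\mathbb{R}\to\mathbb{R}_+$ such that $|\omega(z_1)-\omega(z_2)|\le|z_1-z_2|$ for all $z_1,z_2\in\mathbb{R}$, and $\omega(z)=|z|$ for all sufficiently large $|z|$. Transition measure: for a continual diagram $\omega$, its Cauchy transform $\mathbf{G}_\omega$ is defined for $z\in\mathbb{C}\setminus\mathbb{R}$ by \[\log\big[z\,\mathbf{G}_\omega(z)\big]=-\int_{-\infty}^{\infty}\frac{1}{z-w}\left(\frac{\omega(w)-|w|}{2}\right)'\,dw,\] and the transition measure $\mu_\omega$ is the unique (compactly supported) probability measure on $\mathbb{R}$ with $\mathbf{G}_\omega(z)=\int\frac{1}{z-x}\,d\mu_\omega(x)$ (obtained by Stieltjes inversion). (For a piecewise affine $\omega$ with slopes $\pm1$, local minima at $\mathbbm{x}_0<\dots<\mathbbm{x}_L$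 and local maxima at $\mathbbm{y}_1<\dots<\mathbbm{y}_L$, this gives $\mathbf{G}_\omega(z)=\prod_{i=1}^L(z-\mathbbm{y}_i)/\prod_{i=0}^L(z-\mathbbm{x}_i)$.) The cumulative function is $K_\omega(z)=\mu_\omega((-\infty,z])$. Metric $d$: for $x,y\ge0$ write $(x,y)\in\omega$ if $\omega(x-y)=x+y$. For $x\ge0$ let $\Pi^\omega_Y(x)=\{y\ge 0:(x,y)\in\omega\}$ and for $y\ge0$ let $\Pi^\omega_X(y)=\{x\ge0:(x,y)\in\omega\}$ (nonempty closed sets). Define $d_Y(\omega_1,\omega_2)=\sup_{x\ge0}d_H(\Pi_Y^{\omega_1}(x),\Pi_Y^{\omega_2}(x))$, $d_X(\omega_1,\omega_2)=\sup_{y\ge0}d_H(\Pi_X^{\omega_1}(y),\Pi_X^{\omega_2}(y))$, where $d_H$ is the Hausdorff distance, and $d(\omega_1,\omega_2)=\max(d_X(\omega_1,\omega_2),d_Y(\omega_1,\omega_2))$. *)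

theory Defs
  imports "HOL-Probability.Probability" "HOL-Library.Landau_Symbols"
begin

definition continual_diagram :: "(real \<Rightarrow> real) \<Rightarrow> bool" where
  "continual_diagram \<omega> \<longleftrightarrow>
     (\<forall>z. 0 \<le> \<omega> z) \<and>
     (\<forall>z1 z2. \<bar>\<omega> z1 - \<omega> z2\<bar> \<le> \<bar>z1 - z2\<bar>) \<and>
     (\<exists>R. \<forall>z. R \<le> \<bar>z\<bar> \<longrightarrow> \<omega> z = \<bar>z\<bar>)"

text \<open>Cauchy transform, defined by
  log [z G(z)] = - integral of 1/(z-w) * ((omega(w) - |w|)/2)' dw,
  i.e. G(z) = exp(- integral ...) / z (for non-real z).  The derivative exists
  almost everywhere (Lipschitz function); the integral is w.r.t. Lebesgue measure.\<close>
definition cauchy_transform :: "(real \<Rightarrow> real) \<Rightarrow> complex \<Rightarrow> complex" where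
  "cauchy_transform \<omega> z =
     exp (- (LINT w|lebesgue. (1 / (z - of_real w)) *
                 of_real (deriv (\<lambda>u. (\<omega> u - \<bar>u\<bar>) / 2) w))) / z"

definition transition_measure :: "(real \<Rightarrow> real) \<Rightarrow> real measure" where
  "transition_measure \<omega> =
     (THE M. prob_space M \<and> sets M = sets borel \<and>
        (\<forall>z. Im z \<noteq> 0 \<longrightarrow>
             cauchy_transform \<omega> z = (LINT x|M. 1 / (z - of_real x))))"

definition cumulative :: "(real \<Rightarrow> real) \<Rightarrow> real \<Rightarrow> real" where
  "cumulative \<omega> z = measure (transition_measure \<omega>) {..z}"

definition PiY :: "(real \<Rightarrow> real) \<Rightarrow> real \<Rightarrow> real set" where
  "PiY \<omega> x = {y. 0 \<le> y \<and> \<omega> (x - y) = x + y}"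

definition PiX :: "(real \<Rightarrow> real) \<Rightarrow> real \<Rightarrow> real set" where
  "PiX \<omega> y = {x. 0 \<le> x \<and> \<omega> (x - y) = x + y}"

text \<open>Hausdorff distance (extended-real valued, since the sets may be unbounded).\<close>
definition hausd :: "real set \<Rightarrow> real set \<Rightarrow> ereal" where
  "hausd A B = max (SUP a\<in>A. ereal (infdist a B)) (SUP b\<in>B. ereal (infdist b A))"

definition dY :: "(real \<Rightarrow> real) \<Rightarrow> (real \<Rightarrow> real) \<Rightarrow> ereal" where
  "dY \<omega>1 \<omega>2 = (SUP x\<in>{0..}. hausd (PiY \<omega>1 x) (PiY \<omega>2 x))"

definition dX :: "(real \<Rightarrow> real) \<Rightarrow> (real \<Rightarrow> real) \<Rightarrow> ereal" where
  "dX \<omega>1 \<omega>2 = (SUP y\<in>{0..}. hausd (PiX \<omega>1 y) (PiX \<omega>2 y))"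

definition diag_dist :: "(real \<Rightarrow> real) \<Rightarrow> (real \<Rightarrow> real) \<Rightarrow> ereal" where
  "diag_dist \<omega>1 \<omega>2 = max (dX \<omega>1 \<omega>2) (dY \<omega>1 \<omega>2)"

end

theory Submission
  imports Defs
begin

text \<open>
  Write G for the Cauchy transform of \<open>\<Omega>\<close> and G' for that of a diagram \<open>\<omega>\<close> with
  \<open>d(\<Omega>, \<omega>) \<le> \<epsilon>\<close>. The metric controls the uniform distance: \<open>\<bar>\<omega> - \<Omega>\<bar> \<le> 2\<epsilon>\<close>. Integrating by
  parts in the definition of the Cauchy transform gives G' = G exp D with
  \<open>\<bar>D(u + it)\<bar> \<le> \<pi>\<epsilon>/t\<close>.

  The argument of G(u + it) is minus the Poisson integral of \<open>\<pi>(1 - \<Omega>')/2\<close>. By the Lipschitz condition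
  it stays away from 0 and \<open>-\<pi>\<close>, so \<open>\<bar>G\<bar>\<close> is at most a constant times \<open>\<bar>Im G\<bar>\<close>, which is bounded
  near the interval because the density is. Hence \<open>\<bar>G\<bar> \<le> B\<close> for u between a0 and b0 and t at most 1.

  Let \<open>S\<^sub>\<eta>(u)\<close> be the cumulative function smoothed by the Poisson kernel at scale \<open>\<eta>\<close>. Its derivative in
  \<open>\<eta>\<close> is \<open>- Re G(u + i\<eta>)/\<pi>\<close> and it tends to 1/2 as \<open>\<eta> \<rightarrow> \<infinity>\<close>, so integrating \<open>\<bar>G - G'\<bar> \<le> const \<epsilon>/t\<close> from
  \<open>\<eta> = 8\<epsilon>\<close> to infinity bounds the difference of the smoothed functions by \<open>O(\<epsilon> log(1/\<epsilon>))\<close>. The same order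
  bounds the smoothing errors, because at scales above \<open>\<eta>\<close> both measures have bounded Poisson integrals.
  With \<open>\<epsilon> = o(n\<^sup>-\<^sup>\<alpha> / log n)\<close> the total is \<open>o(n\<^sup>-\<^sup>\<alpha>)\<close>.
\<close>

section \<open>Almost everywhere differentiability of Lipschitz functions\<close>

text \<open>Nothing is known about the regularity of \<open>\<omega>\<close> beyond its being a
  diagram: its transition measure may be purely atomic and its transform unbounded near the real
  axis. The only control is the factor exp D, which helps just where D is bounded, at heights t of
  order \<epsilon> or more. This dictates the cut-off: the constant 8 keeps D below 1/2 there. The
  logarithm is the price of adding up errors of size \<epsilon>/t over all scales between \<epsilon>
  and 1, and it explains the factor log n in the hypothesis. The definitions add two tasks. The
  transform contains the derivative of a merely Lipschitz function, so almost everywhere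
  differentiability has to be established. The transition measure is a definite description, which
  says nothing until existence and uniqueness are known; existence comes from zigzag diagrams, whose
  transforms are rational with interlacing zeros and poles, and uniqueness from the same smoothed
  functions that serve in the estimate.\<close>

lemma Vitali_covering_intervals:
  fixes K :: "(real \<times> real) set"
  assumes K: "\<And>p q. (p, q) \<in> K \<Longrightarrow> p < q"
    and S: "\<And>x d. x \<in> S \<Longrightarrow> 0 < d \<Longrightarrow> \<exists>(p, q)\<in>K. x \<in> {p..q} \<and> q - p < d"
  obtains C where "countable C" "C \<subseteq> K" "disjoint_family_on (\<lambda>(p, q). {p..q}) C"
    "negligible (S - (\<Union>(p, q)\<in>C. {p..q}))"
proof -
  \<comment> \<open>A closed interval is a closed ball around its midpoint, so the covering theorem
    for balls applies. There the balls need only contain the point, hence x may lie anywhere in its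
    interval.\<close>
  define a where "a = (\<lambda>i::real \<times> real. (fst i + snd i) / 2)"
  define r where "r = (\<lambda>i::real \<times> real. (snd i - fst i) / 2)"
  have ball: "cball (a i) (r i) = {fst i..snd i}" for i
    by (auto simp: a_def r_def cball_eq_atLeastAtMost field_simps)
  have "\<exists>i. i \<in> K \<and> x \<in> cball (a i) (r i) \<and> r i < d" if "x \<in> S" "0 < d" for x d
  proof -
    from S[OF that] obtain p q where pq: "(p, q) \<in> K" "x \<in> {p..q}" "q - p < d" by auto
    moreover have "r (p, q) < d" using pq K[of p q] by (simp add: r_def)
    ultimately show ?thesis by (intro exI[of _ "(p,q)"]) (auto simp: ball)
  qed
  moreover have "0 < r i" if "i \<in> K" for i
    using K[of "fst i" "snd i"] that by (simp add: r_def)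
  ultimately obtain C where C: "countable C" "C \<subseteq> K"
     "pairwise (\<lambda>i j. disjnt (cball (a i) (r i)) (cball (a j) (r j))) C"
     "negligible(S - (\<Union>i \<in> C. cball (a i) (r i)))"
    using Vitali_covering_theorem_cballs[of K r S a] by blast
  show ?thesis
  proof (rule that[OF C(1,2)])
    show "disjoint_family_on (\<lambda>(p, q). {p..q}) C"
      using C(3) by (auto simp: ball disjoint_family_on_def pairwise_def disjnt_def case_prod_beta)
    show "negligible (S - (\<Union>(p, q)\<in>C. {p..q}))"
      using C(4) by (simp add: ball case_prod_beta)
  qed
qed

text \<open>Two successive Vitali coverings, by intervals of small slope and then, inside those, by intervals of
  large slope, give \<open>s \<bar>S\<bar> \<le> r (\<bar>S\<bar> + e)\<close>; the Stieltjes measure of g does the bookkeeping.\<close>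

lemma mono_derivates_negligible:
  fixes g :: "real \<Rightarrow> real"
  assumes mono: "mono g" and cont: "continuous_on UNIV g" and rs: "0 \<le> r" "r < s"
    and low: "\<And>x d. x \<in> S \<Longrightarrow> 0 < d \<Longrightarrow> \<exists>p q. p < x \<and> x < q \<and> q - p < d \<and> g q - g p < r * (q - p)"
    and upp: "\<And>x d. x \<in> S \<Longrightarrow> 0 < d \<Longrightarrow> \<exists>p q. p < x \<and> x < q \<and> q - p < d \<and> s * (q - p) < g q - g p"
    and S: "S \<in> sets borel" "bounded S"
  shows "negligible S"
proof -
  define N where "N = interval_measure g"
  \<comment> \<open>Continuity of \<open>g\<close> rules out atoms, so closed and half-open
    intervals get the same mass.\<close>
  have N: "emeasure N {p..q} = ennreal (g q - g p)" if "p \<le> q" for p q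
    unfolding N_def using that mono cont
    by (intro emeasure_interval_measure_Icc) (auto simp: mono_def)
  have sN[measurable_cong]: "sets N = sets borel" by (simp add: N_def)
  have SL: "S \<in> lmeasurable"
    using S by (intro bounded_set_imp_lmeasurable) auto
  have main: "s * measure lebesgue S \<le> r * (measure lebesgue S + e)" if "e > 0" for e
  proof -
    obtain U where U: "open U" "S \<subseteq> U" "U \<in> lmeasurable" "measure lebesgue U < measure lebesgue S + e"
    proof -
      obtain U where U: "open U" "S \<subseteq> U" "U - S \<in> lmeasurable" "emeasure lebesgue (U - S) < ennreal e"
        using sets_lebesgue_outer_open[OF fmeasurableD[OF SL] \<open>e > 0\<close>] by metis
      then have "measure lebesgue (U - S) < e"
        by (metis emeasure_eq_measure2 ennreal_leI not_less)
      with U SL show ?thesis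
        by (intro that[of U]) (auto simp: measurable_measure_Diff dest!: fmeasurable_Diff_D)
    qed
    define K1 where "K1 = {(p, q). p < q \<and> {p..q} \<subseteq> U \<and> g q - g p < r * (q - p)}"
    have p1: "p < q" if "(p, q) \<in> K1" for p q using that by (simp add: K1_def)
    have v1: "\<exists>(p, q)\<in>K1. x \<in> {p..q} \<and> q - p < d" if x: "x \<in> S" "0 < d" for x d
    proof -
      obtain e where e: "e > 0" "ball x e \<subseteq> U" using U x by (meson openE subsetD)
      obtain p q where pq: "p < x" "x < q" "q - p < min d e" "g q - g p < r * (q - p)"
        using low[OF x(1), of "min d e"] x(2) e by auto
      have "{p..q} \<subseteq> ball x e" using pq by (auto simp: dist_real_def)
      then show ?thesis using pq e by (intro bexI[of _ "(p,q)"]) (auto simp: K1_def)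
    qed
    obtain C1 where C1: "countable C1" "C1 \<subseteq> K1" "disjoint_family_on (\<lambda>(p, q). {p..q}) C1"
      "negligible (S - (\<Union>(p, q)\<in>C1. {p..q}))"
      using Vitali_covering_intervals[of K1 S, OF p1 v1] by blast
    define W1 where "W1 = (\<Union>(p, q)\<in>C1. {p..q})"
    \<comment> \<open>The second covering must stay inside the first, which needs an open set.
      Passing to open interiors loses only the endpoints of countably many intervals.\<close>
    define W where "W = (\<Union>(p, q)\<in>C1. {p<..<q})"
    have Wo: "open W" unfolding W_def by auto
    have in1: "{p..q} \<subseteq> U" if "(p, q) \<in> C1" for p q
      using subsetD[OF C1(2) that] by (simp add: K1_def)
    have WW1: "W \<subseteq> W1" "W1 \<subseteq> U"
    proof -
      show "W \<subseteq> W1" unfolding W_def W1_def by (rule UN_mono) auto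
      show "W1 \<subseteq> U" unfolding W1_def using in1 by blast
    qed
    have W1b: "W1 \<in> sets borel" unfolding W1_def by (intro sets.countable_UN'' C1) auto
    have "W1 - W \<subseteq> fst ` C1 \<union> snd ` C1"
    proof
      fix x assume "x \<in> W1 - W"
      then obtain p q where pq: "(p, q) \<in> C1" "p \<le> x" "x \<le> q" and "x \<notin> W" by (auto simp: W1_def)
      then have "\<not> (p < x \<and> x < q)" by (auto simp: W_def)
      then have "x = p \<or> x = q" using pq by auto
      then show "x \<in> fst ` C1 \<union> snd ` C1" using pq(1) by force
    qed
    then have "negligible (W1 - W)"
      using C1(1) by (meson countable_Un countable_image countable_subset countable_imp_null_set_lborel
        null_sets_completionI negligible_iff_null_sets)
    then have nSW: "negligible (S - W)"
      using C1(4) by (rule_tac negligible_subset[of "(S - W1) \<union> (W1 - W)"]) (auto simp: W1_def)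
    have NW1: "emeasure N W1 \<le> ennreal r * emeasure lborel W1"
    proof -
      have "emeasure N W1 = (\<integral>\<^sup>+i. emeasure N (case i of (p, q) \<Rightarrow> {p..q}) \<partial>count_space C1)"
        unfolding W1_def using C1 by (intro emeasure_UN_countable) auto
      also have "\<dots> \<le> (\<integral>\<^sup>+i. ennreal r * emeasure lborel (case i of (p, q) \<Rightarrow> {p..q}) \<partial>count_space C1)"
      proof (intro nn_integral_mono, clarsimp)
        fix p q assume "(p, q) \<in> C1"
        then have "p < q" "g q - g p < r * (q - p)" using C1(2) by (auto simp: K1_def)
        then show "emeasure N {p..q} \<le> ennreal r * emeasure lborel {p..q}"
          using rs by (simp add: N ennreal_mult[symmetric] ennreal_leI)
      qed
      also have "\<dots> = ennreal r * (\<integral>\<^sup>+i. emeasure lborel (case i of (p, q) \<Rightarrow> {p..q}) \<partial>count_space C1)"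
        by (intro nn_integral_cmult) auto
      also have "(\<integral>\<^sup>+i. emeasure lborel (case i of (p, q) \<Rightarrow> {p..q}) \<partial>count_space C1) = emeasure lborel W1"
        unfolding W1_def using C1 by (intro emeasure_UN_countable[symmetric]) auto
      finally show ?thesis .
    qed
    define K2 where "K2 = {(p, q). p < q \<and> {p..q} \<subseteq> W \<and> s * (q - p) < g q - g p}"
    have p2: "p < q" if "(p, q) \<in> K2" for p q using that by (simp add: K2_def)
    have v2: "\<exists>(p, q)\<in>K2. x \<in> {p..q} \<and> q - p < d" if x: "x \<in> S \<inter> W" "0 < d" for x d
    proof -
      obtain e where e: "e > 0" "ball x e \<subseteq> W" using Wo x by (meson openE IntD2)
      obtain p q where pq: "p < x" "x < q" "q - p < min d e" "s * (q - p) < g q - g p"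
        using upp[of x "min d e"] x e by auto
      have "{p..q} \<subseteq> ball x e" using pq by (auto simp: dist_real_def)
      then show ?thesis using pq e by (intro bexI[of _ "(p,q)"]) (auto simp: K2_def)
    qed
    obtain C2 where C2: "countable C2" "C2 \<subseteq> K2" "disjoint_family_on (\<lambda>(p, q). {p..q}) C2"
      "negligible (S \<inter> W - (\<Union>(p, q)\<in>C2. {p..q}))"
      using Vitali_covering_intervals[of K2 "S \<inter> W", OF p2 v2] by blast
    define W2 where "W2 = (\<Union>(p, q)\<in>C2. {p..q})"
    have W2b: "W2 \<in> sets borel" unfolding W2_def by (intro sets.countable_UN'' C2) auto
    have in2: "{p..q} \<subseteq> W" if "(p, q) \<in> C2" for p q
      using subsetD[OF C2(2) that] by (simp add: K2_def)
    have W2W: "W2 \<subseteq> W" unfolding W2_def using in2 by blast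
    have NW2: "ennreal s * emeasure lborel W2 \<le> emeasure N W2"
    proof -
      have "ennreal s * emeasure lborel W2 = ennreal s * (\<integral>\<^sup>+i. emeasure lborel (case i of (p, q) \<Rightarrow> {p..q}) \<partial>count_space C2)"
        unfolding W2_def using C2 by (subst emeasure_UN_countable) auto
      also have "\<dots> = (\<integral>\<^sup>+i. ennreal s * emeasure lborel (case i of (p, q) \<Rightarrow> {p..q}) \<partial>count_space C2)"
        by (intro nn_integral_cmult[symmetric]) auto
      also have "\<dots> \<le> (\<integral>\<^sup>+i. emeasure N (case i of (p, q) \<Rightarrow> {p..q}) \<partial>count_space C2)"
      proof (intro nn_integral_mono, clarsimp)
        fix p q assume "(p, q) \<in> C2"
        then have "p < q" "s * (q - p) < g q - g p" using C2(2) by (auto simp: K2_def)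
        then show "ennreal s * emeasure lborel {p..q} \<le> emeasure N {p..q}"
          using rs by (simp add: N ennreal_mult[symmetric] ennreal_leI)
      qed
      also have "\<dots> = emeasure N W2"
        unfolding W2_def using C2 by (intro emeasure_UN_countable[symmetric]) auto
      finally show ?thesis .
    qed
    have "negligible (S - W2)"
      using C2(4) nSW by (rule_tac negligible_subset[of "(S \<inter> W - W2) \<union> (S - W)"]) (auto simp: W2_def)
    then have nS: "S - W2 \<in> null_sets lebesgue" by (simp add: negligible_iff_null_sets)
    have "emeasure lebesgue S \<le> emeasure lebesgue (W2 \<union> (S - W2))"
      using S W2b by (intro emeasure_mono) auto
    also have "\<dots> = emeasure lebesgue W2"
      using nS W2b by (intro emeasure_Un_null_set) auto
    also have "\<dots> = emeasure lborel W2" using W2b by simp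
    finally have SW2: "emeasure lebesgue S \<le> emeasure lborel W2" .
    have "ennreal (s * measure lebesgue S) = ennreal s * emeasure lebesgue S"
      using SL rs by (simp add: emeasure_eq_measure2 ennreal_mult)
    also have "\<dots> \<le> ennreal s * emeasure lborel W2" using SW2 by (rule mult_left_mono) simp
    also have "\<dots> \<le> emeasure N W2" by (rule NW2)
    also have "\<dots> \<le> emeasure N W1" using W2W WW1 W1b by (intro emeasure_mono) (auto simp: sN)
    also have "\<dots> \<le> ennreal r * emeasure lborel W1" by (rule NW1)
    also have "\<dots> \<le> ennreal r * emeasure lebesgue U"
    proof (rule mult_left_mono)
      have "emeasure lborel W1 = emeasure lebesgue W1" using W1b by simp
      also have "\<dots> \<le> emeasure lebesgue U" using WW1 U by (intro emeasure_mono) (auto simp: fmeasurableD)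
      finally show "emeasure lborel W1 \<le> emeasure lebesgue U" .
    qed simp
    also have "\<dots> = ennreal (r * measure lebesgue U)"
      using U rs by (simp add: emeasure_eq_measure2 ennreal_mult)
    finally have "s * measure lebesgue S \<le> r * measure lebesgue U"
      using rs by (subst (asm) ennreal_le_iff) (auto intro!: mult_nonneg_nonneg)
    also have "\<dots> \<le> r * (measure lebesgue S + e)" using U(4) rs by (intro mult_left_mono) auto
    finally show ?thesis .
  qed
  have "s * measure lebesgue S \<le> r * measure lebesgue S"
  proof (rule field_le_epsilon)
    fix e :: real assume "e > 0"
    \<comment> \<open>Dividing by \<open>r + 1\<close> instead of \<open>r\<close> keeps the case r
      = 0 valid.\<close>
    then have "s * measure lebesgue S \<le> r * (measure lebesgue S + e / (r + 1))"
      using rs by (intro main) auto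
    also have "\<dots> \<le> r * measure lebesgue S + e"
      using rs \<open>e > 0\<close> by (simp add: field_simps)
    finally show "s * measure lebesgue S \<le> r * measure lebesgue S + e" .
  qed
  then have "(s - r) * measure lebesgue S \<le> 0" by (simp add: algebra_simps)
  then have "measure lebesgue S = 0"
    using rs measure_nonneg[of lebesgue S] by (auto simp: mult_le_0_iff)
  then show ?thesis using SL by (simp add: negligible_iff_measure)
qed

text \<open>A small difference quotient at x gives an interval with x as an endpoint; by continuity
  of \<open>g\<close> this endpoint can be pushed slightly past x without losing the strict
  inequality. Points strictly inside are wanted so that the exceptional sets can be built from open
  intervals and are Borel. No sign of \<open>r\<close> is assumed, so large slopes are covered too,
  by passing to -g and -s.\<close>

lemma frequently_small_slope:
  fixes g :: "real \<Rightarrow> real"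
  assumes cont: "continuous_on UNIV g" and fr: "\<exists>\<^sub>F y in at x. (g y - g x) / (y - x) < r" and d: "0 < d"
  shows "\<exists>p q. p < x \<and> x < q \<and> q - p < d \<and> g q - g p < r * (q - p)"
proof -
  obtain y where y: "y \<noteq> x" "\<bar>y - x\<bar> < d / 2" "(g y - g x) / (y - x) < r"
  proof -
    have "\<forall>\<^sub>F y in at x. y \<noteq> x \<and> \<bar>y - x\<bar> < d / 2"
      using d by (auto simp: eventually_at dist_real_def intro!: exI[of _ "d/2"])
    from frequently_eventually_frequently[OF fr this] that show ?thesis
      by (auto dest: frequently_ex)
  qed
  have gc: "isCont g t" for t using cont by (simp add: continuous_on_eq_continuous_at)
  have cont2: "isCont (\<lambda>p. r * (y - p) - (g y - g p)) x"
    by (intro continuous_intros gc)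
  have small: "\<forall>\<^sub>F p in at x. \<bar>p - x\<bar> < d / 2"
    using d by (auto simp: eventually_at dist_real_def intro!: exI[of _ "d/2"])
  show ?thesis
  proof (cases "y > x")
    case True
    then have "0 < r * (y - x) - (g y - g x)" using y by (simp add: field_simps)
    with cont2 have "\<forall>\<^sub>F p in at x. 0 < r * (y - p) - (g y - g p)"
      unfolding isCont_def by (rule order_tendstoD)
    with small have "\<forall>\<^sub>F p in at_left x. \<bar>p - x\<bar> < d / 2 \<and> 0 < r * (y - p) - (g y - g p) \<and> p < x"
      by (auto simp: eventually_at_split eventually_conj_iff) (simp add: eventually_at_filter)
    then obtain p where "\<bar>p - x\<bar> < d / 2" "0 < r * (y - p) - (g y - g p)" "p < x"
      by (metis (no_types, lifting) eventually_happens' trivial_limit_at_left_real)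
    then show ?thesis using True y by (intro exI[of _ p] exI[of _ y]) auto
  next
    case False
    then have "y < x" using y by simp
    then have "r * (y - x) - (g y - g x) < 0" using y by (simp add: field_simps)
    with cont2 have "\<forall>\<^sub>F p in at x. r * (y - p) - (g y - g p) < 0"
      unfolding isCont_def by (rule order_tendstoD)
    with small have "\<forall>\<^sub>F p in at_right x. \<bar>p - x\<bar> < d / 2 \<and> r * (y - p) - (g y - g p) < 0 \<and> x < p"
      by (auto simp: eventually_at_split eventually_conj_iff) (simp add: eventually_at_filter)
    then obtain p where "\<bar>p - x\<bar> < d / 2" "r * (y - p) - (g y - g p) < 0" "x < p"
      by (metis (no_types, lifting) eventually_happens' trivial_limit_at_right_real)
    then show ?thesis using \<open>y < x\<close> y
      by (intro exI[of _ y] exI[of _ p]) (auto simp: algebra_simps)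
  qed
qed

text \<open>After adding a linear function the difference quotients lie in [0, 2L]. Where the
  derivative fails to exist, their lower and upper limits differ and two rationals r < s fit between
  them; there are countably many such pairs, and each contributes a null set.\<close>

lemma lipschitz_non_differentiable_negligible:
  fixes f :: "real \<Rightarrow> real"
  assumes lip: "\<And>x y. \<bar>f x - f y\<bar> \<le> L * \<bar>x - y\<bar>"
  shows "negligible {x. \<not> f differentiable (at x)}"
proof -
  define g where "g = (\<lambda>x. f x + L * x)"
  have slope: "0 \<le> (g y - g x) / (y - x)" "(g y - g x) / (y - x) \<le> 2 * L" if "x \<noteq> y" for x y
  proof -
    have e: "(g y - g x) / (y - x) = (f y - f x) / (y - x) + L"
      using that by (simp add: g_def field_simps)
    have "\<bar>(f y - f x) / (y - x)\<bar> \<le> L"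
      using lip[of y x] that by (simp add: abs_divide divide_le_eq)
    then show "0 \<le> (g y - g x) / (y - x)" "(g y - g x) / (y - x) \<le> 2 * L"
      unfolding e by linarith+
  qed
  have mono: "mono g"
  proof (rule monoI)
    fix x y :: real assume "x \<le> y"
    then show "g x \<le> g y" using lip[of x y] by (simp add: g_def algebra_simps)
  qed
  have "L-lipschitz_on UNIV f"
    using lip lip[of 0 1] by (auto simp: lipschitz_on_def dist_real_def)
  then have contf: "continuous_on UNIV f" by (rule lipschitz_on_continuous_on)
  then have cont: "continuous_on UNIV g" unfolding g_def by (intro continuous_intros)
  have contm: "continuous_on UNIV (\<lambda>x. - g x)" using cont by (intro continuous_intros)
  define U where "U = (\<lambda>s d. \<Union>{{p<..<q} |p q. q - p < d \<and> s * (q - p) < g q - g p})"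
  define V where "V = (\<lambda>r d. \<Union>{{p<..<q} |p q. q - p < d \<and> g q - g p < r * (q - p)})"
  \<comment> \<open>The bound by \<open>m\<close> provides the boundedness needed for finite
    measure; the scales 1/(n+1) replace all d > 0, so that a countable intersection of open sets
    results.\<close>
  define E where "E = (\<lambda>(r, s, m::nat). {-real m<..<real m} \<inter> (\<Inter>n. U (real_of_rat s) (1 / real (Suc n)) \<inter> V (real_of_rat r) (1 / real (Suc n))))"
  have neg: "negligible (E (r, s, m))" if rs: "0 \<le> r" "r < s" for r s m
  proof (rule mono_derivates_negligible[OF mono cont, of "real_of_rat r" "real_of_rat s"])
    show "0 \<le> real_of_rat r" "real_of_rat r < real_of_rat s"
      using rs by (auto simp: of_rat_less)
    have "open (U t d)" "open (V t d)" for t d unfolding U_def V_def by auto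
    then show "E (r, s, m) \<in> sets borel" unfolding E_def by auto
    show "bounded (E (r, s, m))" unfolding E_def
      by (rule bounded_subset[of "{-real m<..<real m}"]) auto
    fix x d assume x: "x \<in> E (r, s, m)" and d: "(0::real) < d"
    obtain n where n: "1 / real (Suc n) < d" using nat_approx_posE[OF d] by (metis (no_types) inverse_eq_divide)
    have "x \<in> U (real_of_rat s) (1 / real (Suc n))" "x \<in> V (real_of_rat r) (1 / real (Suc n))"
      using x by (auto simp: E_def)
    then show "\<exists>p q. p < x \<and> x < q \<and> q - p < d \<and> g q - g p < real_of_rat r * (q - p)"
      "\<exists>p q. p < x \<and> x < q \<and> q - p < d \<and> real_of_rat s * (q - p) < g q - g p"
      using n unfolding U_def V_def by (force dest: order_less_trans)+
  qed
  have sub: "{x. \<not> f differentiable (at x)} \<subseteq> (\<Union>i\<in>{(r, s, m). 0 \<le> r \<and> r < s}. E i)"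
  proof (clarify, rule ccontr)
    fix x assume nd: "\<not> f differentiable at x" and nE: "x \<notin> (\<Union>i\<in>{(r, s, m). 0 \<le> r \<and> r < s}. E i)"
    define \<phi> where "\<phi> = (\<lambda>y. (g y - g x) / (y - x))"
    have bd: "\<forall>\<^sub>F y in at x. 0 \<le> \<phi> y \<and> \<phi> y \<le> 2 * L"
      unfolding eventually_at_filter \<phi>_def by (rule always_eventually) (metis slope)
    define l where "l = Liminf (at x) (\<lambda>y. ereal (\<phi> y))"
    define u where "u = Limsup (at x) (\<lambda>y. ereal (\<phi> y))"
    have l0: "0 \<le> l" unfolding l_def
      by (rule Liminf_bounded) (use bd in \<open>auto elim: eventually_mono\<close>)
    have u1: "u \<le> ereal (2 * L)" unfolding u_def
      by (rule Limsup_bounded) (use bd in \<open>auto elim: eventually_mono\<close>)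
    have lu: "l \<le> u" unfolding l_def u_def by (rule Liminf_le_Limsup) simp
    have "\<not> l < u"
    proof
      assume "l < u"
      obtain r where r: "l < ereal (real_of_rat r)" "ereal (real_of_rat r) < u"
        using ereal_dense3[OF \<open>l < u\<close>] by blast
      obtain s where s: "ereal (real_of_rat r) < ereal (real_of_rat s)" "ereal (real_of_rat s) < u"
        using ereal_dense3[OF r(2)] by blast
      have "0 < ereal (real_of_rat r)" using l0 r(1) by (rule order_le_less_trans)
      then have r0: "0 \<le> r" "r < s" using s by (auto simp: of_rat_less)
      have f1: "\<exists>\<^sub>F y in at x. \<phi> y < real_of_rat r"
      proof (rule ccontr)
        assume "\<not> ?thesis"
        then have "ereal (real_of_rat r) \<le> l" unfolding l_def
          by (intro Liminf_bounded) (auto simp: not_frequently not_less elim: eventually_mono)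
        then show False using r by auto
      qed
      have f2: "\<exists>\<^sub>F y in at x. \<phi> y > real_of_rat s"
      proof (rule ccontr)
        assume "\<not> ?thesis"
        then have "u \<le> ereal (real_of_rat s)" unfolding u_def
          by (intro Limsup_bounded) (auto simp: not_frequently not_less elim: eventually_mono)
        then show False using s by auto
      qed
      have f3: "\<exists>\<^sub>F y in at x. (- g y - - g x) / (y - x) < - real_of_rat s"
        using f2 by (rule frequently_elim1) (auto simp: \<phi>_def minus_divide_left[symmetric] diff_divide_distrib)
      have "x \<in> V (real_of_rat r) d" if "d > 0" for d
        using frequently_small_slope[OF cont f1[unfolded \<phi>_def] that] unfolding V_def by force
      moreover have "x \<in> U (real_of_rat s) d" if "d > 0" for d
        using frequently_small_slope[OF contm f3 that] unfolding U_def by force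
      moreover obtain m :: nat where "\<bar>x\<bar> < real m" using reals_Archimedean2 by blast
      ultimately have "x \<in> E (r, s, m)" unfolding E_def by auto
      then show False using nE r0 by blast
    qed
    then have "l = u" using lu by simp
    moreover obtain D where D: "u = ereal D" using l0 u1 \<open>l = u\<close> by (cases u) auto
    ultimately have "((\<lambda>y. ereal (\<phi> y)) \<longlongrightarrow> ereal D) (at x)"
      by (subst tendsto_iff_Liminf_eq_Limsup) (auto simp: l_def u_def)
    then have "(\<phi> \<longlongrightarrow> D) (at x)" by simp
    then have "(g has_real_derivative D) (at x)"
      unfolding has_field_derivative_iff \<phi>_def .
    then have "((\<lambda>y. g y - L * y) has_real_derivative D - L) (at x)"
      by (auto intro!: derivative_eq_intros)
    then have "f differentiable at x"
      unfolding g_def real_differentiable_def by auto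
    then show False using nd by simp
  qed
  show ?thesis
    by (rule negligible_subset[OF negligible_countable_Union sub, unfolded image_image])
       (auto intro: neg)
qed

section \<open>The Cauchy transform of a continual diagram\<close>

lemma integrable_const_Icc:
  "integrable lborel (\<lambda>w. c * indicator {a..b} w :: real)" for a b c :: real
  by (intro integrable_mult_right integrable_real_indicator) (auto simp: emeasure_lborel_Icc_eq)

lemma integrable_bounded_support:
  fixes g :: "real \<Rightarrow> 'a::{banach, second_countable_topology}"
  assumes [measurable]: "g \<in> borel_measurable borel"
    and "\<And>w. norm (g w) \<le> B" and "\<And>w. R < \<bar>w\<bar> \<Longrightarrow> g w = 0"
  shows "integrable lborel g"
proof (rule Bochner_Integration.integrable_bound)
  show "integrable lborel (\<lambda>w. B * indicator {-R..R} w :: real)" by (rule integrable_const_Icc)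
  show "AE w in lborel. norm (g w) \<le> norm (B * indicator {-R..R} w :: real)"
  proof (rule AE_I2)
    fix w show "norm (g w) \<le> norm (B * indicator {-R..R} w :: real)"
      using assms(2)[of w] assms(3)[of w] by (cases "w \<in> {-R..R}") (auto simp: abs_if split: if_splits)
  qed
qed simp

text \<open>A discrete integration by parts: translation invariance of Lebesgue measure moves a
  difference quotient from \<open>\<sigma>\<close> to \<open>f\<close>, with the opposite step, and
  dominated convergence lets the step tend to 0 on both sides. Only almost everywhere
  differentiability and the Lipschitz bound enter, not a fundamental theorem for absolutely
  continuous functions.\<close>

lemma lipschitz_integral_by_parts:
  fixes \<sigma> \<tau> :: "real \<Rightarrow> real" and F :: "complex \<Rightarrow> complex" and f' :: "real \<Rightarrow> complex"
  assumes lip: "\<And>x y. \<bar>\<sigma> x - \<sigma> y\<bar> \<le> L * \<bar>x - y\<bar>" and supp: "\<And>w. R < \<bar>w\<bar> \<Longrightarrow> \<sigma> w = 0"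
    and [measurable]: "\<tau> \<in> borel_measurable borel"
    and der: "AE w in lborel. (\<sigma> has_real_derivative \<tau> w) (at w)"
    and F: "\<And>w. (F has_field_derivative f' w) (at (of_real w))" and bd: "\<And>w. norm (F (of_real w)) \<le> B"
    and bd': "\<And>w. norm (f' w) \<le> B'" and [measurable]: "f' \<in> borel_measurable borel"
  shows "(LINT w|lborel. F (of_real w) * of_real (\<tau> w)) = - (LINT w|lborel. f' w * of_real (\<sigma> w))"
proof -
  define f where "f = (\<lambda>w::real. F (of_real w))"
  have f: "(f has_vector_derivative f' w) (at w)" for w
    unfolding f_def by (rule has_vector_derivative_real_field[OF F])
  have bd: "norm (f w) \<le> B" for w unfolding f_def by (rule bd)
  have "L-lipschitz_on UNIV \<sigma>"
    using lip lip[of 0 1] by (auto simp: lipschitz_on_def dist_real_def)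
  then have cs: "continuous_on UNIV \<sigma>" by (rule lipschitz_on_continuous_on)
  then have [measurable]: "\<sigma> \<in> borel_measurable borel" by (simp add: borel_measurable_continuous_onI)
  have cf: "continuous_on UNIV f"
    using f by (meson continuous_at_imp_continuous_on has_vector_derivative_continuous)
  then have [measurable]: "f \<in> borel_measurable borel" by (simp add: borel_measurable_continuous_onI)
  have L0: "0 \<le> L" using lip[of 0 1] by simp
  have B0: "0 \<le> B" "0 \<le> B'" using bd[of 0] bd'[of 0] norm_ge_zero order_trans by blast+
  define R' where "R' = max R 0"
  have supp': "\<sigma> w = 0" if "R' < \<bar>w\<bar>" for w using supp[of w] that by (simp add: R'_def)
  obtain C where C: "\<And>w. \<bar>\<sigma> w\<bar> \<le> C" "0 \<le> C"
  proof -
    have "\<bar>\<sigma> w\<bar> \<le> L * (2 * R' + 1)" for w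
    proof (cases "R' < \<bar>w\<bar>")
      case True then show ?thesis using supp'[of w] L0 by (simp add: R'_def)
    next
      case False
      have "\<bar>\<sigma> w\<bar> = \<bar>\<sigma> w - \<sigma> (R' + 1)\<bar>" using supp'[of "R'+1"] by (simp add: R'_def)
      also have "\<dots> \<le> L * \<bar>w - (R' + 1)\<bar>" by (rule lip)
      also have "\<dots> \<le> L * (2 * R' + 1)" using False L0 by (intro mult_left_mono) auto
      finally show ?thesis .
    qed
    then show ?thesis using L0 by (intro that[of "L * (2 * R' + 1)"]) (auto simp: R'_def)
  qed
  \<comment> \<open>Steps of at most 1 keep all shifted supports inside the interval of radius
    \<open>R' + 1\<close>.\<close>
  define h where "h = (\<lambda>n::nat. 1 / real (Suc n))"
  have h0: "0 < h n" "h n \<le> 1" for n by (auto simp: h_def)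
  have h_at: "filterlim h (at 0) sequentially"
    unfolding filterlim_at using LIMSEQ_inverse_real_of_nat h0(1)
    by (auto simp: h_def divide_inverse less_imp_neq[symmetric])
  have shift: "(LINT w|lborel. f w * of_real ((\<sigma> (w + h n) - \<sigma> w) / h n))
      = (LINT w|lborel. ((f (w - h n) - f w) / of_real (h n)) * of_real (\<sigma> w))" (is "?l n = ?r n") for n
  proof -
    have i1: "integrable lborel (\<lambda>w. f w * of_real (\<sigma> w))"
      by (rule integrable_bounded_support[of _ "B * C" R'])
         (auto simp: norm_mult supp' B0 intro!: mult_mono bd C)
    have i2: "integrable lborel (\<lambda>w. f w * of_real (\<sigma> (w + h n)))"
      by (rule integrable_bounded_support[of _ "B * C" "R' + 1"])
         (use h0[of n] in \<open>auto simp: norm_mult B0 intro!: mult_mono bd C supp'\<close>)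
    have i3: "integrable lborel (\<lambda>w. f (w - h n) * of_real (\<sigma> w))"
      by (rule integrable_bounded_support[of _ "B * C" R'])
         (auto simp: norm_mult supp' B0 intro!: mult_mono bd C)
    have "?l n = (LINT w|lborel. (f w * of_real (\<sigma> (w + h n)) - f w * of_real (\<sigma> w)) / of_real (h n))"
      by (simp add: algebra_simps diff_divide_distrib)
    also have "\<dots> = ((LINT w|lborel. f w * of_real (\<sigma> (w + h n))) - (LINT w|lborel. f w * of_real (\<sigma> w))) / of_real (h n)"
      using i1 i2 by simp
    also have "(LINT w|lborel. f w * of_real (\<sigma> (w + h n))) = (LINT w|lborel. f (w - h n) * of_real (\<sigma> w))"
      by (subst lborel_integral_real_affine[where c=1 and t="- h n"]) (auto simp: algebra_simps)
    also have "((LINT w|lborel. f (w - h n) * of_real (\<sigma> w)) - (LINT w|lborel. f w * of_real (\<sigma> w))) / of_real (h n)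
       = (LINT w|lborel. (f (w - h n) * of_real (\<sigma> w) - f w * of_real (\<sigma> w)) / of_real (h n))"
      using i1 i3 by simp
    also have "\<dots> = ?r n" by (simp add: algebra_simps diff_divide_distrib)
    finally show ?thesis .
  qed
  have lim1: "?l \<longlonglongrightarrow> (LINT w|lborel. f w * of_real (\<tau> w))"
  proof (rule integral_dominated_convergence[where w="\<lambda>w. B * L * indicator {-(R'+1)..R'+1} w"])
    show "integrable lborel (\<lambda>w. B * L * indicator {-(R'+1)..R'+1} w)" by (rule integrable_const_Icc)
    show "AE w in lborel. (\<lambda>n. f w * of_real ((\<sigma> (w + h n) - \<sigma> w) / h n)) \<longlonglongrightarrow> f w * of_real (\<tau> w)"
      using der
    proof eventually_elim
      case (elim w)
      then have "((\<lambda>t. (\<sigma> (w + t) - \<sigma> w) / t) \<longlongrightarrow> \<tau> w) (at 0)" by (simp add: DERIV_def)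
      then have "(\<lambda>n. (\<sigma> (w + h n) - \<sigma> w) / h n) \<longlonglongrightarrow> \<tau> w" by (rule filterlim_compose[OF _ h_at])
      then show ?case by (intro tendsto_intros)
    qed
    show "AE w in lborel. norm (f w * of_real ((\<sigma> (w + h n) - \<sigma> w) / h n)) \<le> B * L * indicator {-(R'+1)..R'+1} w" for n
    proof (rule AE_I2)
      fix w
      have "\<bar>(\<sigma> (w + h n) - \<sigma> w) / h n\<bar> \<le> L * indicator {-(R'+1)..R'+1} w"
      proof (cases "w \<in> {-(R'+1)..R'+1}")
        case True
        then show ?thesis using lip[of "w + h n" w] h0[of n] by (simp add: abs_divide divide_le_eq)
      next
        case False
        then have "\<sigma> w = 0" "\<sigma> (w + h n) = 0" using h0[of n] by (auto intro!: supp' simp: R'_def)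
        then show ?thesis using L0 by simp
      qed
      then have "norm (f w) * \<bar>(\<sigma> (w + h n) - \<sigma> w) / h n\<bar> \<le> B * (L * indicator {-(R'+1)..R'+1} w)"
        using B0 bd[of w] by (intro mult_mono) auto
      then show "norm (f w * of_real ((\<sigma> (w + h n) - \<sigma> w) / h n)) \<le> B * L * indicator {-(R'+1)..R'+1} w"
        by (simp only: norm_mult norm_of_real mult.assoc)
    qed
  qed auto
  have lim2: "?r \<longlonglongrightarrow> (LINT w|lborel. - f' w * of_real (\<sigma> w))"
  proof (rule integral_dominated_convergence[where w="\<lambda>w. B' * C * indicator {-R'..R'} w"])
    show "integrable lborel (\<lambda>w. B' * C * indicator {-R'..R'} w)" by (rule integrable_const_Icc)
    show "AE w in lborel. (\<lambda>n. ((f (w - h n) - f w) / of_real (h n)) * of_real (\<sigma> w)) \<longlonglongrightarrow> - f' w * of_real (\<sigma> w)"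
    proof (rule AE_I2)
      fix w
      have "(\<lambda>n. complex_of_real (w - h n)) \<longlonglongrightarrow> complex_of_real (w - 0)"
        using h_at unfolding filterlim_at by (intro tendsto_of_real tendsto_diff tendsto_const) simp
      then have hm: "filterlim (\<lambda>n. complex_of_real (w - h n)) (at (of_real w)) sequentially"
        unfolding filterlim_at using h0(1) by (auto simp: less_imp_neq[symmetric])
      have "((\<lambda>y. (F y - F (of_real w)) / (y - of_real w)) \<longlongrightarrow> f' w) (at (of_real w))"
        using F[of w] unfolding has_field_derivative_iff .
      from filterlim_compose[OF this hm]
      have "(\<lambda>n. - ((f (w - h n) - f w) / (of_real (w - h n) - of_real w))) \<longlonglongrightarrow> - f' w"
        unfolding f_def by (rule tendsto_minus)
      then have "(\<lambda>n. (f (w - h n) - f w) / of_real (h n)) \<longlonglongrightarrow> - f' w"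
        by simp
      then show "(\<lambda>n. ((f (w - h n) - f w) / of_real (h n)) * of_real (\<sigma> w)) \<longlonglongrightarrow> - f' w * of_real (\<sigma> w)"
        by (intro tendsto_intros)
    qed
    show "AE w in lborel. norm (((f (w - h n) - f w) / of_real (h n)) * of_real (\<sigma> w)) \<le> B' * C * indicator {-R'..R'} w" for n
    proof (rule AE_I2)
      fix w
      have "norm (f (w - h n) - f w) \<le> B' * norm (w - h n - w)"
        by (rule differentiable_bound[of UNIV f "\<lambda>x h. h *\<^sub>R f' x"])
           (use f in \<open>auto simp: has_vector_derivative_def mult.commute[of B'] intro!: onorm_le mult_left_mono bd'\<close>)
      then have 1: "norm ((f (w - h n) - f w) / of_real (h n)) \<le> B'"
        using h0[of n] by (simp add: norm_divide divide_le_eq)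
      have 2: "\<bar>\<sigma> w\<bar> \<le> C * indicator {-R'..R'} w"
        using C(1)[of w] C(2) supp'[of w]
        by (cases "R' < \<bar>w\<bar>") (auto simp: indicator_def not_less abs_le_iff)
      have "norm ((f (w - h n) - f w) / of_real (h n)) * \<bar>\<sigma> w\<bar> \<le> B' * (C * indicator {-R'..R'} w)"
        using 1 2 B0 by (intro mult_mono) auto
      then show "norm (((f (w - h n) - f w) / of_real (h n)) * of_real (\<sigma> w)) \<le> B' * C * indicator {-R'..R'} w"
        by (simp only: norm_mult norm_of_real mult.assoc)
    qed
  qed auto
  have "(LINT w|lborel. f w * of_real (\<tau> w)) = (LINT w|lborel. - f' w * of_real (\<sigma> w))"
    using lim1 lim2 unfolding shift by (rule LIMSEQ_unique)
  then show ?thesis by (simp add: f_def)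
qed

section \<open>Slopes of continual diagrams and two integral forms of the transform\<close>

lemma continual_diagram_lipschitz:
  "continual_diagram \<omega> \<Longrightarrow> \<bar>\<omega> x - \<omega> y\<bar> \<le> 1 * \<bar>x - y\<bar>"
  by (simp add: continual_diagram_def)

lemma continual_diagram_continuous:
  assumes "continual_diagram \<omega>"
  shows "continuous_on UNIV \<omega>"
proof (rule lipschitz_on_continuous_on)
  show "1-lipschitz_on UNIV \<omega>"
    using continual_diagram_lipschitz[OF assms] by (auto simp: lipschitz_on_def dist_real_def)
qed

text \<open>The function \<open>\<kappa> = (1 - \<omega>')/2\<close> is a Borel version of the slope with values in [0, 1]. In its terms
  \<open>((\<omega>(w) - \<bar>w\<bar>)/2)'\<close> is the indicator of \<open>w < 0\<close> minus \<open>\<kappa>(w)\<close>.\<close>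

lemma continual_diagram_slope:
  assumes \<omega>: "continual_diagram \<omega>"
  obtains \<kappa> R where "\<kappa> \<in> borel_measurable borel" "\<And>w. 0 \<le> \<kappa> w" "\<And>w. \<kappa> w \<le> 1" "0 < R"
    "\<And>w. w < - R \<Longrightarrow> \<kappa> w = 1" "\<And>w. R < w \<Longrightarrow> \<kappa> w = 0"
    "AE w in lborel. (\<omega> has_real_derivative (1 - 2 * \<kappa> w)) (at w)"
proof -
  note lip = continual_diagram_lipschitz[OF \<omega>]
  obtain R0 where R0: "\<And>z. R0 \<le> \<bar>z\<bar> \<Longrightarrow> \<omega> z = \<bar>z\<bar>"
    using \<omega> by (auto simp: continual_diagram_def)
  define R where "R = \<bar>R0\<bar> + 1"
  have R: "\<omega> z = \<bar>z\<bar>" if "R \<le> \<bar>z\<bar>" for z using that R0[of z] by (simp add: R_def)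
  note [measurable] = borel_measurable_continuous_onI[OF continual_diagram_continuous[OF \<omega>]]
  define h where "h = (\<lambda>n::nat. 1 / real (Suc n))"
  have h0: "0 < h n" "h n \<le> 1" for n by (auto simp: h_def)
  have h_at: "filterlim h (at 0) sequentially"
    unfolding filterlim_at using LIMSEQ_inverse_real_of_nat h0(1)
    by (auto simp: h_def divide_inverse less_imp_neq[symmetric])
  \<comment> \<open>A limit along a fixed sequence of steps is Borel measurable, and it equals the
    derivative wherever that exists.\<close>
  define D where "D = (\<lambda>w. lim (\<lambda>n. (\<omega> (w + h n) - \<omega> w) / h n))"
  have D: "D w = d" if "(\<omega> has_real_derivative d) (at w)" for w d
  proof -
    have "((\<lambda>t. (\<omega> (w + t) - \<omega> w) / t) \<longlongrightarrow> d) (at 0)" using that by (simp add: DERIV_def)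
    then have "(\<lambda>n. (\<omega> (w + h n) - \<omega> w) / h n) \<longlonglongrightarrow> d" by (rule filterlim_compose[OF _ h_at])
    then show ?thesis unfolding D_def by (rule limI)
  qed
  \<comment> \<open>Clamping gives the bounds at every point, also where \<open>D\<close> is a
    meaningless default; where the derivative exists it changes nothing, because that derivative
    lies in [-1, 1].\<close>
  define \<kappa> where "\<kappa> = (\<lambda>w. min 1 (max 0 ((1 - D w) / 2)))"
  show ?thesis
  proof (rule that)
    show "\<kappa> \<in> borel_measurable borel" unfolding \<kappa>_def D_def by measurable
    show "0 \<le> \<kappa> w" "\<kappa> w \<le> 1" for w by (auto simp: \<kappa>_def)
    show "0 < R" by (simp add: R_def)
    show "\<kappa> w = 1" if "w < - R" for w
    proof -
      have "(\<omega> has_real_derivative - 1) (at w)"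
      proof (rule has_field_derivative_transform_within_open[of uminus _ _ "{..<-R}"])
        show "(uminus has_real_derivative - 1) (at w)" by (auto intro!: derivative_eq_intros)
        show "- x = \<omega> x" if "x \<in> {..<-R}" for x using R[of x] that \<open>0 < R\<close> by simp
      qed (use that in auto)
      then show ?thesis by (simp add: \<kappa>_def D)
    qed
    show "\<kappa> w = 0" if "R < w" for w
    proof -
      have "(\<omega> has_real_derivative 1) (at w)"
      proof (rule has_field_derivative_transform_within_open[of "\<lambda>x. x" _ _ "{R<..}"])
        show "((\<lambda>x. x) has_real_derivative 1) (at w)" by (auto intro!: derivative_eq_intros)
        show "x = \<omega> x" if "x \<in> {R<..}" for x using R[of x] that \<open>0 < R\<close> by simp
      qed (use that in auto)
      then show ?thesis by (simp add: \<kappa>_def D)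
    qed
    have "AE w in lebesgue. \<omega> differentiable (at w)"
      using lipschitz_non_differentiable_negligible[OF lip]
      by (auto simp: negligible_iff_null_sets completion.AE_iff_null_sets intro!: AE_I' )
    then have "AE w in lborel. \<omega> differentiable (at w)" by (simp add: AE_completion_iff)
    then show "AE w in lborel. (\<omega> has_real_derivative (1 - 2 * \<kappa> w)) (at w)"
    proof eventually_elim
      case (elim w)
      then obtain d where d: "(\<omega> has_real_derivative d) (at w)" by (auto simp: real_differentiable_def)
      have "\<bar>d\<bar> \<le> 1"
      proof (rule tendsto_upperbound)
        show "((\<lambda>t. \<bar>(\<omega> (w + t) - \<omega> w) / t\<bar>) \<longlongrightarrow> \<bar>d\<bar>) (at 0)"
          using d by (intro tendsto_rabs) (simp add: DERIV_def)
        show "\<forall>\<^sub>F t in at 0. \<bar>(\<omega> (w + t) - \<omega> w) / t\<bar> \<le> 1"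
          using lip[of "w + t" w for t]
          by (auto simp: eventually_at_filter abs_divide divide_le_eq intro!: always_eventually)
      qed simp
      then have "1 - 2 * \<kappa> w = d" by (auto simp: \<kappa>_def D[OF d] min_def max_def field_simps)
      then show ?case using d by simp
    qed
  qed
qed

lemma inverse_shift_has_field_derivative:
  assumes "Im z \<noteq> 0"
  shows "((\<lambda>y. 1 / (z - y)) has_field_derivative 1 / (z - of_real w)\<^sup>2) (at (of_real w))"
proof -
  have "z - of_real w \<noteq> 0" using assms by (auto simp: complex_eq_iff)
  then show ?thesis
    by (auto intro!: derivative_eq_intros simp: power2_eq_square)
qed

lemma norm_inverse_shift_le:
  assumes "Im z \<noteq> 0"
  shows "norm (1 / (z - complex_of_real w)) \<le> 1 / \<bar>Im z\<bar>"
  using abs_Im_le_cmod[of "z - of_real w"] assms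
  by (auto simp: norm_divide intro!: divide_left_mono mult_pos_pos)

text \<open>The first form exhibits a slope density, which serves for the existence of the measure
  and for the argument of the transform. The second, obtained by parts, involves only values of
  \<open>\<omega>\<close>, so it is stable under small uniform perturbations.\<close>

lemma cauchy_transform_slope:
  assumes \<omega>: "continual_diagram \<omega>" and z: "Im z \<noteq> 0"
    and [measurable]: "\<kappa> \<in> borel_measurable borel"
    and der: "AE w in lborel. (\<omega> has_real_derivative (1 - 2 * \<kappa> w)) (at w)"
  shows "cauchy_transform \<omega> z = exp (LINT w|lborel. 1 / (z - of_real w) * of_real (\<kappa> w - indicator {..<0} w)) / z"
    and "cauchy_transform \<omega> z = exp (LINT w|lborel. 1 / (z - of_real w)\<^sup>2 * of_real ((\<omega> w - \<bar>w\<bar>) / 2)) / z"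
proof -
  note lip = continual_diagram_lipschitz[OF \<omega>]
  obtain R where R: "\<And>z. R \<le> \<bar>z\<bar> \<Longrightarrow> \<omega> z = \<bar>z\<bar>"
    using \<omega> by (auto simp: continual_diagram_def)
  note [measurable] = borel_measurable_continuous_onI[OF continual_diagram_continuous[OF \<omega>]]
  define \<sigma> where "\<sigma> = (\<lambda>u. (\<omega> u - \<bar>u\<bar>) / 2)"
  have slip: "\<bar>\<sigma> x - \<sigma> y\<bar> \<le> 1 * \<bar>x - y\<bar>" for x y
  proof -
    have e: "\<sigma> x - \<sigma> y = ((\<omega> x - \<omega> y) - (\<bar>x\<bar> - \<bar>y\<bar>)) / 2" by (simp add: \<sigma>_def field_simps)
    moreover have "\<bar>(\<omega> x - \<omega> y) - (\<bar>x\<bar> - \<bar>y\<bar>)\<bar> \<le> \<bar>x - y\<bar> + \<bar>x - y\<bar>"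
      using abs_triangle_ineq4[of "\<omega> x - \<omega> y" "\<bar>x\<bar> - \<bar>y\<bar>"] lip[of x y] abs_triangle_ineq3[of x y] by linarith
    ultimately show ?thesis unfolding e by (simp add: abs_divide)
  qed
  have "AE w in lborel. w \<noteq> (0::real)" by (rule AE_lborel_singleton)
  with der have d\<sigma>: "AE w in lborel. (\<sigma> has_real_derivative (indicator {..<0} w - \<kappa> w)) (at w)"
  proof eventually_elim
    case (elim w)
    have "((\<lambda>u. \<bar>u\<bar>) has_real_derivative sgn w) (at w)"
    proof (cases "w < 0")
      case True
      have "((\<lambda>u. \<bar>u\<bar>) has_real_derivative - 1) (at w)"
        by (rule has_field_derivative_transform_within_open[OF DERIV_minus[OF DERIV_ident], of "{..<0}"])
           (use True in auto)
      then show ?thesis using True by simp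
    next
      case False
      with elim have "0 < w" by simp
      have "((\<lambda>u. \<bar>u\<bar>) has_real_derivative 1) (at w)"
        by (rule has_field_derivative_transform_within_open[OF DERIV_ident, of "{0<..}"])
           (use \<open>0 < w\<close> in auto)
      then show ?thesis using \<open>0 < w\<close> by simp
    qed
    with elim(1) have "(\<sigma> has_real_derivative ((1 - 2 * \<kappa> w) - sgn w) / 2) (at w)"
      unfolding \<sigma>_def by (auto intro!: derivative_eq_intros)
    moreover have "((1 - 2 * \<kappa> w) - sgn w) / 2 = indicator {..<0} w - \<kappa> w"
      using elim(2) by (auto simp: sgn_if indicator_def field_simps)
    ultimately show ?case by simp
  qed
  have "AE w in lborel. indicator {..<0} w - \<kappa> w = deriv \<sigma> w"
    using d\<sigma> by eventually_elim (simp add: DERIV_imp_deriv)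
  then have ae: "AE w in lebesgue. indicator {..<0} w - \<kappa> w = deriv \<sigma> w"
    by (rule AE_completion)
  have [measurable]: "(\<lambda>w. indicator {..<0} w - \<kappa> w) \<in> borel_measurable lebesgue"
    by (intro measurable_completion) simp
  \<comment> \<open>\<open>deriv\<close> takes unspecified values on the exceptional null set, so
    measurability is inherited from the Borel version, with respect to the completed
    measure.\<close>
  have [measurable]: "deriv \<sigma> \<in> borel_measurable lebesgue"
    using ae by (rule borel_measurable_AE[rotated]) measurable
  have [measurable]: "(\<lambda>w. 1 / (z - complex_of_real w)) \<in> borel_measurable lebesgue"
    by (intro measurable_completion) simp
  have "(LINT w|lebesgue. (1 / (z - of_real w)) * of_real (deriv \<sigma> w))
     = (LINT w|lebesgue. (1 / (z - of_real w)) * of_real (indicator {..<0} w - \<kappa> w))"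
  proof (rule integral_cong_AE)
    show "AE w in lebesgue. (1 / (z - of_real w)) * of_real (deriv \<sigma> w)
      = (1 / (z - of_real w)) * of_real (indicator {..<0} w - \<kappa> w)"
      using ae by eventually_elim (simp only:)
  qed measurable
  also have "\<dots> = (LINT w|lborel. (1 / (z - of_real w)) * of_real (indicator {..<0} w - \<kappa> w))"
    by (rule integral_completion) measurable
  finally have eq: "(LINT w|lebesgue. (1 / (z - of_real w)) * of_real (deriv \<sigma> w)) = \<dots>" .
  have "- (LINT w|lborel. (1 / (z - of_real w)) * of_real (indicator {..<0} w - \<kappa> w))
     = (LINT w|lborel. - ((1 / (z - of_real w)) * of_real (indicator {..<0} w - \<kappa> w)))"
    by simp
  also have "\<dots> = (LINT w|lborel. 1 / (z - of_real w) * of_real (\<kappa> w - indicator {..<0} w))"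
    by (rule Bochner_Integration.integral_cong) (auto simp: algebra_simps)
  finally show "cauchy_transform \<omega> z = exp (LINT w|lborel. 1 / (z - of_real w) * of_real (\<kappa> w - indicator {..<0} w)) / z"
    using eq unfolding cauchy_transform_def \<sigma>_def by simp
  have "(LINT w|lborel. (1 / (z - of_real w)) * of_real (indicator {..<0} w - \<kappa> w))
     = - (LINT w|lborel. 1 / (z - of_real w)\<^sup>2 * of_real (\<sigma> w))"
  proof (rule lipschitz_integral_by_parts[OF slip _ _ d\<sigma> inverse_shift_has_field_derivative[OF z] norm_inverse_shift_le[OF z]])
    show "\<sigma> w = 0" if "R < \<bar>w\<bar>" for w using R[of w] that by (simp add: \<sigma>_def)
    show "norm (1 / (z - complex_of_real w)\<^sup>2) \<le> (1 / \<bar>Im z\<bar>)\<^sup>2" for w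
      using power_mono[OF norm_inverse_shift_le[OF z, of w], of 2]
      by (simp add: norm_divide norm_power power_divide)
  qed auto
  then show "cauchy_transform \<omega> z = exp (LINT w|lborel. 1 / (z - of_real w)\<^sup>2 * of_real ((\<omega> w - \<bar>w\<bar>) / 2)) / z"
    using eq unfolding cauchy_transform_def \<sigma>_def by simp
qed

section \<open>Existence of the transition measure\<close>

lemma inverse_shift_measurable [measurable]:
  "(\<lambda>w. 1 / (z - complex_of_real w)) \<in> borel_measurable borel"
  by measurable

lemma set_integrable_bounded_Icc:
  fixes f :: "real \<Rightarrow> 'a::{banach, second_countable_topology}"
  assumes [measurable]: "f \<in> borel_measurable borel" and B: "\<And>w. norm (f w) \<le> B"
  shows "set_integrable lborel {p..q} f"
  unfolding set_integrable_def
proof (rule integrable_bounded_support[of _ B "max \<bar>p\<bar> \<bar>q\<bar>"])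
  have "0 \<le> B" using B[of 0] norm_ge_zero order_trans by blast
  then show "norm (indicator {p..q} w *\<^sub>R f w) \<le> B" for w
    using B[of w] by (auto simp: indicator_def)
qed (auto simp: indicator_def)

lemma set_integral_Icc_split:
  fixes f :: "real \<Rightarrow> 'a::{banach, second_countable_topology}"
  assumes [measurable]: "f \<in> borel_measurable borel" and B: "\<And>w. norm (f w) \<le> B"
    and "p \<le> c" "c \<le> q"
  shows "(LINT w:{p..q}|lborel. f w) = (LINT w:{p..c}|lborel. f w) + (LINT w:{c..q}|lborel. f w)"
proof -
  have "(LINT w:{p..q}|lborel. f w) = (LINT w|lborel. indicator {p..c} w *\<^sub>R f w + indicator {c..q} w *\<^sub>R f w)"
    unfolding set_lebesgue_integral_def
  proof (rule integral_cong_AE)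
    show "AE w in lborel. indicator {p..q} w *\<^sub>R f w = indicator {p..c} w *\<^sub>R f w + indicator {c..q} w *\<^sub>R f w"
      using AE_lborel_singleton[of c]
      by eventually_elim (use assms(3,4) in \<open>auto simp: indicator_def\<close>)
  qed auto
  also have "\<dots> = (LINT w:{p..c}|lborel. f w) + (LINT w:{c..q}|lborel. f w)"
    using set_integrable_bounded_Icc[OF assms(1) B]
    unfolding set_lebesgue_integral_def set_integrable_def by (intro Bochner_Integration.integral_add)
  finally show ?thesis .
qed

text \<open>For nonreal z the points z - w avoid the cut of the principal logarithm, so -Ln(z - w)
  is a primitive. Exponentiating turns a stretch where the slope density is 1 into a rational factor
  with zero p and pole q.\<close>

lemma exp_integral_inverse_shift:
  assumes z: "Im z \<noteq> 0" and pq: "p \<le> q"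
  shows "exp (LINT w:{p..q}|lborel. 1 / (z - of_real w)) = (z - of_real p) / (z - of_real q)"
proof -
  have ne: "z - of_real w \<noteq> 0" and nr: "z - of_real w \<notin> \<real>\<^sub>\<le>\<^sub>0" for w
    using z by (auto simp: complex_eq_iff complex_nonpos_Reals_iff)
  have eq: "(LINT w|lborel. indicator {p..q} w *\<^sub>R (1 / (z - of_real w))) = - Ln (z - of_real q) - - Ln (z - of_real p)"
  proof (rule integral_FTC_atLeastAtMost[OF pq])
    show "((\<lambda>w. - Ln (z - complex_of_real w)) has_vector_derivative 1 / (z - of_real w)) (at w within {p..q})" for w
    proof -
      have "((\<lambda>y. - Ln (z - y)) has_field_derivative 1 / (z - of_real w)) (at (of_real w))"
        using nr[of w] ne[of w] by (auto intro!: derivative_eq_intros simp: field_simps)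
      then show ?thesis by (rule has_vector_derivative_at_within[OF has_vector_derivative_real_field])
    qed
    show "continuous_on {p..q} (\<lambda>w. 1 / (z - complex_of_real w))"
      using ne by (intro continuous_intros) auto
  qed
  show ?thesis
    unfolding set_lebesgue_integral_def eq using ne by (simp add: exp_diff exp_minus field_simps)
qed

lemma inverse_shift_lipschitz:
  assumes z: "Im z \<noteq> 0"
  shows "norm (1 / (z - complex_of_real w) - 1 / (z - of_real p)) \<le> \<bar>w - p\<bar> / (Im z)\<^sup>2"
proof -
  have ne: "z - of_real w \<noteq> 0" for w using z by (auto simp: complex_eq_iff)
  have "1 / (z - complex_of_real w) - 1 / (z - of_real p) = of_real (w - p) * (1 / (z - of_real w)) * (1 / (z - of_real p))"
    using ne[of w] ne[of p] by (simp add: field_simps)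
  then have "norm (1 / (z - complex_of_real w) - 1 / (z - of_real p)) =
      \<bar>w - p\<bar> * norm (1 / (z - complex_of_real w)) * norm (1 / (z - complex_of_real p))"
    by (simp only: norm_mult norm_of_real)
  also have "\<dots> \<le> \<bar>w - p\<bar> * (1 / \<bar>Im z\<bar>) * (1 / \<bar>Im z\<bar>)"
    using norm_inverse_shift_le[OF z] by (intro mult_mono) auto
  also have "\<dots> = \<bar>w - p\<bar> / (Im z)\<^sup>2" by (simp add: power2_eq_square flip: abs_mult)
  finally show ?thesis .
qed

text \<open>The point \<open>y\<close> is chosen so that [y, q] has the same mass as
  \<open>\<kappa>\<close> on the cell. The difference \<open>g\<close> then has integral 0, so the
  kernel may be replaced by its deviation from its value at p. This gains a second factor q - p, and
  the errors of about n cells of length of order 1/n still tend to 0 in total.\<close>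

lemma cell_approximation:
  fixes \<kappa> :: "real \<Rightarrow> real"
  assumes [measurable]: "\<kappa> \<in> borel_measurable borel" and \<kappa>: "\<And>w. 0 \<le> \<kappa> w" "\<And>w. \<kappa> w \<le> 1"
    and pq: "p \<le> q" and z: "Im z \<noteq> 0"
  defines "y \<equiv> q - (LINT w:{p..q}|lborel. \<kappa> w)"
  shows "p \<le> y" "y \<le> q"
    and "norm ((LINT w:{p..q}|lborel. of_real (\<kappa> w) * (1 / (z - of_real w))) -
      (LINT w:{y..q}|lborel. 1 / (z - of_real w))) \<le> (q - p)\<^sup>2 / (Im z)\<^sup>2"
proof -
  have i1: "integrable lborel (\<lambda>w. indicator {p..q} w * \<kappa> w)"
    using set_integrable_bounded_Icc[of \<kappa> 1 p q] \<kappa> by (simp add: set_integrable_def)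
  have "0 \<le> (LINT w:{p..q}|lborel. \<kappa> w)"
    unfolding set_lebesgue_integral_def using \<kappa> by (intro Bochner_Integration.integral_nonneg) auto
  then show yq: "y \<le> q" by (simp add: y_def)
  have "(LINT w:{p..q}|lborel. \<kappa> w) \<le> (LINT w|lborel. indicator {p..q} w)"
    unfolding set_lebesgue_integral_def
    by (rule integral_mono) (use i1 \<kappa> integrable_const_Icc[of 1 p q] in \<open>auto simp: indicator_def\<close>)
  then show py: "p \<le> y" using pq by (simp add: y_def)
  define f where "f = (\<lambda>w. 1 / (z - complex_of_real w))"
  have [measurable]: "f \<in> borel_measurable borel" by (simp add: f_def)
  have fb: "norm (f w) \<le> 1 / \<bar>Im z\<bar>" for w unfolding f_def by (rule norm_inverse_shift_le[OF z])
  define g where "g = (\<lambda>w. indicator {p..q} w * \<kappa> w - indicator {y..q} w)"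
  have gb: "\<bar>g w\<bar> \<le> indicator {p..q} w" for w
    using \<kappa>[of w] py by (auto simp: g_def indicator_def)
  have [measurable]: "g \<in> borel_measurable borel" by (simp add: g_def)
  have i2: "integrable lborel (indicator {y..q} :: real \<Rightarrow> real)" using integrable_const_Icc[of 1 y q] by simp
  have ig: "integrable lborel g" unfolding g_def using i1 i2 by auto
  have "(LINT w|lborel. g w) = (LINT w:{p..q}|lborel. \<kappa> w) - (q - y)"
    unfolding g_def set_lebesgue_integral_def using i1 i2 yq by simp
  then have g0: "(LINT w|lborel. g w) = 0" by (simp add: y_def)
  have igf: "integrable lborel (\<lambda>w. of_real (g w) * f w)"
  proof (rule integrable_bounded_support[of _ "1 / \<bar>Im z\<bar>" "max \<bar>p\<bar> \<bar>q\<bar>"])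
    show "norm (of_real (g w) * f w) \<le> 1 / \<bar>Im z\<bar>" for w
    proof -
      have "\<bar>g w\<bar> * norm (f w) \<le> 1 * (1 / \<bar>Im z\<bar>)"
        using order_trans[OF gb[of w], of 1] fb[of w] by (intro mult_mono) (auto simp: indicator_def)
      then show ?thesis by (simp add: norm_mult)
    qed
    show "of_real (g w) * f w = 0" if "max \<bar>p\<bar> \<bar>q\<bar> < \<bar>w\<bar>" for w
    proof -
      have "w \<notin> {p..q}" using that by auto
      then show ?thesis using gb[of w] by simp
    qed
  qed simp
  have "(LINT w:{p..q}|lborel. of_real (\<kappa> w) * f w) - (LINT w:{y..q}|lborel. f w)
    = (LINT w|lborel. indicator {p..q} w *\<^sub>R (of_real (\<kappa> w) * f w) - indicator {y..q} w *\<^sub>R f w)"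
    unfolding set_lebesgue_integral_def
  proof (rule Bochner_Integration.integral_diff[symmetric])
    show "integrable lborel (\<lambda>w. indicator {p..q} w *\<^sub>R (complex_of_real (\<kappa> w) * f w))"
      unfolding set_integrable_def[symmetric]
      using mult_mono[OF \<kappa>(2) fb] \<kappa> by (intro set_integrable_bounded_Icc[of _ "1 * (1 / \<bar>Im z\<bar>)"]) (auto simp: norm_mult)
    show "integrable lborel (\<lambda>w. indicator {y..q} w *\<^sub>R f w)"
      unfolding set_integrable_def[symmetric] using fb by (intro set_integrable_bounded_Icc) auto
  qed
  also have "\<dots> = (LINT w|lborel. of_real (g w) * f w)"
    by (rule Bochner_Integration.integral_cong) (auto simp: g_def scaleR_conv_of_real algebra_simps)
  also have "\<dots> = (LINT w|lborel. of_real (g w) * f w) - (LINT w|lborel. of_real (g w) * f p)"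
    using g0 ig by simp
  also have "\<dots> = (LINT w|lborel. of_real (g w) * f w - of_real (g w) * f p)"
    using ig igf by (intro Bochner_Integration.integral_diff[symmetric]) auto
  also have "\<dots> = (LINT w|lborel. of_real (g w) * (f w - f p))" by (simp add: algebra_simps)
  also have "norm \<dots> \<le> (LINT w|lborel. (q - p) / (Im z)\<^sup>2 * indicator {p..q} w)"
  proof (rule Bochner_Integration.integral_norm_bound_integral)
    show "integrable lborel (\<lambda>w. of_real (g w) * (f w - f p))"
      using Bochner_Integration.integrable_diff[OF igf, of "\<lambda>w. of_real (g w) * f p"] ig by (simp add: algebra_simps)
    show "norm (of_real (g w) * (f w - f p)) \<le> (q - p) / (Im z)\<^sup>2 * indicator {p..q} w" for w
    proof (cases "w \<in> {p..q}")
      case True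
      have "norm (f w - f p) \<le> \<bar>w - p\<bar> / (Im z)\<^sup>2" unfolding f_def by (rule inverse_shift_lipschitz[OF z])
      also have "\<dots> \<le> (q - p) / (Im z)\<^sup>2" using True by (intro divide_right_mono) auto
      finally have "\<bar>g w\<bar> * norm (f w - f p) \<le> 1 * ((q - p) / (Im z)\<^sup>2)"
        using gb[of w] True by (intro mult_mono) auto
      then show ?thesis using True by (simp add: norm_mult)
    next
      case False then show ?thesis using gb[of w] by simp
    qed
  qed (rule integrable_const_Icc)
  also have "\<dots> = (q - p)\<^sup>2 / (Im z)\<^sup>2" using pq by (simp add: power2_eq_square)
  finally show "norm ((LINT w:{p..q}|lborel. of_real (\<kappa> w) * (1 / (z - of_real w))) -
      (LINT w:{y..q}|lborel. 1 / (z - of_real w))) \<le> (q - p)\<^sup>2 / (Im z)\<^sup>2"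
    unfolding f_def .
qed

text \<open>Since \<open>u \<le> y \<le> x\<close> for all atoms u, the partial fractions of \<open>(z - y)/((z - u)(z - x))\<close> have nonnegative
  coefficients with sum 1: moving the fraction \<open>(x - y)/(x - u)\<close> of the mass of u to x multiplies the Cauchy
  transform by \<open>(z - y)/(z - x)\<close>.\<close>

lemma pmf_multiply_factor:
  fixes p :: "real pmf"
  assumes fin: "finite (set_pmf p)" and sub: "set_pmf p \<subseteq> {..x0}" and x: "x0 \<le> y" "y \<le> x" "x0 < x"
  obtains p' where "finite (set_pmf p')" "set_pmf p' \<subseteq> insert x (set_pmf p)"
    "\<And>z. Im z \<noteq> 0 \<Longrightarrow> measure_pmf.expectation p' (\<lambda>u. 1 / (z - of_real u)) =
       measure_pmf.expectation p (\<lambda>u. 1 / (z - of_real u)) * ((z - of_real y) / (z - of_real x))"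
proof -
  define f where "f = (\<lambda>u. map_pmf (\<lambda>b. if b then x else u) (bernoulli_pmf ((x - y) / (x - u))))"
  have ff: "set_pmf (f u) \<subseteq> {x, u}" for u unfolding f_def by auto
  show ?thesis
  proof (rule that[of "bind_pmf p f"])
    have "set_pmf (bind_pmf p f) \<subseteq> insert x (set_pmf p)" using ff by auto
    then show "set_pmf (bind_pmf p f) \<subseteq> insert x (set_pmf p)" "finite (set_pmf (bind_pmf p f))"
      using fin by (auto intro: finite_subset)
    fix z :: complex assume z: "Im z \<noteq> 0"
    have ne: "z - of_real w \<noteq> 0" for w using z by (auto simp: complex_eq_iff)
    define g where "g = (\<lambda>u. 1 / (z - complex_of_real u))"
    have step: "measure_pmf.expectation (f u) g = g u * ((z - of_real y) / (z - of_real x))" if "u \<in> set_pmf p" for u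
    proof -
      have u: "u \<le> x0" using sub that by auto
      define t where "t = (x - y) / (x - u)"
      have t: "0 \<le> t" "t \<le> 1" using u x by (auto simp: t_def)
      have "measure_pmf.expectation (f u) g = (\<Sum>b\<in>UNIV. pmf (bernoulli_pmf t) b *\<^sub>R g (if b then x else u))"
        unfolding f_def by (simp add: t_def[symmetric] integral_measure_pmf[of UNIV])
      also have "\<dots> = of_real t * g x + of_real (1 - t) * g u"
        using t by (simp add: UNIV_bool scaleR_conv_of_real)
      also have "\<dots> = g u * ((z - of_real y) / (z - of_real x))"
      proof -
        have t': "complex_of_real t * (of_real x - of_real u) = of_real x - of_real y"
        proof -
          have "t * (x - u) = x - y" using u x by (simp add: t_def)
          then show ?thesis by (metis of_real_diff of_real_mult)
        qed
        have "of_real t * (z - of_real u) + of_real (1 - t) * (z - of_real x) = z - of_real y"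
          using t' by (simp add: algebra_simps)
        then show ?thesis using ne[of x] ne[of u] by (simp add: g_def field_simps)
      qed
      finally show ?thesis .
    qed
    have "measure_pmf.expectation (bind_pmf p f) g = (\<Sum>a\<in>set_pmf p. pmf p a *\<^sub>R measure_pmf.expectation (f a) g)"
      using fin by (intro pmf_expectation_bind) (auto intro: finite_subset[OF ff])
    also have "\<dots> = (\<Sum>a\<in>set_pmf p. pmf p a *\<^sub>R g a) * ((z - of_real y) / (z - of_real x))"
      unfolding sum_distrib_right by (intro sum.cong refl) (simp only: step scaleR_conv_of_real mult.assoc)
    also have "(\<Sum>a\<in>set_pmf p. pmf p a *\<^sub>R g a) = measure_pmf.expectation p g"
      using fin by (intro integral_measure_pmf[symmetric]) auto
    finally show "measure_pmf.expectation (bind_pmf p f) (\<lambda>u. 1 / (z - of_real u)) =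
       measure_pmf.expectation p (\<lambda>u. 1 / (z - of_real u)) * ((z - of_real y) / (z - of_real x))"
      unfolding g_def .
  qed
qed

text \<open>These are the transition measures of zigzag diagrams with minima \<open>x k\<close> and
  maxima \<open>y k\<close>. Each cell multiplies the transform by one factor, realized by moving
  mass to a new rightmost atom. A maximum may coincide with a neighbouring minimum, because the
  slope density may be constantly 0 or 1 on a cell.\<close>

lemma discrete_cauchy_transform:
  fixes x y :: "nat \<Rightarrow> real"
  assumes "\<And>k. x k < x (Suc k)" "\<And>k. x k \<le> y k" "\<And>k. y k \<le> x (Suc k)"
  shows "\<exists>p. finite (set_pmf p) \<and> set_pmf p \<subseteq> {x 0..x n} \<and>
    (\<forall>z. Im z \<noteq> 0 \<longrightarrow> measure_pmf.expectation p (\<lambda>u. 1 / (z - of_real u)) =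
      exp (\<Sum>k<n. LINT w:{y k..x (Suc k)}|lborel. 1 / (z - of_real w)) / (z - of_real (x 0)))"
proof (induction n)
  case 0
  show ?case by (rule exI[of _ "return_pmf (x 0)"]) auto
next
  case (Suc n)
  then obtain p where p: "finite (set_pmf p)" "set_pmf p \<subseteq> {x 0..x n}"
    "\<And>z. Im z \<noteq> 0 \<Longrightarrow> measure_pmf.expectation p (\<lambda>u. 1 / (z - of_real u)) =
      exp (\<Sum>k<n. LINT w:{y k..x (Suc k)}|lborel. 1 / (z - of_real w)) / (z - of_real (x 0))" by blast
  from p(2) have "set_pmf p \<subseteq> {..x n}" by auto
  from pmf_multiply_factor[OF p(1) this assms(2,3,1)] obtain p' where p':
    "finite (set_pmf p')" "set_pmf p' \<subseteq> insert (x (Suc n)) (set_pmf p)"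
    "\<And>z. Im z \<noteq> 0 \<Longrightarrow> measure_pmf.expectation p' (\<lambda>u. 1 / (z - of_real u)) =
       measure_pmf.expectation p (\<lambda>u. 1 / (z - of_real u)) * ((z - of_real (y n)) / (z - of_real (x (Suc n))))"
    by blast
  have "x 0 \<le> x n" using assms(1) by (intro lift_Suc_mono_le[of x 0 n]) (auto simp: less_imp_le)
  moreover note assms(1)[of n]
  ultimately have "set_pmf p' \<subseteq> {x 0..x (Suc n)}" using p(2) p'(2) by fastforce
  moreover have "measure_pmf.expectation p' (\<lambda>u. 1 / (z - of_real u)) =
      exp (\<Sum>k<Suc n. LINT w:{y k..x (Suc k)}|lborel. 1 / (z - of_real w)) / (z - of_real (x 0))" if "Im z \<noteq> 0" for z
    unfolding p'(3)[OF that] p(3)[OF that] sum.lessThan_Suc exp_add exp_integral_inverse_shift[OF that assms(3)[of n]] by simp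
  ultimately show ?case using p'(1) by blast
qed

text \<open>On each cell \<open>\<kappa>\<close> is replaced by the indicator of a right subinterval of the same mass; the resulting
  discrete measures have a weak limit by Helly's theorem.\<close>

lemma exists_cauchy_transform_slope_Icc:
  fixes \<kappa> :: "real \<Rightarrow> real"
  assumes \<kappa>m [measurable]: "\<kappa> \<in> borel_measurable borel" and \<kappa>: "\<And>w. 0 \<le> \<kappa> w" "\<And>w. \<kappa> w \<le> 1" and R: "0 < R"
  shows "\<exists>M. real_distribution M \<and> (\<forall>z. Im z \<noteq> 0 \<longrightarrow> (LINT x|M. 1 / (z - of_real x)) =
    exp (LINT w:{-R..R}|lborel. of_real (\<kappa> w) * (1 / (z - of_real w))) / (z + of_real R))"
proof -
  \<comment> \<open>There are n + 1 equal cells, so the index n = 0 causes no division by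
    zero.\<close>
  define x where "x = (\<lambda>n k. - R + real k * (2 * R / real (Suc n)))"
  define y where "y = (\<lambda>n k. x n (Suc k) - (LINT w:{x n k..x n (Suc k)}|lborel. \<kappa> w))"
  define S where "S = (\<lambda>n z. \<Sum>k<Suc n. LINT w:{y n k..x n (Suc k)}|lborel. 1 / (z - complex_of_real w))"
  define I where "I = (\<lambda>z. LINT w:{-R..R}|lborel. complex_of_real (\<kappa> w) * (1 / (z - of_real w)))"
  have xs: "x n (Suc k) - x n k = 2 * R / real (Suc n)" for n k
    unfolding x_def of_nat_Suc[of k] by (simp add: distrib_right add_divide_distrib)
  have x1: "x n k < x n (Suc k)" for n k
  proof -
    have "0 < 2 * R / real (Suc n)" using R by simp
    then show ?thesis using xs[of n k] by linarith
  qed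
  have x0: "x n 0 = - R" and xn: "x n (Suc n) = R" for n by (simp_all add: x_def del: of_nat_Suc)
  have y1: "x n k \<le> y n k" "y n k \<le> x n (Suc k)" for n k
    unfolding y_def using cell_approximation(1,2)[OF \<kappa>m \<kappa> less_imp_le[OF x1], of \<i>] by auto
  have "\<forall>n. \<exists>p. finite (set_pmf p) \<and> set_pmf p \<subseteq> {-R..R} \<and>
    (\<forall>z. Im z \<noteq> 0 \<longrightarrow> measure_pmf.expectation p (\<lambda>u. 1 / (z - of_real u)) = exp (S n z) / (z + of_real R))"
    using discrete_cauchy_transform[of "x n" "y n" "Suc n" for n, OF x1 y1] unfolding S_def x0 xn by simp
  then obtain p where p: "\<And>n. finite (set_pmf (p n))" "\<And>n. set_pmf (p n) \<subseteq> {-R..R}"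
    "\<And>n z. Im z \<noteq> 0 \<Longrightarrow> measure_pmf.expectation (p n) (\<lambda>u. 1 / (z - of_real u)) = exp (S n z) / (z + of_real R)"
    by metis
  \<comment> \<open>A \<open>pmf\<close> lives on the discrete sigma-algebra; its image under the
    identity lives on the Borel sets, as Helly's theorem requires.\<close>
  define \<mu> where "\<mu> = (\<lambda>n. distr (measure_pmf (p n)) borel (\<lambda>x. x))"
  have rd: "real_distribution (\<mu> n)" for n
    unfolding \<mu>_def by (rule prob_space.real_distribution_distr[OF measure_pmf.prob_space_axioms]) simp
  have tight: "tight \<mu>" unfolding tight_def
  proof (intro conjI allI impI)
    fix \<epsilon> :: real assume "\<epsilon> > 0"
    \<comment> \<open>Tightness is stated with half-open intervals, hence the margin that keeps an
      atom at -R inside.\<close>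
    have "measure (\<mu> n) {-R-1<..R} = 1" for n
    proof -
      have "measure (\<mu> n) {-R-1<..R} = measure (measure_pmf (p n)) {-R-1<..R}"
        unfolding \<mu>_def by (subst measure_distr) auto
      also have "\<dots> = 1"
        using p(2)[of n] by (subst measure_pmf.prob_eq_1) (auto simp: AE_measure_pmf_iff)
      finally show ?thesis .
    qed
    then show "\<exists>a b. a < b \<and> (\<forall>n. 1 - \<epsilon> < measure (\<mu> n) {a<..b})"
      using R \<open>\<epsilon> > 0\<close> by (intro exI[of _ "-R-1"] exI[of _ R]) auto
  qed (rule rd)
  obtain r M where r: "strict_mono (r :: nat \<Rightarrow> nat)" and M: "real_distribution M" and wc: "weak_conv_m (\<mu> \<circ> id \<circ> r) M"
    using tight_imp_convergent_subsubsequence[OF tight strict_mono_id] by blast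
  have Slim: "(\<lambda>n. S n z) \<longlonglongrightarrow> I z" if z: "Im z \<noteq> 0" for z
  proof -
    define f where "f = (\<lambda>w. complex_of_real (\<kappa> w) * (1 / (z - of_real w)))"
    have fm: "f \<in> borel_measurable borel" unfolding f_def by measurable
    have fb: "norm (f w) \<le> 1 * (1 / \<bar>Im z\<bar>)" for w
      unfolding f_def norm_mult using \<kappa> norm_inverse_shift_le[OF z, of w] by (intro mult_mono) auto
    have split: "(LINT w:{x n 0..x n m}|lborel. f w) = (\<Sum>k<m. LINT w:{x n k..x n (Suc k)}|lborel. f w)" for n m
    proof (induction m)
      case 0
      have "(LINT w:{x n 0..x n 0}|lborel. f w) = (LINT w|(lborel :: real measure). 0)"
        unfolding set_lebesgue_integral_def
        by (rule integral_cong_AE) (use fm AE_lborel_singleton[of "x n 0"] in \<open>auto elim: eventually_mono\<close>)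
      then show ?case by simp
    next
      case (Suc m)
      have "x n 0 \<le> x n m" using x1[of n] by (intro lift_Suc_mono_le[of "x n" 0 m]) (auto simp: less_imp_le)
      then show ?case
        using set_integral_Icc_split[OF fm fb, of "x n 0" "x n m" "x n (Suc m)"] x1[of n m] Suc by simp
    qed
    \<comment> \<open>The n + 1 cells each contribute an error of order 1/(n+1) squared.\<close>
    have bound: "norm (S n z - I z) \<le> 4 * R\<^sup>2 / (Im z)\<^sup>2 / real (Suc n)" for n
    proof -
      have "I z = (\<Sum>k<Suc n. LINT w:{x n k..x n (Suc k)}|lborel. f w)"
        using split[of n "Suc n"] unfolding x0 xn I_def f_def .
      then have "norm (S n z - I z) = norm (\<Sum>k<Suc n. (LINT w:{y n k..x n (Suc k)}|lborel. 1 / (z - complex_of_real w)) -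
         (LINT w:{x n k..x n (Suc k)}|lborel. f w))"
        by (simp only: S_def sum_subtractf)
      also have "\<dots> \<le> (\<Sum>k<Suc n. (2 * R / real (Suc n))\<^sup>2 / (Im z)\<^sup>2)"
      proof (rule sum_norm_le)
        fix k
        show "norm ((LINT w:{y n k..x n (Suc k)}|lborel. 1 / (z - complex_of_real w)) -
         (LINT w:{x n k..x n (Suc k)}|lborel. f w)) \<le> (2 * R / real (Suc n))\<^sup>2 / (Im z)\<^sup>2"
          using cell_approximation(3)[OF \<kappa>m \<kappa> less_imp_le[OF x1] z, of n k]
          unfolding y_def f_def xs by (simp only: norm_minus_commute)
      qed
      also have "\<dots> = 4 * R\<^sup>2 / (Im z)\<^sup>2 / real (Suc n)"
        using z by (simp add: field_simps power2_eq_square del: of_nat_Suc)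
      finally show ?thesis .
    qed
    have "(\<lambda>n. 4 * R\<^sup>2 / (Im z)\<^sup>2 / real (Suc n)) \<longlonglongrightarrow> 0"
      by (rule real_tendsto_divide_at_top[OF tendsto_const])
         (rule filterlim_compose[OF filterlim_real_sequentially filterlim_Suc])
    then have "(\<lambda>n. S n z - I z) \<longlonglongrightarrow> 0"
      by (rule Lim_null_comparison[rotated]) (use bound in auto)
    then show ?thesis by (rule LIM_zero_cancel)
  qed
  have "(LINT x|M. 1 / (z - of_real x)) = exp (I z) / (z + of_real R)" if z: "Im z \<noteq> 0" for z
  proof (rule LIMSEQ_unique)
    have ne: "z - of_real w \<noteq> 0" for w using z by (auto simp: complex_eq_iff)
    show "(\<lambda>n. LINT x|(\<mu> \<circ> id \<circ> r) n. 1 / (z - of_real x)) \<longlonglongrightarrow> (LINT x|M. 1 / (z - of_real x))"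
      by (rule weak_conv_imp_integral_bdd_continuous_conv[OF _ M wc _ norm_inverse_shift_le[OF z]])
         (use rd ne in \<open>auto intro!: continuous_intros\<close>)
    have "(LINT x|(\<mu> \<circ> id \<circ> r) n. 1 / (z - of_real x)) = exp (S (r n) z) / (z + of_real R)" for n
      unfolding p(3)[OF z, symmetric] by (simp add: \<mu>_def integral_distr)
    moreover have "(\<lambda>n. exp (S (r n) z) / (z + of_real R)) \<longlonglongrightarrow> exp (I z) / (z + of_real R)"
      using ne[of "-R"] LIMSEQ_subseq_LIMSEQ[OF Slim[OF z] r]
      by (intro tendsto_intros) (auto simp: o_def)
    ultimately show "(\<lambda>n. LINT x|(\<mu> \<circ> id \<circ> r) n. 1 / (z - of_real x)) \<longlonglongrightarrow> exp (I z) / (z + of_real R)" by simp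
  qed
  then show ?thesis using M unfolding I_def by blast
qed

text \<open>Only the normalization changes. Below -R the indicator cancels against
  \<open>\<kappa>\<close> = 1; what it still subtracts is the integral of the kernel over [-R, 0],
  whose exponential (z + R)/z exchanges the factor 1/z for 1/(z + R).\<close>

lemma exists_cauchy_transform_slope:
  fixes \<kappa> :: "real \<Rightarrow> real"
  assumes \<kappa>m [measurable]: "\<kappa> \<in> borel_measurable borel" and \<kappa>: "\<And>w. 0 \<le> \<kappa> w" "\<And>w. \<kappa> w \<le> 1" and R: "0 < R"
    and supp: "\<And>w. w < - R \<Longrightarrow> \<kappa> w = 1" "\<And>w. R < w \<Longrightarrow> \<kappa> w = 0"
  shows "\<exists>M. real_distribution M \<and> (\<forall>z. Im z \<noteq> 0 \<longrightarrow> (LINT x|M. 1 / (z - of_real x)) =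
    exp (LINT w|lborel. 1 / (z - of_real w) * of_real (\<kappa> w - indicator {..<0} w)) / z)"
proof -
  have "exp (LINT w|lborel. 1 / (z - of_real w) * of_real (\<kappa> w - indicator {..<0} w)) / z
    = exp (LINT w:{-R..R}|lborel. of_real (\<kappa> w) * (1 / (z - of_real w))) / (z + of_real R)" if z: "Im z \<noteq> 0" for z
  proof -
    have fb: "norm (of_real (\<kappa> w) * (1 / (z - of_real w))) \<le> 1 * (1 / \<bar>Im z\<bar>)" for w
      unfolding norm_mult using \<kappa> norm_inverse_shift_le[OF z, of w] by (intro mult_mono) auto
    have "(LINT w|lborel. 1 / (z - of_real w) * of_real (\<kappa> w - indicator {..<0} w))
      = (LINT w|lborel. indicator {-R..R} w *\<^sub>R (of_real (\<kappa> w) * (1 / (z - of_real w))) - indicator {-R..0} w *\<^sub>R (1 / (z - of_real w)))"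
    proof (rule integral_cong_AE)
      have "AE w in lborel. w \<noteq> (0::real)" by (rule AE_lborel_singleton)
      then show "AE w in lborel. 1 / (z - of_real w) * of_real (\<kappa> w - indicator {..<0} w)
       = indicator {-R..R} w *\<^sub>R (of_real (\<kappa> w) * (1 / (z - of_real w))) - indicator {-R..0} w *\<^sub>R (1 / (z - of_real w))"
      proof eventually_elim
        case (elim w)
        consider "w < - R" | "- R \<le> w" "w < 0" | "0 < w" "w \<le> R" | "R < w" using elim by linarith
        then show ?case using R supp[of w] by cases (auto simp: indicator_def diff_divide_distrib)
      qed
    qed auto
    also have "\<dots> = (LINT w:{-R..R}|lborel. of_real (\<kappa> w) * (1 / (z - of_real w))) - (LINT w:{-R..0}|lborel. 1 / (z - of_real w))"
      unfolding set_lebesgue_integral_def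
    proof (rule Bochner_Integration.integral_diff)
      show "integrable lborel (\<lambda>w. indicator {-R..R} w *\<^sub>R (of_real (\<kappa> w) * (1 / (z - of_real w))))"
        unfolding set_integrable_def[symmetric] by (rule set_integrable_bounded_Icc[OF _ fb]) measurable
      show "integrable lborel (\<lambda>w. indicator {-R..0} w *\<^sub>R (1 / (z - complex_of_real w)))"
        unfolding set_integrable_def[symmetric] by (rule set_integrable_bounded_Icc[OF _ norm_inverse_shift_le[OF z]]) measurable
    qed
    finally have eq: "(LINT w|lborel. 1 / (z - of_real w) * of_real (\<kappa> w - indicator {..<0} w)) = \<dots>" .
    have "z \<noteq> 0" using z by auto
    then show ?thesis
      unfolding eq exp_diff exp_integral_inverse_shift[OF z, of "-R" 0, OF less_imp_le, simplified, OF R] by simp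
  qed
  then show ?thesis using exists_cauchy_transform_slope_Icc[OF \<kappa>m \<kappa> R] by simp
qed

section \<open>Poisson smoothing and uniqueness of the transition measure\<close>

text \<open>For \<eta> > 0 the integrand is the distribution function of the Cauchy law of scale
  \<eta> at u - x, so this is the distribution function at u of the convolution of \<open>M\<close>
  with that law.\<close>

definition smoothed_cdf :: "real measure \<Rightarrow> real \<Rightarrow> real \<Rightarrow> real" where
  "smoothed_cdf M u \<eta> = (LINT x|M. 1 / 2 + arctan ((u - x) / \<eta>) / pi)"

lemma Fubini_Icc:
  fixes \<phi> :: "real \<Rightarrow> real \<Rightarrow> real"
  assumes M: "real_distribution M" and m: "(\<lambda>(x, t). \<phi> x t) \<in> borel_measurable (borel \<Otimes>\<^sub>M borel)"
    and bd: "\<And>x t. t \<in> {c..d} \<Longrightarrow> \<bar>\<phi> x t\<bar> \<le> B"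
  shows "(LINT x|M. (LINT t:{c..d}|lborel. \<phi> x t)) = (LINT t:{c..d}|lborel. LINT x|M. \<phi> x t)"
    and "integrable M (\<lambda>x. LINT t:{c..d}|lborel. \<phi> x t)"
    and "set_integrable lborel {c..d} (\<lambda>t. LINT x|M. \<phi> x t)"
proof -
  interpret M: real_distribution M by fact
  interpret P: pair_sigma_finite M "lborel :: real measure" ..
  note [measurable] = m
  define f where "f = (\<lambda>x t. indicator {c..d} t *\<^sub>R \<phi> x t)"
  have sets: "sets (M \<Otimes>\<^sub>M (lborel :: real measure)) = sets (borel \<Otimes>\<^sub>M borel)"
    by (rule sets_pair_measure_cong) auto
  have fm: "case_prod f \<in> borel_measurable (borel \<Otimes>\<^sub>M borel)"
    unfolding f_def by measurable
  have int: "integrable (M \<Otimes>\<^sub>M lborel) (case_prod f)"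
  proof (rule Bochner_Integration.integrable_bound)
    show "integrable (M \<Otimes>\<^sub>M lborel) (\<lambda>p. B * indicator (UNIV \<times> {c..d}) p :: real)"
    proof (intro integrable_mult_right integrable_real_indicator)
      have "emeasure (M \<Otimes>\<^sub>M lborel) (UNIV \<times> {c..d}) = emeasure M UNIV * emeasure lborel {c..d}"
        by (rule lborel.emeasure_pair_measure_Times) auto
      also have "\<dots> < \<infinity>"
        by (simp add: M.emeasure_space_1[unfolded M.space_eq_univ] emeasure_lborel_Icc_eq)
      finally show "emeasure (M \<Otimes>\<^sub>M lborel) (UNIV \<times> {c..d}) < \<infinity>" .
    qed (auto simp: sets)
    show "case_prod f \<in> borel_measurable (M \<Otimes>\<^sub>M lborel)" using fm sets by (simp cong: measurable_cong_sets)
    show "AE p in M \<Otimes>\<^sub>M lborel. norm (case_prod f p) \<le> norm (B * indicator (UNIV \<times> {c..d}) p :: real)"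
    proof (rule AE_I2)
      fix p :: "real \<times> real"
      show "norm (case_prod f p) \<le> norm (B * indicator (UNIV \<times> {c..d}) p :: real)"
        using bd[of "snd p" "fst p"]
        by (cases "snd p \<in> {c..d}") (auto simp: f_def case_prod_beta indicator_def mem_Times_iff)
    qed
  qed
  show "(LINT x|M. (LINT t:{c..d}|lborel. \<phi> x t)) = (LINT t:{c..d}|lborel. LINT x|M. \<phi> x t)"
    using P.Fubini_integral[OF int] unfolding f_def set_lebesgue_integral_def by simp
  show "integrable M (\<lambda>x. LINT t:{c..d}|lborel. \<phi> x t)"
    using P.integrable_fst[OF int] unfolding f_def set_lebesgue_integral_def by simp
  show "set_integrable lborel {c..d} (\<lambda>t. LINT x|M. \<phi> x t)"
    using P.integrable_snd[OF int] unfolding f_def set_integrable_def by simp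
qed

lemma integrable_inverse_shift:
  assumes "real_distribution M" "Im z \<noteq> 0"
  shows "integrable M (\<lambda>x. 1 / (z - complex_of_real x))"
proof -
  interpret real_distribution M by fact
  show ?thesis
    by (rule integrable_const_bound[where B="1 / \<bar>Im z\<bar>"])
       (use norm_inverse_shift_le[OF assms(2)] in auto)
qed

lemma Re_inverse_shift: "Re (1 / (Complex u t - of_real x)) = (u - x) / ((u - x)\<^sup>2 + t\<^sup>2)"
  and Im_inverse_shift: "Im (1 / (Complex u t - of_real x)) = - (t / ((u - x)\<^sup>2 + t\<^sup>2))"
  by (simp_all add: Re_divide Im_divide)

lemma Poisson_measurable [measurable]:
  "(\<lambda>(x, t). (u - x) / ((u - x)\<^sup>2 + t\<^sup>2) :: real) \<in> borel_measurable (borel \<Otimes>\<^sub>M borel)"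
  "(\<lambda>(x, t). 1 / ((u - x)\<^sup>2 + t\<^sup>2) :: real) \<in> borel_measurable (borel \<Otimes>\<^sub>M borel)"
  by measurable

lemma arctan_diff_eq_integral:
  fixes s :: real
  assumes "0 < \<eta>" "\<eta> \<le> T"
  shows "(LINT t:{\<eta>..T}|lborel. s / (s\<^sup>2 + t\<^sup>2)) = arctan (s / \<eta>) - arctan (s / T)"
proof -
  have pos: "0 < s\<^sup>2 + t\<^sup>2" if "t > 0" for t using that by (simp add: add_nonneg_pos)
  have "(LINT t|lborel. indicator {\<eta>..T} t *\<^sub>R (s / (s\<^sup>2 + t\<^sup>2))) = - arctan (s / T) - - arctan (s / \<eta>)"
  proof (rule integral_FTC_atLeastAtMost[OF assms(2)])
    show "continuous_on {\<eta>..T} (\<lambda>t. s / (s\<^sup>2 + t\<^sup>2))"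
      using assms pos by (intro continuous_intros) (auto simp: less_imp_neq[symmetric] dest!: less_le_trans)
    fix t assume t: "\<eta> \<le> t" "t \<le> T"
    then have t0: "0 < t" using assms by simp
    have "((\<lambda>t. - arctan (s / t)) has_real_derivative s / (s\<^sup>2 + t\<^sup>2)) (at t within {\<eta>..T})"
    proof -
      have "((\<lambda>t. - arctan (s / t)) has_real_derivative - (inverse (1 + (s / t)\<^sup>2) * (- (s / t\<^sup>2)))) (at t within {\<eta>..T})"
        using t0 by (auto intro!: derivative_eq_intros simp: power2_eq_square)
      moreover have "- (inverse (1 + (s / t)\<^sup>2) * (- (s / t\<^sup>2))) = s / (s\<^sup>2 + t\<^sup>2)"
        using t0 pos[of t] by (simp add: field_simps power_divide)
      ultimately show ?thesis by simp
    qed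
    then show "((\<lambda>t. - arctan (s / t)) has_vector_derivative s / (s\<^sup>2 + t\<^sup>2)) (at t within {\<eta>..T})"
      by (simp add: has_real_derivative_iff_has_vector_derivative)
  qed
  then show ?thesis unfolding set_lebesgue_integral_def by simp
qed

lemma smoothing_kernel_bound: "norm (1 / 2 + arctan s / pi) \<le> 1"
proof -
  have "- (pi / 2) < arctan s" "arctan s < pi / 2" using arctan_bounded[of s] by auto
  then have "- (1 / 2) < arctan s / pi" "arctan s / pi < 1 / 2" by (simp_all add: field_simps)
  then show ?thesis unfolding real_norm_def by linarith
qed

lemma integrable_smoothing_kernel:
  assumes "real_distribution M"
  shows "integrable M (\<lambda>x. 1 / 2 + arctan ((u - x) / \<eta>) / pi)"
proof -
  interpret real_distribution M by fact
  show ?thesis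
    by (rule integrable_const_bound[where B=1]) (auto simp: smoothing_kernel_bound simp del: real_norm_def)
qed

text \<open>Over a range of scales the derivative formula is just Fubini for the kernel, whose
  primitive in t is -arctan((u - x)/t); no differentiation under the integral sign is involved. The
  restriction t \<ge> \<eta> keeps the kernel bounded.\<close>

lemma smoothed_cdf_diff:
  assumes M: "real_distribution M" and \<eta>: "0 < \<eta>" "\<eta> \<le> T"
  shows "smoothed_cdf M u \<eta> - smoothed_cdf M u T =
      (LINT t:{\<eta>..T}|lborel. Re (LINT x|M. 1 / (Complex u t - of_real x))) / pi"
    and "set_integrable lborel {\<eta>..T} (\<lambda>t. Re (LINT x|M. 1 / (Complex u t - of_real x)))"
proof -
  interpret real_distribution M by fact
  have bd: "\<bar>(u - x) / ((u - x)\<^sup>2 + t\<^sup>2)\<bar> \<le> 1 / \<eta>" if "t \<in> {\<eta>..T}" for x t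
  proof -
    have "\<bar>(u - x) / ((u - x)\<^sup>2 + t\<^sup>2)\<bar> \<le> norm (1 / (Complex u t - of_real x))"
      unfolding Re_inverse_shift[symmetric] by (rule abs_Re_le_cmod)
    also have "\<dots> \<le> 1 / \<bar>t\<bar>" using norm_inverse_shift_le[of "Complex u t" x] that \<eta> by simp
    also have "\<dots> \<le> 1 / \<eta>" using that \<eta> by (intro divide_left_mono) auto
    finally show ?thesis .
  qed
  note F = Fubini_Icc[OF M Poisson_measurable(1) bd]
  have Re: "(LINT x|M. (u - x) / ((u - x)\<^sup>2 + t\<^sup>2)) = Re (LINT x|M. 1 / (Complex u t - of_real x))" if "t \<in> {\<eta>..T}" for t
    using integrable_inverse_shift[OF M, of "Complex u t"] that \<eta> by (simp add: Re_inverse_shift[symmetric])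
  have "smoothed_cdf M u \<eta> - smoothed_cdf M u T =
     (LINT x|M. (1 / 2 + arctan ((u - x) / \<eta>) / pi) - (1 / 2 + arctan ((u - x) / T) / pi))"
    unfolding smoothed_cdf_def
    by (rule Bochner_Integration.integral_diff[symmetric]) (rule integrable_smoothing_kernel[OF M])+
  also have "\<dots> = (LINT x|M. (LINT t:{\<eta>..T}|lborel. (u - x) / ((u - x)\<^sup>2 + t\<^sup>2)) / pi)"
    unfolding arctan_diff_eq_integral[OF \<eta>] by (simp add: diff_divide_distrib)
  also have "\<dots> = (LINT x|M. (LINT t:{\<eta>..T}|lborel. (u - x) / ((u - x)\<^sup>2 + t\<^sup>2))) / pi"
    by simp
  also have "(LINT x|M. (LINT t:{\<eta>..T}|lborel. (u - x) / ((u - x)\<^sup>2 + t\<^sup>2))) =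
      (LINT t:{\<eta>..T}|lborel. LINT x|M. (u - x) / ((u - x)\<^sup>2 + t\<^sup>2))" by (rule F(1))
  also have "\<dots> = (LINT t:{\<eta>..T}|lborel. Re (LINT x|M. 1 / (Complex u t - of_real x)))"
    by (rule set_lebesgue_integral_cong) (auto simp: Re)
  finally show "smoothed_cdf M u \<eta> - smoothed_cdf M u T =
      (LINT t:{\<eta>..T}|lborel. Re (LINT x|M. 1 / (Complex u t - of_real x))) / pi" .
  have "set_integrable lborel {\<eta>..T} (\<lambda>t. LINT x|M. (u - x) / ((u - x)\<^sup>2 + t\<^sup>2))" by (rule F(3))
  then show "set_integrable lborel {\<eta>..T} (\<lambda>t. Re (LINT x|M. 1 / (Complex u t - of_real x)))"
    by (subst set_integrable_cong[OF refl refl Re[symmetric]]) auto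
qed

section \<open>Stieltjes inversion: limits at large and at small scales\<close>

lemma smoothed_cdf_at_top:
  assumes M: "real_distribution M"
  shows "(\<lambda>n. smoothed_cdf M u (real n)) \<longlonglongrightarrow> 1 / 2"
proof -
  interpret real_distribution M by fact
  have "(\<lambda>n. smoothed_cdf M u (real n)) \<longlonglongrightarrow> (LINT x|M. 1 / 2 + arctan 0 / pi)"
    unfolding smoothed_cdf_def
  proof (rule integral_dominated_convergence[where w="\<lambda>_. 1"])
    show "AE x in M. (\<lambda>n. 1 / 2 + arctan ((u - x) / real n) / pi) \<longlonglongrightarrow> 1 / 2 + arctan 0 / pi"
      by (intro AE_I2 tendsto_intros real_tendsto_divide_at_top[OF tendsto_const] filterlim_real_sequentially) simp
    show "AE x in M. norm (1 / 2 + arctan ((u - x) / real n) / pi) \<le> 1" for n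
    by (intro AE_I2 smoothing_kernel_bound)
  qed auto
  then show ?thesis using prob_space by simp
qed

text \<open>The kernel equals 1/2 at x = u for every scale, so an atom at u enters with half its
  weight, which the convention sgn 0 = 0 records.\<close>

lemma smoothed_cdf_at_0:
  assumes M: "real_distribution M"
  shows "(\<lambda>n. smoothed_cdf M u (1 / real (Suc n))) \<longlonglongrightarrow> (LINT x|M. 1 / 2 + sgn (u - x) / 2)"
proof -
  interpret real_distribution M by fact
  show ?thesis
    unfolding smoothed_cdf_def
  proof (rule integral_dominated_convergence[where w="\<lambda>_. 1"])
    show "AE x in M. (\<lambda>n. 1 / 2 + arctan ((u - x) / (1 / real (Suc n))) / pi) \<longlonglongrightarrow> 1 / 2 + sgn (u - x) / 2"
    proof (rule AE_I2)
      fix x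
      have at: "filterlim (\<lambda>n. real (Suc n)) at_top sequentially"
        by (rule filterlim_compose[OF filterlim_real_sequentially filterlim_Suc])
      have "(\<lambda>n. arctan ((u - x) * real (Suc n))) \<longlonglongrightarrow> sgn (u - x) * (pi / 2)"
      proof (cases "u - x" "0 :: real" rule: linorder_cases)
        case less
        have "filterlim (\<lambda>n. (u - x) * real (Suc n)) at_bot sequentially"
          using less at by (intro filterlim_tendsto_neg_mult_at_bot[OF tendsto_const])
        then show ?thesis using filterlim_compose[OF tendsto_arctan_at_bot] less by simp
      next
        case greater
        have "filterlim (\<lambda>n. (u - x) * real (Suc n)) at_top sequentially"
          using greater at by (intro filterlim_tendsto_pos_mult_at_top[OF tendsto_const])
        then show ?thesis using filterlim_compose[OF tendsto_arctan_at_top] greater by simp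
      qed simp
      then have "(\<lambda>n. 1 / 2 + arctan ((u - x) * real (Suc n)) / pi) \<longlonglongrightarrow> 1 / 2 + sgn (u - x) * (pi / 2) / pi"
        by (intro tendsto_intros) auto
      then show "(\<lambda>n. 1 / 2 + arctan ((u - x) / (1 / real (Suc n))) / pi) \<longlonglongrightarrow> 1 / 2 + sgn (u - x) / 2"
        by simp
    qed
    show "AE x in M. norm (1 / 2 + arctan ((u - x) / (1 / real (Suc n))) / pi) \<le> 1" for n
    by (intro AE_I2 smoothing_kernel_bound)
  qed auto
qed

text \<open>Approaching u strictly from the right restores the missing half of an atom at u: the
  shifted sign functions converge pointwise to the indicator of x \<le> u.\<close>

lemma cdf_limit:
  assumes M: "real_distribution M"
  shows "(\<lambda>n. LINT x|M. 1 / 2 + sgn (u + 1 / real (Suc n) - x) / 2) \<longlonglongrightarrow> cdf M u"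
proof -
  interpret real_distribution M by fact
  have "(\<lambda>n. LINT x|M. 1 / 2 + sgn (u + 1 / real (Suc n) - x) / 2) \<longlonglongrightarrow> (LINT x|M. indicator {..u} x)"
  proof (rule integral_dominated_convergence[where w="\<lambda>_. 1"])
    show "AE x in M. (\<lambda>n. 1 / 2 + sgn (u + 1 / real (Suc n) - x) / 2) \<longlonglongrightarrow> indicator {..u} x"
    proof (rule AE_I2)
      fix x
      have "\<forall>\<^sub>F n in sequentially. 1 / 2 + sgn (u + 1 / real (Suc n) - x) / 2 = indicator {..u} x"
      proof (cases "x \<le> u")
        case True
        have "0 < u + 1 / real (Suc n) - x" for n
          using True by (simp add: add_nonneg_pos diff_add_eq[symmetric] del: of_nat_Suc)
        then show ?thesis using True by simp
      next
        case False
        have "(\<lambda>n. 1 / real (Suc n)) \<longlonglongrightarrow> 0"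
          using LIMSEQ_inverse_real_of_nat by (simp add: divide_inverse)
        then have "\<forall>\<^sub>F n in sequentially. 1 / real (Suc n) < x - u"
          using False by (intro order_tendstoD) auto
        then show ?thesis
          by eventually_elim (use False in \<open>simp del: of_nat_Suc\<close>)
      qed
      then show "(\<lambda>n. 1 / 2 + sgn (u + 1 / real (Suc n) - x) / 2) \<longlonglongrightarrow> indicator {..u} x"
        by (rule tendsto_eventually)
    qed
    show "AE x in M. norm (1 / 2 + sgn (u + 1 / real (Suc n) - x) / 2) \<le> 1" for n
      by (auto simp: sgn_if)
  qed auto
  then show ?thesis by (simp add: cdf_def)
qed

text \<open>Equal transforms force equal changes of the smoothed functions between any two scales;
  the limit 1/2 at infinite scale, common to all probability measures, fixes the constant. Letting
  the scale tend to 0 and then approaching from the right recovers the distribution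
  function.\<close>

lemma cauchy_transform_unique:
  assumes M: "real_distribution M" and M': "real_distribution M'"
    and eq: "\<And>z. Im z \<noteq> 0 \<Longrightarrow> (LINT x|M. 1 / (z - complex_of_real x)) = (LINT x|M'. 1 / (z - of_real x))"
  shows "M = M'"
proof -
  have "smoothed_cdf M u \<eta> = smoothed_cdf M' u \<eta>" if \<eta>: "0 < \<eta>" for u \<eta>
  proof -
    have d: "smoothed_cdf M u \<eta> - smoothed_cdf M' u \<eta> = smoothed_cdf M u T - smoothed_cdf M' u T" if "\<eta> \<le> T" for T
    proof -
      have "(LINT t:{\<eta>..T}|lborel. Re (LINT x|M. 1 / (Complex u t - of_real x))) =
        (LINT t:{\<eta>..T}|lborel. Re (LINT x|M'. 1 / (Complex u t - of_real x)))"
        by (rule set_lebesgue_integral_cong) (use \<eta> in \<open>auto simp: eq\<close>)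
      then show ?thesis using smoothed_cdf_diff(1)[OF M \<eta> that, of u] smoothed_cdf_diff(1)[OF M' \<eta> that, of u] by simp
    qed
    have "\<forall>\<^sub>F n in sequentially. \<eta> \<le> real n" using filterlim_real_sequentially unfolding filterlim_at_top by blast
    then have "\<forall>\<^sub>F n in sequentially. smoothed_cdf M u (real n) - smoothed_cdf M' u (real n) = smoothed_cdf M u \<eta> - smoothed_cdf M' u \<eta>"
      by eventually_elim (use d in auto)
    then have "(\<lambda>n. smoothed_cdf M u (real n) - smoothed_cdf M' u (real n)) \<longlonglongrightarrow> smoothed_cdf M u \<eta> - smoothed_cdf M' u \<eta>"
      by (rule tendsto_eventually)
    moreover have "(\<lambda>n. smoothed_cdf M u (real n) - smoothed_cdf M' u (real n)) \<longlonglongrightarrow> 1 / 2 - 1 / 2"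
      by (intro tendsto_diff smoothed_cdf_at_top M M')
    ultimately have "smoothed_cdf M u \<eta> - smoothed_cdf M' u \<eta> = 1 / 2 - 1 / 2" by (rule LIMSEQ_unique)
    then show ?thesis by simp
  qed
  then have "(LINT x|M. 1 / 2 + sgn (u - x) / 2) = (LINT x|M'. 1 / 2 + sgn (u - x) / 2)" for u
    using smoothed_cdf_at_0[OF M', of u] by (intro LIMSEQ_unique[OF smoothed_cdf_at_0[OF M]]) simp
  then have "cdf M u = cdf M' u" for u
    using cdf_limit[OF M', of u] by (intro LIMSEQ_unique[OF cdf_limit[OF M]]) simp
  then show ?thesis using cdf_unique[OF M M'] by blast
qed

text \<open>Existence and uniqueness together make the definite description denote; everything said
  later about \<open>transition_measure\<close> rests on these two facts.\<close>

lemma transition_measure: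
  assumes "continual_diagram \<omega>"
  shows "real_distribution (transition_measure \<omega>)"
    and "Im z \<noteq> 0 \<Longrightarrow> cauchy_transform \<omega> z = (LINT x|transition_measure \<omega>. 1 / (z - of_real x))"
proof -
  obtain \<kappa> R where k: "\<kappa> \<in> borel_measurable borel" "\<And>w. 0 \<le> \<kappa> w" "\<And>w. \<kappa> w \<le> 1" "0 < R"
    "\<And>w. w < - R \<Longrightarrow> \<kappa> w = 1" "\<And>w. R < w \<Longrightarrow> \<kappa> w = 0"
    "AE w in lborel. (\<omega> has_real_derivative (1 - 2 * \<kappa> w)) (at w)"
    by (rule continual_diagram_slope[OF assms]) blast
  obtain M where M: "real_distribution M"
    "\<And>z. Im z \<noteq> 0 \<Longrightarrow> cauchy_transform \<omega> z = (LINT x|M. 1 / (z - of_real x))"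
    using exists_cauchy_transform_slope[OF k(1-6)] cauchy_transform_slope(1)[OF assms _ k(1) k(7)] by auto
  have "transition_measure \<omega> = M"
    unfolding transition_measure_def
  proof (rule the_equality)
    show "prob_space M \<and> sets M = sets borel \<and>
        (\<forall>z. Im z \<noteq> 0 \<longrightarrow> cauchy_transform \<omega> z = (LINT x|M. 1 / (z - of_real x)))"
      using M by (auto simp: real_distribution_def real_distribution_axioms_def)
    fix M' assume M': "prob_space M' \<and> sets M' = sets borel \<and>
        (\<forall>z. Im z \<noteq> 0 \<longrightarrow> cauchy_transform \<omega> z = (LINT x|M'. 1 / (z - of_real x)))"
    then have "real_distribution M'" by (auto simp: real_distribution_def real_distribution_axioms_def)
    then show "M' = M" by (rule cauchy_transform_unique[OF _ M(1)]) (use M M' in auto)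
  qed
  with M show "real_distribution (transition_measure \<omega>)"
    "Im z \<noteq> 0 \<Longrightarrow> cauchy_transform \<omega> z = (LINT x|transition_measure \<omega>. 1 / (z - of_real x))" by auto
qed

section \<open>Distribution functions and their Poisson smoothings\<close>

lemma arctan_le_self: "arctan x \<le> x" if "0 \<le> x" for x :: real
proof -
  have "0 - arctan 0 \<le> x - arctan x"
  proof (rule DERIV_nonneg_imp_nondecreasing[OF that])
    fix y :: real
    have "((\<lambda>x. x - arctan x) has_real_derivative 1 - inverse (1 + y\<^sup>2)) (at y)"
      by (auto intro!: derivative_eq_intros)
    moreover have "inverse (1 + y\<^sup>2) \<le> 1" by (rule inverse_le_1_iff[THEN iffD2]) simp
    ultimately show "\<exists>d. ((\<lambda>x. x - arctan x) has_real_derivative d) (at y) \<and> 0 \<le> d" by fastforce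
  qed
  then show ?thesis by simp
qed

text \<open>Since arctan(v) and arctan(1/v) add up to \<pi>/2 with the sign of v, the error is
  |arctan(\<eta>/s)|/\<pi>, and arctan lies below the identity on nonnegative numbers.\<close>

lemma step_minus_kernel_le:
  fixes s \<eta> :: real
  assumes "0 < \<eta>" "s \<noteq> 0"
  shows "\<bar>(if 0 \<le> s then 1 else 0) - (1 / 2 + arctan (s / \<eta>) / pi)\<bar> \<le> \<eta> / \<bar>s\<bar>"
proof -
  have inv: "arctan (s / \<eta>) = sgn s * pi / 2 - arctan (\<eta> / s)"
    using Transcendental.arctan_inverse[of "s / \<eta>"] assms by (simp add: sgn_divide)
  have "\<bar>(if 0 \<le> s then 1 else 0) - (1 / 2 + arctan (s / \<eta>) / pi)\<bar> = \<bar>arctan (\<eta> / s)\<bar> / pi"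
    unfolding inv using assms by (auto simp: sgn_if field_simps abs_if)
  also have "\<bar>arctan (\<eta> / s)\<bar> = arctan (\<eta> / \<bar>s\<bar>)"
  proof (cases "s < 0")
    case True
    then have "\<eta> / s < 0" using assms by (simp add: divide_pos_neg)
    then show ?thesis using True by (simp add: arctan_minus)
  qed (use assms in auto)
  also have "\<dots> / pi \<le> (\<eta> / \<bar>s\<bar>) / 1"
    using assms pi_gt3 by (intro frac_le arctan_le_self) auto
  finally show ?thesis by simp
qed

lemma integral_inverse_Icc:
  assumes "0 < c" "c \<le> d"
  shows "(LINT t:{c..d}|lborel. 1 / t) = ln d - ln c" "set_integrable lborel {c..d} (\<lambda>t. 1 / t :: real)"
proof -
  have "has_bochner_integral lborel (\<lambda>t. indicator {c..d} t *\<^sub>R (1 / t)) (ln d - ln c)"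
    by (rule has_bochner_integral_FTC_Icc)
       (use assms in \<open>auto intro!: derivative_eq_intros continuous_intros simp: has_real_derivative_iff_has_vector_derivative[symmetric]\<close>)
  then show "(LINT t:{c..d}|lborel. 1 / t) = ln d - ln c" "set_integrable lborel {c..d} (\<lambda>t. 1 / t :: real)"
    by (auto simp: set_lebesgue_integral_def set_integrable_def has_bochner_integral_iff)
qed

lemma integral_inverse_square_Icc:
  assumes "1 \<le> (d :: real)"
  shows "(LINT t:{1..d}|lborel. 1 / t\<^sup>2) \<le> 1" "set_integrable lborel {1..d} (\<lambda>t. 1 / t\<^sup>2 :: real)"
proof -
  have "has_bochner_integral lborel (\<lambda>t. indicator {1..d} t *\<^sub>R (1 / t\<^sup>2)) (- (1 / d) - - (1 / 1))"
    by (rule has_bochner_integral_FTC_Icc)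
       (use assms in \<open>auto intro!: derivative_eq_intros continuous_intros
          simp: has_real_derivative_iff_has_vector_derivative[symmetric] power2_eq_square\<close>)
  then show "(LINT t:{1..d}|lborel. 1 / t\<^sup>2) \<le> 1" "set_integrable lborel {1..d} (\<lambda>t. 1 / t\<^sup>2 :: real)"
    using assms by (auto simp: set_lebesgue_integral_def set_integrable_def has_bochner_integral_iff)
qed

text \<open>The tail \<open>\<eta>/\<bar>s\<bar>\<close> of the smoothing kernel is dominated by an average of Poisson kernels over the scales
  in \<open>[\<eta>, 1]\<close>, so only Poisson integrals centred at u are needed.\<close>

lemma step_minus_kernel_le_Poisson:
  fixes s \<eta> :: real
  assumes \<eta>: "0 < \<eta>" "\<eta> \<le> 1"
  shows "\<bar>(if 0 \<le> s then 1 else 0) - (1 / 2 + arctan (s / \<eta>) / pi)\<bar>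
    \<le> 2 * \<eta> * (\<eta> / (s\<^sup>2 + \<eta>\<^sup>2)) + 5 * \<eta> * (LINT t:{\<eta>..1}|lborel. 1 / (s\<^sup>2 + t\<^sup>2)) + 2 * \<eta>"
    (is "?k \<le> ?P + 5 * \<eta> * ?I + 2 * \<eta>")
proof -
  have I0: "0 \<le> ?I" unfolding set_lebesgue_integral_def by (intro Bochner_Integration.integral_nonneg) auto
  have P0: "0 \<le> ?P" using \<eta> by simp
  \<comment> \<open>In the core the Poisson kernel at scale \<eta> is at least 1/(2\<eta>), whence
    the coefficient 2\<eta>. For intermediate s all scales t from |s| to 2|s| lie in [\<eta>, 1],
    which is why the cut is at 1/2, and there s^2 + t^2 \<le> 5 s^2, whence the 5. Far away
    \<eta>/|s| is already at most 2\<eta>.\<close>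
  consider "\<bar>s\<bar> \<le> \<eta>" | "\<eta> < \<bar>s\<bar>" "\<bar>s\<bar> < 1 / 2" | "1 / 2 \<le> \<bar>s\<bar>" by linarith
  then show ?thesis
  proof cases
    case 1
    have "- (pi / 2) < arctan (s / \<eta>)" "arctan (s / \<eta>) < pi / 2" using arctan_bounded[of "s / \<eta>"] by auto
    then have v: "- (1 / 2) < arctan (s / \<eta>) / pi" "arctan (s / \<eta>) / pi < 1 / 2" by (simp_all add: field_simps)
    have "?k \<le> 1"
    proof (cases "0 \<le> s")
      case True show ?thesis unfolding if_P[OF True] using v by linarith
    next
      case False show ?thesis unfolding if_not_P[OF False] using v by linarith
    qed
    also have "1 \<le> ?P"
    proof -
      have "s\<^sup>2 \<le> \<eta>\<^sup>2" using 1 \<eta> abs_le_square_iff[of s \<eta>] by simp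
      moreover have "0 < s\<^sup>2 + \<eta>\<^sup>2" using \<eta> by (simp add: add_nonneg_pos)
      ultimately show ?thesis by (simp add: field_simps power2_eq_square)
    qed
    also have "?P \<le> ?P + 5 * \<eta> * ?I + 2 * \<eta>" using I0 \<eta> by simp
    finally show ?thesis .
  next
    case 2
    have s0: "s \<noteq> 0" "0 < \<bar>s\<bar>" using 2 \<eta> by auto
    have "1 / (5 * \<bar>s\<bar>) = (LINT t|lborel. indicator {\<bar>s\<bar>..2 * \<bar>s\<bar>} t * (1 / (5 * s\<^sup>2)))"
      using s0 by (simp add: power2_eq_square abs_if)
    also have "\<dots> \<le> ?I" unfolding set_lebesgue_integral_def
    proof (rule integral_mono)
      show "integrable lborel (\<lambda>t. indicator {\<bar>s\<bar>..2 * \<bar>s\<bar>} t * (1 / (5 * s\<^sup>2)))"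
        using integrable_const_Icc[of "1 / (5 * s\<^sup>2)" "\<bar>s\<bar>" "2 * \<bar>s\<bar>"] by (simp add: mult.commute)
      have sp: "0 < s\<^sup>2 + t\<^sup>2" for t using s0 by (simp add: add_pos_nonneg)
      show "integrable lborel (\<lambda>t. indicator {\<eta>..1} t *\<^sub>R (1 / (s\<^sup>2 + t\<^sup>2)))"
        by (rule borel_integrable_compact) (use sp in \<open>auto intro!: continuous_intros simp: less_imp_neq[symmetric]\<close>)
      fix t
      show "indicator {\<bar>s\<bar>..2 * \<bar>s\<bar>} t * (1 / (5 * s\<^sup>2)) \<le> indicator {\<eta>..1} t *\<^sub>R (1 / (s\<^sup>2 + t\<^sup>2))"
      proof (cases "t \<in> {\<bar>s\<bar>..2 * \<bar>s\<bar>}")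
        case True
        then have "t\<^sup>2 \<le> (2 * \<bar>s\<bar>)\<^sup>2" using s0 by (intro power_mono) auto
        then have "s\<^sup>2 + t\<^sup>2 \<le> 5 * s\<^sup>2" by (simp add: power_mult_distrib)
        then have "1 / (5 * s\<^sup>2) \<le> 1 / (s\<^sup>2 + t\<^sup>2)" using sp[of t] s0 by (intro divide_left_mono mult_pos_pos) auto
        then show ?thesis using True 2 by simp
      qed simp
    qed
    finally have "5 * \<eta> * (1 / (5 * \<bar>s\<bar>)) \<le> 5 * \<eta> * ?I" using \<eta> by (intro mult_left_mono) auto
    moreover have "5 * \<eta> * (1 / (5 * \<bar>s\<bar>)) = \<eta> / \<bar>s\<bar>" using s0 by simp
    ultimately have "\<eta> / \<bar>s\<bar> \<le> ?P + 5 * \<eta> * ?I + 2 * \<eta>" using P0 \<eta> by linarith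
    then show ?thesis by (rule order_trans[OF step_minus_kernel_le[OF \<eta>(1) s0(1)]])
  next
    case 3
    then have s0: "s \<noteq> 0" by auto
    have "\<eta> / \<bar>s\<bar> \<le> \<eta> / (1 / 2)" using 3 \<eta> by (intro divide_left_mono) auto
    then have "\<eta> / \<bar>s\<bar> \<le> 2 * \<eta>" by simp
    moreover have "0 \<le> 5 * \<eta> * ?I" using I0 \<eta> by simp
    ultimately have "\<eta> / \<bar>s\<bar> \<le> ?P + 5 * \<eta> * ?I + 2 * \<eta>" using P0 by linarith
    then show ?thesis by (rule order_trans[OF step_minus_kernel_le[OF \<eta>(1) s0]])
  qed
qed

text \<open>The kernel bound is integrated against \<open>M\<close>. Its first term gives a Poisson
  integral at scale \<eta>; the integrand of the second is a Poisson kernel divided by t, so Fubini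
  leaves the integral of B/t over [\<eta>, 1], which produces the logarithm. Only scales between
  \<eta> and 1 enter, so the lemma also covers measures with atoms.\<close>

lemma cdf_smoothing_error:
  assumes M: "real_distribution M" and \<eta>: "0 < \<eta>" "\<eta> \<le> 1"
    and B: "\<And>t. \<eta> \<le> t \<Longrightarrow> t \<le> 1 \<Longrightarrow> - Im (LINT x|M. 1 / (Complex u t - of_real x)) \<le> B"
  shows "\<bar>cdf M u - smoothed_cdf M u \<eta>\<bar> \<le> 2 * \<eta> * B + 5 * \<eta> * (B * - ln \<eta>) + 2 * \<eta>"
proof -
  interpret real_distribution M by fact
  define P where "P = (\<lambda>t. LINT x|M. t / ((u - x)\<^sup>2 + t\<^sup>2))"
  have iP: "integrable M (\<lambda>x. t / ((u - x)\<^sup>2 + t\<^sup>2))" if "0 < t" for t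
  proof -
    have "integrable M (\<lambda>x. - Im (1 / (Complex u t - of_real x)))"
      using integrable_inverse_shift[OF M, of "Complex u t"] that by (intro integrable_minus integrable_Im) auto
    then show ?thesis by (simp add: Im_inverse_shift)
  qed
  have P: "P t \<le> B" if "\<eta> \<le> t" "t \<le> 1" for t
  proof -
    have "P t = (LINT x|M. - Im (1 / (Complex u t - of_real x)))" by (simp add: P_def Im_inverse_shift)
    also have "\<dots> = - Im (LINT x|M. 1 / (Complex u t - of_real x))"
      using integrable_inverse_shift[OF M, of "Complex u t"] that \<eta> by simp
    also have "\<dots> \<le> B" by (rule B[OF that])
    finally show ?thesis .
  qed
  have bd: "\<bar>1 / ((u - x)\<^sup>2 + t\<^sup>2)\<bar> \<le> 1 / \<eta>\<^sup>2" if "t \<in> {\<eta>..1}" for x t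
  proof -
    have "\<eta>\<^sup>2 \<le> t\<^sup>2" using that \<eta> by (intro power_mono) auto
    then have "\<eta>\<^sup>2 \<le> (u - x)\<^sup>2 + t\<^sup>2" by (simp add: add_increasing)
    moreover have e0: "0 < \<eta>\<^sup>2" using \<eta> by simp
    ultimately have "1 / ((u - x)\<^sup>2 + t\<^sup>2) \<le> 1 / \<eta>\<^sup>2"
      by (intro divide_left_mono mult_pos_pos less_le_trans[OF e0]) auto
    then show ?thesis by simp
  qed
  note F = Fubini_Icc[OF M Poisson_measurable(2) bd]
  have i2: "integrable M (\<lambda>x. 5 * \<eta> * (LINT t:{\<eta>..1}|lborel. 1 / ((u - x)\<^sup>2 + t\<^sup>2)))"
    by (rule integrable_mult_right[OF F(2)])
  have i1: "integrable M (\<lambda>x. 2 * \<eta> * (\<eta> / ((u - x)\<^sup>2 + \<eta>\<^sup>2)))"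
    by (rule integrable_mult_right[OF iP[OF \<eta>(1)]])
  define J where "J = (LINT x|M. (LINT t:{\<eta>..1}|lborel. 1 / ((u - x)\<^sup>2 + t\<^sup>2)))"
  have J: "J \<le> B * - ln \<eta>"
  proof -
    have "J = (LINT t:{\<eta>..1}|lborel. LINT x|M. 1 / ((u - x)\<^sup>2 + t\<^sup>2))"
      unfolding J_def by (rule F(1))
    also have "\<dots> \<le> (LINT t:{\<eta>..1}|lborel. B * (1 / t))"
    proof (rule set_integral_mono)
      show "set_integrable lborel {\<eta>..1} (\<lambda>t. LINT x|M. 1 / ((u - x)\<^sup>2 + t\<^sup>2))" by (rule F(3))
      show "set_integrable lborel {\<eta>..1} (\<lambda>t. B * (1 / t))"
        by (intro set_integrable_mult_right integral_inverse_Icc(2) \<eta>)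
      fix t assume t: "t \<in> {\<eta>..1}"
      then have t0: "0 < t" using \<eta> by simp
      have "P t = t * (LINT x|M. 1 / ((u - x)\<^sup>2 + t\<^sup>2))"
        unfolding P_def integral_mult_right_zero[symmetric] by simp
      then have "t * (LINT x|M. 1 / ((u - x)\<^sup>2 + t\<^sup>2)) \<le> B" using P[of t] t by simp
      then show "(LINT x|M. 1 / ((u - x)\<^sup>2 + t\<^sup>2)) \<le> B * (1 / t)" using t0 by (simp add: field_simps)
    qed
    also have "\<dots> = B * (LINT t:{\<eta>..1}|lborel. 1 / t)" by (rule set_integral_mult_right)
    finally show ?thesis unfolding integral_inverse_Icc(1)[OF \<eta>] by simp
  qed
  have "cdf M u - smoothed_cdf M u \<eta> = (LINT x|M. indicator {..u} x) - smoothed_cdf M u \<eta>"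
    by (simp add: cdf_def)
  also have "\<dots> = (LINT x|M. indicator {..u} x - (1 / 2 + arctan ((u - x) / \<eta>) / pi))"
    unfolding smoothed_cdf_def
    by (rule Bochner_Integration.integral_diff[symmetric]) (auto intro: integrable_smoothing_kernel[OF M] simp: emeasure_eq_measure)
  finally have "\<bar>cdf M u - smoothed_cdf M u \<eta>\<bar> = \<bar>LINT x|M. indicator {..u} x - (1 / 2 + arctan ((u - x) / \<eta>) / pi)\<bar>"
    by (rule arg_cong)
  also have "\<dots> \<le> (LINT x|M. 2 * \<eta> * (\<eta> / ((u - x)\<^sup>2 + \<eta>\<^sup>2)) + 5 * \<eta> * (LINT t:{\<eta>..1}|lborel. 1 / ((u - x)\<^sup>2 + t\<^sup>2)) + 2 * \<eta>)"
  proof (rule Bochner_Integration.integral_abs_bound_integral)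
    show "integrable M (\<lambda>x. indicator {..u} x - (1 / 2 + arctan ((u - x) / \<eta>) / pi))"
      by (rule Bochner_Integration.integrable_diff) (auto intro: integrable_smoothing_kernel[OF M] simp: emeasure_eq_measure)
    show "integrable M (\<lambda>x. 2 * \<eta> * (\<eta> / ((u - x)\<^sup>2 + \<eta>\<^sup>2)) + 5 * \<eta> * (LINT t:{\<eta>..1}|lborel. 1 / ((u - x)\<^sup>2 + t\<^sup>2)) + 2 * \<eta>)"
      by (rule Bochner_Integration.integrable_add[OF Bochner_Integration.integrable_add[OF i1 i2]]) simp
    show "\<bar>indicator {..u} x - (1 / 2 + arctan ((u - x) / \<eta>) / pi)\<bar> \<le> 2 * \<eta> * (\<eta> / ((u - x)\<^sup>2 + \<eta>\<^sup>2)) +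
        5 * \<eta> * (LINT t:{\<eta>..1}|lborel. 1 / ((u - x)\<^sup>2 + t\<^sup>2)) + 2 * \<eta>" for x
    proof -
      have "indicator {..u} x = (if 0 \<le> u - x then 1 else 0 :: real)" by (simp add: indicator_def)
      then show ?thesis using step_minus_kernel_le_Poisson[OF \<eta>, of "u - x"] by (simp only:)
    qed
  qed
  also have "\<dots> = 2 * \<eta> * P \<eta> + 5 * \<eta> * J + 2 * \<eta>"
  proof -
    let ?f = "\<lambda>x. 2 * \<eta> * (\<eta> / ((u - x)\<^sup>2 + \<eta>\<^sup>2))"
    let ?g = "\<lambda>x. 5 * \<eta> * (LINT t:{\<eta>..1}|lborel. 1 / ((u - x)\<^sup>2 + t\<^sup>2))"
    have c: "(LINT x|M. 2 * \<eta>) = 2 * \<eta>" by (simp add: prob_space[unfolded space_eq_univ])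
    have f: "(LINT x|M. ?f x) = 2 * \<eta> * P \<eta>" unfolding P_def by (rule integral_mult_right_zero)
    have g: "(LINT x|M. ?g x) = 5 * \<eta> * J" unfolding J_def by (rule integral_mult_right_zero)
    have "(LINT x|M. ?f x + ?g x + 2 * \<eta>) = (LINT x|M. ?f x + ?g x) + (LINT x|M. 2 * \<eta>)"
      by (rule Bochner_Integration.integral_add[OF Bochner_Integration.integrable_add[OF i1 i2] integrable_const])
    also have "(LINT x|M. ?f x + ?g x) = (LINT x|M. ?f x) + (LINT x|M. ?g x)"
      by (rule Bochner_Integration.integral_add[OF i1 i2])
    finally show ?thesis by (simp only: f g c)
  qed
  also have "\<dots> \<le> 2 * \<eta> * B + 5 * \<eta> * (B * - ln \<eta>) + 2 * \<eta>"
    using P[of \<eta>] J \<eta> by (intro add_mono mult_left_mono) auto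
  finally show ?thesis .
qed

section \<open>Comparing the smoothed distribution functions of two measures\<close>

lemma smoothed_cdf_difference_le:
  assumes M: "real_distribution M" and M': "real_distribution M'" and \<eta>: "0 < \<eta>" "\<eta> \<le> T"
    and h: "\<And>t. \<eta> \<le> t \<Longrightarrow> t \<le> T \<Longrightarrow>
       norm ((LINT x|M. 1 / (Complex u t - of_real x)) - (LINT x|M'. 1 / (Complex u t - of_real x))) \<le> h t"
    and hi: "set_integrable lborel {\<eta>..T} h"
  shows "\<bar>(smoothed_cdf M u \<eta> - smoothed_cdf M' u \<eta>) - (smoothed_cdf M u T - smoothed_cdf M' u T)\<bar>
    \<le> (LINT t:{\<eta>..T}|lborel. h t)"
proof -
  define g g' where "g = (\<lambda>t. Re (LINT x|M. 1 / (Complex u t - of_real x)))"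
    and "g' = (\<lambda>t. Re (LINT x|M'. 1 / (Complex u t - of_real x)))"
  note d = smoothed_cdf_diff[OF M \<eta>, of u, folded g_def] and d' = smoothed_cdf_diff[OF M' \<eta>, of u, folded g'_def]
  have gh: "\<bar>g t - g' t\<bar> \<le> h t" if "t \<in> {\<eta>..T}" for t
    unfolding g_def g'_def minus_complex.sel[symmetric]
    by (rule order_trans[OF abs_Re_le_cmod h]) (use that in auto)
  have "(smoothed_cdf M u \<eta> - smoothed_cdf M' u \<eta>) - (smoothed_cdf M u T - smoothed_cdf M' u T)
    = ((LINT t:{\<eta>..T}|lborel. g t) - (LINT t:{\<eta>..T}|lborel. g' t)) / pi"
    using d(1) d'(1) by (simp add: diff_divide_distrib)
  also have "\<dots> = (LINT t:{\<eta>..T}|lborel. g t - g' t) / pi"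
    using set_integral_diff(2)[OF d(2) d'(2)] by simp
  also have "\<bar>\<dots>\<bar> = \<bar>LINT t:{\<eta>..T}|lborel. g t - g' t\<bar> / pi" by simp
  also have "\<dots> \<le> (LINT t:{\<eta>..T}|lborel. h t) / 1"
  proof (rule frac_le)
    show "\<bar>LINT t:{\<eta>..T}|lborel. g t - g' t\<bar> \<le> (LINT t:{\<eta>..T}|lborel. h t)"
      unfolding set_lebesgue_integral_def
    proof (rule Bochner_Integration.integral_abs_bound_integral)
      show "integrable lborel (\<lambda>t. indicator {\<eta>..T} t *\<^sub>R (g t - g' t))"
        using set_integral_diff(1)[OF d(2) d'(2)] by (simp add: set_integrable_def)
      show "integrable lborel (\<lambda>t. indicator {\<eta>..T} t *\<^sub>R h t)" using hi by (simp add: set_integrable_def)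
      show "\<bar>indicator {\<eta>..T} t *\<^sub>R (g t - g' t)\<bar> \<le> indicator {\<eta>..T} t *\<^sub>R h t" for t
        using gh[of t] by (cases "t \<in> {\<eta>..T}") auto
    qed
    then show "0 \<le> (LINT t:{\<eta>..T}|lborel. h t)" by simp
  qed (use pi_gt3 in auto)
  finally show ?thesis by simp
qed

text \<open>The bound A/t yields the logarithm on [\<eta>, 1] but is not integrable at infinity, so
  beyond 1 the faster decay A/t^2 is required. The boundary term at scale T disappears because both
  smoothed functions have the same limit.\<close>

lemma smoothed_cdf_close:
  assumes M: "real_distribution M" and M': "real_distribution M'" and \<eta>: "0 < \<eta>" "\<eta> \<le> 1"
    and h1: "\<And>t. \<eta> \<le> t \<Longrightarrow> t \<le> 1 \<Longrightarrow>
       norm ((LINT x|M. 1 / (Complex u t - of_real x)) - (LINT x|M'. 1 / (Complex u t - of_real x))) \<le> A * (1 / t)"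
    and h2: "\<And>t. 1 \<le> t \<Longrightarrow>
       norm ((LINT x|M. 1 / (Complex u t - of_real x)) - (LINT x|M'. 1 / (Complex u t - of_real x))) \<le> A * (1 / t\<^sup>2)"
  shows "\<bar>smoothed_cdf M u \<eta> - smoothed_cdf M' u \<eta>\<bar> \<le> A * - ln \<eta> + A"
proof -
  define D where "D = (\<lambda>t. smoothed_cdf M u t - smoothed_cdf M' u t)"
  have A0: "0 \<le> A" using order_trans[OF norm_ge_zero h2[of 1]] by simp
  have 1: "\<bar>D \<eta> - D 1\<bar> \<le> A * - ln \<eta>"
  proof -
    have "\<bar>D \<eta> - D 1\<bar> \<le> (LINT t:{\<eta>..1}|lborel. A * (1 / t))"
      unfolding D_def
      by (intro smoothed_cdf_difference_le[OF M M' \<eta> h1] set_integrable_mult_right integral_inverse_Icc(2)[OF \<eta>])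
    also have "\<dots> = A * (LINT t:{\<eta>..1}|lborel. 1 / t)" by (rule set_integral_mult_right)
    finally show ?thesis unfolding integral_inverse_Icc(1)[OF \<eta>] by simp
  qed
  have 2: "\<bar>D 1 - D T\<bar> \<le> A" if "1 \<le> T" for T
  proof -
    have "\<bar>D 1 - D T\<bar> \<le> (LINT t:{1..T}|lborel. A * (1 / t\<^sup>2))"
      unfolding D_def
      by (intro smoothed_cdf_difference_le[OF M M'] h2 set_integrable_mult_right integral_inverse_square_Icc(2)[OF that] that) auto
    also have "\<dots> = A * (LINT t:{1..T}|lborel. 1 / t\<^sup>2)" by (rule set_integral_mult_right)
    also have "\<dots> \<le> A * 1" using A0 integral_inverse_square_Icc(1)[OF that] by (intro mult_left_mono)
    finally show ?thesis by simp
  qed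
  have "(\<lambda>n. D (real n)) \<longlonglongrightarrow> 1 / 2 - 1 / 2"
    unfolding D_def by (intro tendsto_diff smoothed_cdf_at_top M M')
  then have "(\<lambda>n. \<bar>D 1 - D (real n)\<bar>) \<longlonglongrightarrow> \<bar>D 1 - 0\<bar>" by (intro tendsto_intros) auto
  moreover have "\<forall>\<^sub>F n in sequentially. \<bar>D 1 - D (real n)\<bar> \<le> A"
    using eventually_ge_at_top[of 1] by eventually_elim (use 2 in auto)
  ultimately have "\<bar>D 1 - 0\<bar> \<le> A" by (rule tendsto_upperbound) simp
  then show ?thesis using 1 unfolding D_def by linarith
qed

section \<open>The argument of the Cauchy transform\<close>

lemma Poisson_atLeast:
  fixes u t c :: real
  assumes t: "0 < t"
  shows "has_bochner_integral lborel (\<lambda>w. t / ((u - w)\<^sup>2 + t\<^sup>2) * indicator {c..} w) (pi / 2 + arctan ((u - c) / t))"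
proof -
  have pos: "0 < (u - w)\<^sup>2 + t\<^sup>2" for w using t by (simp add: add_nonneg_pos)
  have lim: "((\<lambda>w. arctan ((w - u) / t)) \<longlongrightarrow> pi / 2) at_top"
  proof (rule filterlim_compose[OF tendsto_arctan_at_top])
    have "filterlim (\<lambda>w. w + - u) at_top at_top"
      using filterlim_tendsto_add_at_top[OF tendsto_const filterlim_ident, of "- u"] by (simp add: add.commute)
    then have "filterlim (\<lambda>w. inverse t * (w + - u)) at_top at_top"
      using t by (intro filterlim_tendsto_pos_mult_at_top[OF tendsto_const]) auto
    then show "filterlim (\<lambda>w. (w - u) / t) at_top at_top" by (simp add: divide_inverse mult.commute)
  qed
  have "(\<integral>\<^sup>+w. ennreal (t / ((u - w)\<^sup>2 + t\<^sup>2)) * indicator {c..} w \<partial>lborel) = ennreal (pi / 2 - arctan ((c - u) / t))"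
  proof (rule nn_integral_FTC_atLeast[OF _ _ _ lim])
    fix w
    have "((\<lambda>w. arctan ((w - u) / t)) has_real_derivative inverse (1 + ((w - u) / t)\<^sup>2) * (1 / t)) (at w)"
      using t by (auto intro!: derivative_eq_intros)
    moreover have "inverse (1 + ((w - u) / t)\<^sup>2) * (1 / t) = t / ((u - w)\<^sup>2 + t\<^sup>2)"
    proof -
      have "1 + ((w - u) / t)\<^sup>2 = ((u - w)\<^sup>2 + t\<^sup>2) / t\<^sup>2"
        using t by (simp add: power_divide add_divide_distrib power2_commute[of w u])
      then show ?thesis using t pos[of w] by (simp add: power2_eq_square)
    qed
    ultimately show "((\<lambda>w. arctan ((w - u) / t)) has_real_derivative t / ((u - w)\<^sup>2 + t\<^sup>2)) (at w)" by simp
  qed (use t pos in \<open>auto intro!: divide_nonneg_nonneg\<close>)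
  also have "(\<integral>\<^sup>+w. ennreal (t / ((u - w)\<^sup>2 + t\<^sup>2)) * indicator {c..} w \<partial>lborel) =
      (\<integral>\<^sup>+w. ennreal (t / ((u - w)\<^sup>2 + t\<^sup>2) * indicator {c..} w) \<partial>lborel)"
    by (intro nn_integral_cong) (auto simp: indicator_def)
  finally have nn: "(\<integral>\<^sup>+w. ennreal (t / ((u - w)\<^sup>2 + t\<^sup>2) * indicator {c..} w) \<partial>lborel) = ennreal (pi / 2 - arctan ((c - u) / t))" .
  have e: "pi / 2 - arctan ((c - u) / t) = pi / 2 + arctan ((u - c) / t)"
    using arctan_minus[of "(u - c) / t"] by (simp add: minus_divide_left)
  have "0 \<le> pi / 2 + arctan ((u - c) / t)" using arctan_lbound[of "(u - c) / t"] by simp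
  then show ?thesis
    using nn[unfolded e] t by (intro has_bochner_integral_nn_integral) (auto simp: indicator_def)
qed

text \<open>Reflection w -> -w of the preceding half-line; the endpoint c changes sides, which
  affects a null set only.\<close>

lemma Poisson_atMost:
  fixes u t c :: real
  assumes t: "0 < t"
  shows "has_bochner_integral lborel (\<lambda>w. t / ((u - w)\<^sup>2 + t\<^sup>2) * indicator {..<c} w) (pi / 2 - arctan ((u - c) / t))"
proof -
  have "has_bochner_integral lborel (\<lambda>w. t / ((- u - w)\<^sup>2 + t\<^sup>2) * indicator {-c..} w) (pi / 2 + arctan ((- u - - c) / t))"
    by (rule Poisson_atLeast[OF t])
  then have "has_bochner_integral lborel (\<lambda>w. t / ((- u - (0 + (-1) * w))\<^sup>2 + t\<^sup>2) * indicator {-c..} (0 + (-1) * w))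
     ((pi / 2 + arctan ((- u - - c) / t)) /\<^sub>R \<bar>-1\<bar>)"
    by (subst (asm) lborel_has_bochner_integral_real_affine_iff[where c="-1" and t=0]) simp
  moreover have "(pi / 2 + arctan ((- u - - c) / t)) /\<^sub>R \<bar>-1\<bar> = pi / 2 - arctan ((u - c) / t)"
    using arctan_minus[of "(u - c) / t"] by (simp add: minus_divide_left)
  moreover have "(- u - (0 + (-1) * w))\<^sup>2 = (u - w)\<^sup>2" for w by (simp add: power2_eq_square algebra_simps)
  ultimately have h: "has_bochner_integral lborel (\<lambda>w. t / ((u - w)\<^sup>2 + t\<^sup>2) * indicator {-c..} (0 + (-1) * w)) (pi / 2 - arctan ((u - c) / t))"
    by simp
  have "AE w in lborel. t / ((u - w)\<^sup>2 + t\<^sup>2) * indicator {-c..} (0 + (-1) * w) = t / ((u - w)\<^sup>2 + t\<^sup>2) * indicator {..<c} w"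
    using AE_lborel_singleton[of c] by eventually_elim (auto simp: indicator_def)
  then show ?thesis using h by (subst (asm) has_bochner_integral_cong_AE) auto
qed

lemma Poisson_UNIV:
  fixes u t :: real
  assumes t: "0 < t"
  shows "has_bochner_integral lborel (\<lambda>w. t / ((u - w)\<^sup>2 + t\<^sup>2)) pi"
proof -
  have "has_bochner_integral lborel (\<lambda>w. t / ((u - w)\<^sup>2 + t\<^sup>2) * indicator {0..} w + t / ((u - w)\<^sup>2 + t\<^sup>2) * indicator {..<0} w)
     ((pi / 2 + arctan ((u - 0) / t)) + (pi / 2 - arctan ((u - 0) / t)))"
    by (intro has_bochner_integral_add Poisson_atLeast Poisson_atMost t)
  moreover have "t / ((u - w)\<^sup>2 + t\<^sup>2) * indicator {0..} w + t / ((u - w)\<^sup>2 + t\<^sup>2) * indicator {..<0} w = t / ((u - w)\<^sup>2 + t\<^sup>2)" for w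
    by (auto simp: indicator_def)
  ultimately show ?thesis by simp
qed

lemma Poisson_Icc:
  fixes u t \<rho> :: real
  assumes t: "0 < t" and "0 \<le> \<rho>"
  shows "has_bochner_integral lborel (\<lambda>w. t / ((u - w)\<^sup>2 + t\<^sup>2) * indicator {u..<u + \<rho>} w) (arctan (\<rho> / t))"
proof -
  have "has_bochner_integral lborel (\<lambda>w. t / ((u - w)\<^sup>2 + t\<^sup>2) * indicator {u..} w - t / ((u - w)\<^sup>2 + t\<^sup>2) * indicator {u + \<rho>..} w)
     ((pi / 2 + arctan ((u - u) / t)) - (pi / 2 + arctan ((u - (u + \<rho>)) / t)))"
    by (intro has_bochner_integral_diff Poisson_atLeast t)
  moreover have "t / ((u - w)\<^sup>2 + t\<^sup>2) * indicator {u..} w - t / ((u - w)\<^sup>2 + t\<^sup>2) * indicator {u + \<rho>..} w = t / ((u - w)\<^sup>2 + t\<^sup>2) * indicator {u..<u + \<rho>} w" for w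
    using assms(2) by (auto simp: indicator_def)
  moreover have "(u - (u + \<rho>)) / t = - (\<rho> / t)" by simp
  ultimately show ?thesis by (simp only: arctan_minus) simp
qed

lemma Complex_polar:
  fixes u t :: real
  assumes t: "0 < t"
  shows "Complex u t = of_real (norm (Complex u t)) * cis (pi / 2 - arctan (u / t))"
proof -
  have n: "norm (Complex u t) = t * sqrt (1 + (u / t)\<^sup>2)"
  proof -
    have "u\<^sup>2 + t\<^sup>2 = t\<^sup>2 * (1 + (u / t)\<^sup>2)" using t by (simp add: power_divide algebra_simps)
    then show ?thesis using t by (simp add: complex_norm real_sqrt_mult)
  qed
  have "0 < 1 + (u / t)\<^sup>2" by (simp add: add_pos_nonneg)
  then have s: "sqrt (1 + (u / t)\<^sup>2) \<noteq> 0" by simp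
  show ?thesis
    unfolding n using t s by (simp add: complex_eq_iff cos_diff sin_diff sin_arctan cos_arctan)
qed

text \<open>With the kernel of total mass \<pi>, the imaginary part of the exponent is the Poisson
  integral of the negative half-line minus that of \<open>\<kappa>\<close>. The former is exactly
  the argument of u + it, so division by z cancels it. Stating the result with a sine avoids any
  choice of branch.\<close>

lemma Im_cauchy_transform_slope:
  fixes \<kappa> :: "real \<Rightarrow> real" and u t :: real
  assumes [measurable]: "\<kappa> \<in> borel_measurable borel" and \<kappa>: "\<And>w. 0 \<le> \<kappa> w" "\<And>w. \<kappa> w \<le> 1" and R: "0 < R"
    and supp: "\<And>w. w < - R \<Longrightarrow> \<kappa> w = 1" "\<And>w. R < w \<Longrightarrow> \<kappa> w = 0" and t: "0 < t"
  defines "G \<equiv> exp (LINT w|lborel. 1 / (Complex u t - of_real w) * of_real (\<kappa> w - indicator {..<0} w)) / Complex u t"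
  shows "Im G = - norm G * sin (LINT w|lborel. \<kappa> w * (t / ((u - w)\<^sup>2 + t\<^sup>2)))"
    and "integrable lborel (\<lambda>w. \<kappa> w * (t / ((u - w)\<^sup>2 + t\<^sup>2)))"
proof -
  define P where "P = (\<lambda>w. t / ((u - w)\<^sup>2 + t\<^sup>2))"
  have [measurable]: "P \<in> borel_measurable borel" unfolding P_def by measurable
  have P0: "0 \<le> P w" for w unfolding P_def using t by simp
  have iP: "integrable lborel P" using Poisson_UNIV[OF t, of u] by (simp add: P_def has_bochner_integral_iff)
  have i1: "integrable lborel (\<lambda>w. \<kappa> w * P w)"
    by (rule Bochner_Integration.integrable_bound[OF iP]) (use \<kappa> P0 in \<open>auto simp: abs_mult intro!: mult_left_le_one_le\<close>)
  then show "integrable lborel (\<lambda>w. \<kappa> w * (t / ((u - w)\<^sup>2 + t\<^sup>2)))" by (simp add: P_def)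
  define \<theta> where "\<theta> = (LINT w|lborel. \<kappa> w * P w)"
  define E where "E = (LINT w|lborel. 1 / (Complex u t - of_real w) * of_real (\<kappa> w - indicator {..<0} w))"
  have iE: "integrable lborel (\<lambda>w. 1 / (Complex u t - of_real w) * of_real (\<kappa> w - indicator {..<0} w))"
  proof (rule integrable_bounded_support[of _ "1 / t * 1" R])
    show "norm (1 / (Complex u t - of_real w) * of_real (\<kappa> w - indicator {..<0} w)) \<le> 1 / t * 1" for w
      unfolding norm_mult norm_of_real
      using norm_inverse_shift_le[of "Complex u t" w] t \<kappa>[of w] by (intro mult_mono) (auto simp: indicator_def)
    show "1 / (Complex u t - of_real w) * of_real (\<kappa> w - indicator {..<0} w) = 0" if "R < \<bar>w\<bar>" for w
    proof -
      have "w < - R \<or> R < w" using that by auto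
      then show ?thesis using supp[of w] R by auto
    qed
  qed measurable
  have i0: "has_bochner_integral lborel (\<lambda>w. P w * indicator {..<0} w) (pi / 2 - arctan (u / t))"
    using Poisson_atMost[OF t, of u 0] by (simp only: P_def diff_0_right)
  have "Im E = (LINT w|lborel. Im (1 / (Complex u t - of_real w) * of_real (\<kappa> w - indicator {..<0} w)))"
    unfolding E_def by (rule integral_Im[OF iE, symmetric])
  also have "\<dots> = (LINT w|lborel. P w * indicator {..<0} w - \<kappa> w * P w)"
  proof (rule Bochner_Integration.integral_cong[OF refl])
    fix w
    have "Im (1 / (Complex u t - of_real w) * of_real (\<kappa> w - indicator {..<0} w)) = Im (1 / (Complex u t - of_real w)) * (\<kappa> w - indicator {..<0} w)"
      by (simp only: Im_complex_of_real Re_complex_of_real times_complex.sel)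
    moreover have "Im (1 / (Complex u t - of_real w)) = - P w" by (simp only: Im_inverse_shift P_def)
    ultimately show "Im (1 / (Complex u t - of_real w) * of_real (\<kappa> w - indicator {..<0} w)) = P w * indicator {..<0} w - \<kappa> w * P w"
      by (simp only:) (simp add: algebra_simps)
  qed
  also have "\<dots> = (pi / 2 - arctan (u / t)) - \<theta>"
    using i0 i1 unfolding \<theta>_def
    by (simp add: has_bochner_integral_iff)
  finally have ImE: "Im E - (pi / 2 - arctan (u / t)) = - \<theta>" by simp
  define r where "r = exp (Re E) / norm (Complex u t)"
  have "Complex u t \<noteq> 0" using t by (auto simp: complex_eq_iff)
  then have r: "0 < r" by (simp add: r_def)
  have "G = (of_real (exp (Re E)) * cis (Im E)) / (of_real (norm (Complex u t)) * cis (pi / 2 - arctan (u / t)))"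
    unfolding G_def E_def[symmetric] Complex_polar[OF t, symmetric] by (subst exp_eq_polar) (rule refl)
  also have "\<dots> = of_real r * (cis (Im E) / cis (pi / 2 - arctan (u / t)))"
    by (simp only: r_def of_real_divide times_divide_times_eq)
  also have "\<dots> = of_real r * cis (- \<theta>)" unfolding cis_divide ImE ..
  finally have G: "G = of_real r * cis (- \<theta>)" .
  have nG: "norm G = r" unfolding G using r by (simp add: norm_mult)
  have "Im G = - r * sin \<theta>" unfolding G by simp
  then show "Im G = - norm G * sin (LINT w|lborel. \<kappa> w * (t / ((u - w)\<^sup>2 + t\<^sup>2)))"
    unfolding nG by (simp only: \<theta>_def P_def)
qed

section \<open>Bounds on the Cauchy transform\<close>

lemma sin_ge_sin_of_mem_Icc:
  assumes "0 \<le> c" "c \<le> \<theta>" "\<theta> \<le> pi - c"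
  shows "sin c \<le> sin \<theta>"
proof (cases "\<theta> \<le> pi / 2")
  case True
  then show ?thesis using assms by (intro sin_monotone_2pi_le) auto
next
  case False
  have "sin c \<le> sin (pi - \<theta>)" using assms False by (intro sin_monotone_2pi_le) auto
  then show ?thesis by simp
qed

lemma slope_bounds_of_lipschitz:
  assumes lip: "lipschitz_on (1 - \<delta>) {a..b} \<Omega>" and w: "w \<in> {a<..<b}"
    and der: "(\<Omega> has_real_derivative (1 - 2 * k)) (at w)"
  shows "\<delta> / 2 \<le> k" "k \<le> 1 - \<delta> / 2"
proof -
  have "\<bar>1 - 2 * k\<bar> \<le> 1 - \<delta>"
  proof (rule tendsto_upperbound)
    show "((\<lambda>y. \<bar>(\<Omega> y - \<Omega> w) / (y - w)\<bar>) \<longlongrightarrow> \<bar>1 - 2 * k\<bar>) (at w)"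
      using der by (intro tendsto_rabs) (simp add: has_field_derivative_iff)
    have "\<forall>\<^sub>F y in at w. y \<in> {a<..<b}" using w by (intro eventually_at_in_open') auto
    moreover have "\<forall>\<^sub>F y in at w. y \<noteq> w" by (simp add: eventually_at_filter)
    ultimately show "\<forall>\<^sub>F y in at w. \<bar>(\<Omega> y - \<Omega> w) / (y - w)\<bar> \<le> 1 - \<delta>"
    proof eventually_elim
      case (elim y)
      then have "\<bar>\<Omega> y - \<Omega> w\<bar> \<le> (1 - \<delta>) * \<bar>y - w\<bar>"
        using lipschitz_onD[OF lip, of y w] w by (simp add: dist_real_def)
      then show ?case using elim by (simp add: abs_divide divide_le_eq)
    qed
  qed simp
  then show "\<delta> / 2 \<le> k" "k \<le> 1 - \<delta> / 2" by (auto simp: abs_le_iff)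
qed

text \<open>Let \<theta> be the integral of \<open>\<kappa>\<close> against the Poisson kernel of
  total mass \<pi>. Almost everywhere on [u, u + \<rho>) both \<open>\<kappa>\<close> and 1 -
  \<open>\<kappa>\<close> are at least \<delta>/2, and the kernel has mass arctan(\<rho>/t) \<ge>
  arctan \<rho> there because t \<le> 1. So \<theta> stays at distance at least \<delta>/2 times
  arctan \<rho> from 0 and from \<pi>, uniformly in t.\<close>

lemma norm_cauchy_transform_le_Im:
  assumes \<Omega>: "continual_diagram \<Omega>" and \<delta>: "0 < \<delta>" and lip: "lipschitz_on (1 - \<delta>) {a..b} \<Omega>"
    and u: "a \<le> u" "u + \<rho> \<le> b" and \<rho>: "0 < \<rho>" and t: "0 < t" "t \<le> 1"
  shows "norm (cauchy_transform \<Omega> (Complex u t)) * sin (\<delta> / 2 * arctan \<rho>) \<le> - Im (cauchy_transform \<Omega> (Complex u t))"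
    and "0 < sin (\<delta> / 2 * arctan \<rho>)"
proof -
  obtain \<kappa> R where k: "\<kappa> \<in> borel_measurable borel" "\<And>w. 0 \<le> \<kappa> w" "\<And>w. \<kappa> w \<le> 1" "0 < R"
    "\<And>w. w < - R \<Longrightarrow> \<kappa> w = 1" "\<And>w. R < w \<Longrightarrow> \<kappa> w = 0"
    "AE w in lborel. (\<Omega> has_real_derivative (1 - 2 * \<kappa> w)) (at w)"
    by (rule continual_diagram_slope[OF \<Omega>]) blast
  define G where "G = cauchy_transform \<Omega> (Complex u t)"
  have G: "G = exp (LINT w|lborel. 1 / (Complex u t - of_real w) * of_real (\<kappa> w - indicator {..<0} w)) / Complex u t"
    unfolding G_def using t by (intro cauchy_transform_slope(1)[OF \<Omega> _ k(1) k(7)]) simp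
  define P where "P = (\<lambda>w. t / ((u - w)\<^sup>2 + t\<^sup>2))"
  define \<theta> where "\<theta> = (LINT w|lborel. \<kappa> w * P w)"
  have P0: "0 \<le> P w" for w unfolding P_def using t by simp
  have Im: "Im G = - norm G * sin \<theta>" and i1: "integrable lborel (\<lambda>w. \<kappa> w * P w)"
    unfolding G \<theta>_def P_def using Im_cauchy_transform_slope[OF k(1-6) t(1), of u] by simp_all
  have iP: "integrable lborel P" and P1: "(LINT w|lborel. P w) = pi"
    using Poisson_UNIV[OF t(1), of u] by (simp_all add: P_def has_bochner_integral_iff)
  have "has_bochner_integral lborel (\<lambda>w. P w * indicator {u..<u + \<rho>} w) (arctan (\<rho> / t))"
    unfolding P_def by (rule Poisson_Icc) (use t \<rho> in auto)
  then have iI: "integrable lborel (\<lambda>w. P w * indicator {u..<u + \<rho>} w)"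
    and I: "(LINT w|lborel. P w * indicator {u..<u + \<rho>} w) = arctan (\<rho> / t)"
    by (simp_all add: has_bochner_integral_iff)
  \<comment> \<open>The slope bounds are known at interior points only, and u = a is permitted;
    hence the point a is removed.\<close>
  have ae: "AE w in lborel. w \<in> {u..<u + \<rho>} \<longrightarrow> \<delta> / 2 \<le> \<kappa> w \<and> \<kappa> w \<le> 1 - \<delta> / 2"
    using k(7) AE_lborel_singleton[of a]
  proof eventually_elim
    case (elim w)
    show ?case
    proof
      assume "w \<in> {u..<u + \<rho>}"
      then have "w \<in> {a<..<b}" using u elim(2) by auto
      then show "\<delta> / 2 \<le> \<kappa> w \<and> \<kappa> w \<le> 1 - \<delta> / 2" using slope_bounds_of_lipschitz[OF lip _ elim(1)] by blast
    qed
  qed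
  define c where "c = \<delta> / 2 * arctan \<rho>"
  \<comment> \<open>A Lipschitz constant is nonnegative, so \<delta> \<le> 1; this keeps c below
    \<pi>/2 and its sine positive.\<close>
  have d1: "\<delta> \<le> 1" using lipschitz_on_nonneg[OF lip] by simp
  have at: "0 < arctan \<rho>" "arctan \<rho> < pi / 2" using \<rho> arctan_ubound by auto
  have c0: "0 < c" using \<delta> at by (simp add: c_def)
  have c1: "c < pi / 2"
  proof -
    have "c \<le> 1 * arctan \<rho>" unfolding c_def using d1 at by (intro mult_right_mono) auto
    then show ?thesis using at by simp
  qed
  have "\<rho> \<le> \<rho> / t" using t \<rho> by (simp add: field_simps)
  then have "arctan \<rho> \<le> arctan (\<rho> / t)" by (simp add: arctan_le_iff)
  then have cI: "c \<le> \<delta> / 2 * arctan (\<rho> / t)" unfolding c_def using \<delta> by (intro mult_left_mono) auto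
  have "\<delta> / 2 * arctan (\<rho> / t) = (LINT w|lborel. \<delta> / 2 * (P w * indicator {u..<u + \<rho>} w))"
    unfolding integral_mult_right_zero I ..
  also have "\<dots> \<le> \<theta>" unfolding \<theta>_def
  proof (rule integral_mono_AE)
    show "AE w in lborel. \<delta> / 2 * (P w * indicator {u..<u + \<rho>} w) \<le> \<kappa> w * P w"
      using ae
    proof eventually_elim
      case (elim w)
      then show ?case using mult_right_mono[of "\<delta> / 2" "\<kappa> w" "P w"] P0[of w] k(2)[of w] by (cases "w \<in> {u..<u + \<rho>}") auto
    qed
  qed (rule integrable_mult_right[OF iI], rule i1)
  finally have t1: "c \<le> \<theta>" using cI by simp
  have "\<delta> / 2 * arctan (\<rho> / t) = (LINT w|lborel. \<delta> / 2 * (P w * indicator {u..<u + \<rho>} w))"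
    unfolding integral_mult_right_zero I ..
  also have "\<dots> \<le> (LINT w|lborel. P w - \<kappa> w * P w)"
  proof (rule integral_mono_AE)
    show "AE w in lborel. \<delta> / 2 * (P w * indicator {u..<u + \<rho>} w) \<le> P w - \<kappa> w * P w"
      using ae
    proof eventually_elim
      case (elim w)
      have "P w - \<kappa> w * P w = (1 - \<kappa> w) * P w" by (simp add: algebra_simps)
      then show ?case using elim mult_right_mono[of "\<delta> / 2" "1 - \<kappa> w" "P w"] P0[of w] k(3)[of w] by (cases "w \<in> {u..<u + \<rho>}") auto
    qed
  qed (rule integrable_mult_right[OF iI], rule Bochner_Integration.integrable_diff[OF iP i1])
  also have "\<dots> = pi - \<theta>" unfolding \<theta>_def using Bochner_Integration.integral_diff[OF iP i1] P1 by simp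
  finally have t2: "\<theta> \<le> pi - c" using cI by simp
  have "norm G * sin c \<le> norm G * sin \<theta>"
    using sin_ge_sin_of_mem_Icc[OF _ t1 t2] c0 by (intro mult_left_mono) auto
  then show "norm (cauchy_transform \<Omega> (Complex u t)) * sin (\<delta> / 2 * arctan \<rho>) \<le> - Im (cauchy_transform \<Omega> (Complex u t))"
    using Im unfolding G_def[symmetric] c_def[symmetric] by simp
  show "0 < sin (\<delta> / 2 * arctan \<rho>)"
    unfolding c_def[symmetric] using c0 c1 by (intro sin_gt_zero) auto
qed

text \<open>Inside [a, b] the density is at most C and the Poisson kernel has total mass \<pi>.
  Outside, points are at distance at least \<rho> from u, where the kernel is at most t/\<rho>^2
  \<le> 1/\<rho>^2, and \<open>M\<close> has total mass 1.\<close>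

lemma Im_cauchy_transform_density_le:
  fixes f :: "real \<Rightarrow> real"
  assumes M: "real_distribution M" and f: "f \<in> borel_measurable borel" "\<And>x. x \<in> {a..b} \<Longrightarrow> 0 \<le> f x" "\<And>x. x \<in> {a..b} \<Longrightarrow> f x \<le> C"
    and dens: "\<And>A. A \<in> sets borel \<Longrightarrow> A \<subseteq> {a..b} \<Longrightarrow> emeasure M A = (\<integral>\<^sup>+x\<in>A. ennreal (f x) \<partial>lborel)"
    and u: "a + \<rho> \<le> u" "u \<le> b - \<rho>" and \<rho>: "0 < \<rho>" and t: "0 < t" "t \<le> 1"
  shows "- Im (LINT x|M. 1 / (Complex u t - of_real x)) \<le> C * pi + 1 / \<rho>\<^sup>2"
proof -
  interpret real_distribution M by fact
  note [measurable] = f(1)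
  have ab: "u \<in> {a..b}" using u \<rho> by auto
  have C0: "0 \<le> C" using f(2,3)[OF ab] by simp
  define P where "P = (\<lambda>w. t / ((u - w)\<^sup>2 + t\<^sup>2))"
  have [measurable]: "P \<in> borel_measurable borel" unfolding P_def by measurable
  have P0: "0 \<le> P w" for w unfolding P_def using t by simp
  have iP: "integrable M P"
  proof -
    have "integrable M (\<lambda>x. - Im (1 / (Complex u t - of_real x)))"
      using integrable_inverse_shift[OF M, of "Complex u t"] t by (intro integrable_minus integrable_Im) auto
    then show ?thesis by (simp add: Im_inverse_shift P_def)
  qed
  have "- Im (LINT x|M. 1 / (Complex u t - of_real x)) = (LINT x|M. P x)"
  proof -
    have "(LINT x|M. P x) = (LINT x|M. - Im (1 / (Complex u t - of_real x)))" by (simp add: P_def Im_inverse_shift)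
    also have "\<dots> = - Im (LINT x|M. 1 / (Complex u t - of_real x))"
      using integrable_inverse_shift[OF M, of "Complex u t"] t by simp
    finally show ?thesis ..
  qed
  moreover have le: "ennreal (LINT x|M. P x) \<le> ennreal (C * pi + 1 / \<rho>\<^sup>2)"
  proof -
    \<comment> \<open>The density hypothesis speaks only of subsets of [a, b], so it is rephrased as
      an identity of two measures that vanish outside this interval.\<close>
    have eq: "density M (indicator {a..b}) = density lborel (\<lambda>x. ennreal (f x) * indicator {a..b} x)"
    proof (rule measure_eqI)
      fix A assume "A \<in> sets (density M (indicator {a..b}))"
      then have A: "A \<in> sets borel" by simp
      have "emeasure (density M (indicator {a..b})) A = (\<integral>\<^sup>+x. indicator {a..b} x * indicator A x \<partial>M)"
        using A by (intro emeasure_density) auto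
      also have "\<dots> = (\<integral>\<^sup>+x. indicator (A \<inter> {a..b}) x \<partial>M)"
        by (intro nn_integral_cong) (auto simp: indicator_def)
      also have "\<dots> = emeasure M (A \<inter> {a..b})" using A by simp
      also have "\<dots> = (\<integral>\<^sup>+x\<in>A \<inter> {a..b}. ennreal (f x) \<partial>lborel)" using A by (intro dens) auto
      also have "\<dots> = (\<integral>\<^sup>+x. (ennreal (f x) * indicator {a..b} x) * indicator A x \<partial>lborel)"
        by (intro nn_integral_cong) (auto simp: indicator_def)
      also have "\<dots> = emeasure (density lborel (\<lambda>x. ennreal (f x) * indicator {a..b} x)) A"
        using A by (intro emeasure_density[symmetric]) auto
      finally show "emeasure (density M (indicator {a..b})) A = emeasure (density lborel (\<lambda>x. ennreal (f x) * indicator {a..b} x)) A" .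
    qed simp
    have "ennreal (LINT x|M. P x) = (\<integral>\<^sup>+x. ennreal (P x) \<partial>M)"
      using iP P0 by (intro nn_integral_eq_integral[symmetric]) auto
    also have "\<dots> \<le> (\<integral>\<^sup>+x. indicator {a..b} x * ennreal (P x) + ennreal (1 / \<rho>\<^sup>2) \<partial>M)"
    proof (rule nn_integral_mono)
      fix x
      show "ennreal (P x) \<le> indicator {a..b} x * ennreal (P x) + ennreal (1 / \<rho>\<^sup>2)"
      proof (cases "x \<in> {a..b}")
        case False
        then have "\<rho> \<le> \<bar>u - x\<bar>" using u by auto
        then have "\<rho>\<^sup>2 \<le> (u - x)\<^sup>2" using \<rho> by (metis abs_of_pos abs_le_square_iff)
        then have "\<rho>\<^sup>2 \<le> (u - x)\<^sup>2 + t\<^sup>2" by (simp add: add_increasing2)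
        then have "P x \<le> 1 / \<rho>\<^sup>2" unfolding P_def using t \<rho> by (intro frac_le) auto
        then show ?thesis using False by (simp add: ennreal_leI)
      qed simp
    qed
    also have "\<dots> = (\<integral>\<^sup>+x. indicator {a..b} x * ennreal (P x) \<partial>M) + ennreal (1 / \<rho>\<^sup>2)"
      using emeasure_space_1 by (subst nn_integral_add) auto
    also have "(\<integral>\<^sup>+x. indicator {a..b} x * ennreal (P x) \<partial>M) = (\<integral>\<^sup>+x. ennreal (P x) \<partial>density M (indicator {a..b}))"
      by (subst nn_integral_density) auto
    also have "\<dots> = (\<integral>\<^sup>+x. ennreal (f x) * indicator {a..b} x * ennreal (P x) \<partial>lborel)"
      unfolding eq by (subst nn_integral_density) auto
    also have "\<dots> \<le> (\<integral>\<^sup>+x. ennreal (C * P x) \<partial>lborel)"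
    proof (rule nn_integral_mono)
      fix x
      show "ennreal (f x) * indicator {a..b} x * ennreal (P x) \<le> ennreal (C * P x)"
        using f(2,3)[of x] P0[of x] C0 by (cases "x \<in> {a..b}") (auto simp: ennreal_mult[symmetric] intro!: ennreal_leI mult_right_mono)
    qed
    also have "\<dots> = ennreal (C * pi)"
    proof -
      have "has_bochner_integral lborel (\<lambda>x. C * P x) (C * pi)"
        unfolding P_def by (rule has_bochner_integral_mult_right[OF Poisson_UNIV[OF t(1)]])
      then show ?thesis using P0 C0
        by (subst nn_integral_eq_integral) (auto simp: has_bochner_integral_iff)
    qed
    finally show ?thesis using C0 by (simp add: ennreal_plus add_right_mono)
  qed
  moreover have "(LINT x|M. P x) \<le> C * pi + 1 / \<rho>\<^sup>2"
    using le C0 by (subst (asm) ennreal_le_iff) auto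
  ultimately show ?thesis by simp
qed

section \<open>From the metric on diagrams to the uniform distance\<close>

lemma continual_diagram_ge_abs:
  assumes "continual_diagram \<omega>"
  shows "\<bar>z\<bar> \<le> \<omega> z"
proof -
  obtain R where R: "\<And>z. R \<le> \<bar>z\<bar> \<Longrightarrow> \<omega> z = \<bar>z\<bar>"
    using assms by (auto simp: continual_diagram_def)
  \<comment> \<open>At both ends of [-r, r] the diagram has the value r; with slopes of absolute
    value at most 1 it cannot come down from there to a value below |z|.\<close>
  define r where "r = max R \<bar>z\<bar>"
  have "\<omega> r = r" "\<omega> (- r) = r" using R[of r] R[of "- r"] by (auto simp: r_def)
  moreover have "z \<le> r" "- z \<le> r" by (auto simp: r_def)
  ultimately show ?thesis
    using continual_diagram_lipschitz[OF assms, of r z] continual_diagram_lipschitz[OF assms, of "- r" z] by (smt (verit))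
qed

text \<open>Needed because \<open>infdist\<close> to the empty set is 0, so an empty section would
  make a small Hausdorff distance meaningless. The sign change comes from \<open>\<omega> x\<close>
  \<ge> x at y = 0 and from the region where the diagram equals the absolute value.\<close>

lemma PiY_nonempty:
  assumes \<omega>: "continual_diagram \<omega>" and x: "0 \<le> x"
  shows "PiY \<omega> x \<noteq> {}"
proof -
  obtain R where R: "\<And>z. R \<le> \<bar>z\<bar> \<Longrightarrow> \<omega> z = \<bar>z\<bar>"
    using \<omega> by (auto simp: continual_diagram_def)
  have cont: "isCont \<omega> z" for z
    using continual_diagram_continuous[OF \<omega>] by (simp add: continuous_on_eq_continuous_at)
  define r where "r = max R 0 + x"
  have "\<omega> (x - r) = r - x" using R[of "x - r"] by (simp add: r_def)
  then have "\<omega> (x - r) - (x + r) \<le> 0" using x by simp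
  moreover have "0 \<le> \<omega> (x - 0) - (x + 0)" using continual_diagram_ge_abs[OF \<omega>, of x] by simp
  moreover have "0 \<le> r" using x by (simp add: r_def)
  moreover have "isCont (\<lambda>y. \<omega> (x - y) - (x + y)) y" for y
    by (intro continuous_intros isCont_o2[OF _ cont])
  ultimately obtain y where "0 \<le> y" "\<omega> (x - y) - (x + y) = 0"
    using IVT2[of "\<lambda>y. \<omega> (x - y) - (x + y)" r 0 0] by blast
  then show ?thesis by (auto simp: PiY_def)
qed

text \<open>The graph point over z has rotated coordinates (x, y). Comparing the sections at this x
  yields y' with (x, y') on the other diagram and |y - y'| at most about \<epsilon>. Passing from y
  to y' changes the height x + y by |y - y'|, and moving the base point from x - y' back to z costs
  the same again by the Lipschitz condition; hence the factor 2.\<close>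

lemma uniform_distance_le_diag_dist:
  assumes \<Omega>: "continual_diagram \<Omega>" and \<omega>: "continual_diagram \<omega>" and d: "diag_dist \<Omega> \<omega> \<le> ereal \<epsilon>"
  shows "\<bar>\<omega> z - \<Omega> z\<bar> \<le> 2 * \<epsilon>"
proof -
  define x y where "x = (\<Omega> z + z) / 2" and "y = (\<Omega> z - z) / 2"
  have xy: "0 \<le> x" "0 \<le> y" "x - y = z" "x + y = \<Omega> z"
    using continual_diagram_ge_abs[OF \<Omega>, of z] by (auto simp: x_def y_def field_simps)
  have y: "y \<in> PiY \<Omega> x" using xy by (simp add: PiY_def)
  have "ereal (infdist y (PiY \<omega> x)) \<le> hausd (PiY \<Omega> x) (PiY \<omega> x)"
    unfolding hausd_def using y by (intro max.coboundedI1 SUP_upper)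
  also have "\<dots> \<le> dY \<Omega> \<omega>"
    unfolding dY_def using xy by (intro SUP_upper) simp
  also have "\<dots> \<le> diag_dist \<Omega> \<omega>" unfolding diag_dist_def by simp
  finally have inf: "infdist y (PiY \<omega> x) \<le> \<epsilon>" using d by (metis ereal_less_eq(3) order_trans)
  have ne: "PiY \<omega> x \<noteq> {}" by (rule PiY_nonempty[OF \<omega> xy(1)])
  show ?thesis
  \<comment> \<open>The slack e avoids showing that the distance to the section is attained.\<close>
  proof (rule field_le_epsilon)
    fix e :: real assume "0 < e"
    then have "infdist y (PiY \<omega> x) < \<epsilon> + e / 2" using inf by simp
    then obtain y' where y': "y' \<in> PiY \<omega> x" "dist y y' < \<epsilon> + e / 2"
      unfolding infdist_notempty[OF ne] by (subst (asm) cINF_less_iff[OF ne]) (auto intro: bdd_belowI2[of _ 0])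
    then have "\<omega> (x - y') = x + y'" by (simp add: PiY_def)
    moreover have "\<bar>\<omega> z - \<omega> (x - y')\<bar> \<le> \<bar>y - y'\<bar>"
      using continual_diagram_lipschitz[OF \<omega>, of "x - y" "x - y'"] xy(3) by (simp add: abs_minus_commute)
    ultimately have "\<bar>\<omega> z - \<Omega> z\<bar> \<le> 2 * \<bar>y - y'\<bar>" using xy(4) by (smt (verit))
    then show "\<bar>\<omega> z - \<Omega> z\<bar> \<le> 2 * \<epsilon> + e" using y'(2) by (simp add: dist_real_def)
  qed
qed

text \<open>Both transforms have the same factor 1/z, so their quotient is the exponential of a
  difference of integrals. There |\<omega> - \<Omega>|/2 is at most \<epsilon>, and the integral of
  1/|z - w|^2 over the line is \<pi>/t.\<close>

lemma cauchy_transform_perturbation: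
  assumes \<Omega>: "continual_diagram \<Omega>" and \<omega>: "continual_diagram \<omega>" and d: "\<And>w. \<bar>\<omega> w - \<Omega> w\<bar> \<le> 2 * \<epsilon>" and t: "0 < t"
  obtains D where "cauchy_transform \<omega> (Complex u t) = cauchy_transform \<Omega> (Complex u t) * exp D" "norm D \<le> \<epsilon> * pi / t"
proof -
  define z where "z = Complex u t"
  have z: "Im z \<noteq> 0" using t by (simp add: z_def)
  define I where "I = (\<lambda>\<omega> :: real \<Rightarrow> real. LINT w|lborel. 1 / (z - of_real w)\<^sup>2 * of_real ((\<omega> w - \<bar>w\<bar>) / 2))"
  have tr: "cauchy_transform \<psi> z = exp (I \<psi>) / z" if \<psi>: "continual_diagram \<psi>" for \<psi>
  proof -
    obtain \<kappa> R where "\<kappa> \<in> borel_measurable borel" "AE w in lborel. (\<psi> has_real_derivative (1 - 2 * \<kappa> w)) (at w)"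
      by (rule continual_diagram_slope[OF \<psi>]) blast
    then show ?thesis unfolding I_def by (rule cauchy_transform_slope(2)[OF \<psi> z])
  qed
  have int: "integrable lborel (\<lambda>w. 1 / (z - of_real w)\<^sup>2 * of_real ((\<psi> w - \<bar>w\<bar>) / 2))" if \<psi>: "continual_diagram \<psi>" for \<psi>
  proof -
    obtain R where R: "\<And>z. R \<le> \<bar>z\<bar> \<Longrightarrow> \<psi> z = \<bar>z\<bar>"
      using \<psi> by (auto simp: continual_diagram_def)
    define r where "r = max R 0"
    note [measurable] = borel_measurable_continuous_onI[OF continual_diagram_continuous[OF \<psi>]]
    show ?thesis
    proof (rule integrable_bounded_support[of _ "(1 / \<bar>Im z\<bar>)\<^sup>2 * r" r])
      show "norm (1 / (z - of_real w)\<^sup>2 * of_real ((\<psi> w - \<bar>w\<bar>) / 2)) \<le> (1 / \<bar>Im z\<bar>)\<^sup>2 * r" for w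
        unfolding norm_mult norm_of_real
      proof (rule mult_mono)
        show "norm (1 / (z - complex_of_real w)\<^sup>2) \<le> (1 / \<bar>Im z\<bar>)\<^sup>2"
          using power_mono[OF norm_inverse_shift_le[OF z, of w], of 2]
          by (simp add: norm_divide norm_power power_divide)
        show "\<bar>(\<psi> w - \<bar>w\<bar>) / 2\<bar> \<le> r"
        proof (cases "R \<le> \<bar>w\<bar>")
          case True then show ?thesis using R[of w] by (simp add: r_def)
        next
          case False
          have "\<psi> r = r" using R[of r] by (simp add: r_def)
          moreover have "r = R" using False by (simp add: r_def)
          ultimately show ?thesis
            using False continual_diagram_lipschitz[OF \<psi>, of w r] continual_diagram_ge_abs[OF \<psi>, of w] by auto
        qed
      qed (auto simp: r_def)
      show "1 / (z - of_real w)\<^sup>2 * of_real ((\<psi> w - \<bar>w\<bar>) / 2) = 0" if "r < \<bar>w\<bar>" for w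
        using R[of w] that by (simp add: r_def)
    qed measurable
  qed
  show ?thesis
  proof (rule that[of "I \<omega> - I \<Omega>"])
    show "cauchy_transform \<omega> (Complex u t) = cauchy_transform \<Omega> (Complex u t) * exp (I \<omega> - I \<Omega>)"
      unfolding z_def[symmetric] tr[OF \<Omega>] tr[OF \<omega>] by (simp add: exp_diff)
    have "I \<omega> - I \<Omega> = (LINT w|lborel. 1 / (z - of_real w)\<^sup>2 * of_real ((\<omega> w - \<bar>w\<bar>) / 2) - 1 / (z - of_real w)\<^sup>2 * of_real ((\<Omega> w - \<bar>w\<bar>) / 2))"
      unfolding I_def by (rule Bochner_Integration.integral_diff[symmetric]) (rule int[OF \<omega>], rule int[OF \<Omega>])
    also have "norm \<dots> \<le> (LINT w|lborel. \<epsilon> / t * (t / ((u - w)\<^sup>2 + t\<^sup>2)))"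
    proof (rule Bochner_Integration.integral_norm_bound_integral)
      show "integrable lborel (\<lambda>w. 1 / (z - of_real w)\<^sup>2 * of_real ((\<omega> w - \<bar>w\<bar>) / 2) - 1 / (z - of_real w)\<^sup>2 * of_real ((\<Omega> w - \<bar>w\<bar>) / 2))"
        by (rule Bochner_Integration.integrable_diff) (rule int[OF \<omega>], rule int[OF \<Omega>])
      show "integrable lborel (\<lambda>w. \<epsilon> / t * (t / ((u - w)\<^sup>2 + t\<^sup>2)))"
        using Poisson_UNIV[OF t, of u] by (intro integrable_mult_right) (simp add: has_bochner_integral_iff)
      fix w
      have n: "norm (1 / (z - complex_of_real w)\<^sup>2) = 1 / ((u - w)\<^sup>2 + t\<^sup>2)"
        by (simp add: norm_divide norm_power cmod_power2 z_def)
      have "1 / (z - of_real w)\<^sup>2 * of_real ((\<omega> w - \<bar>w\<bar>) / 2) - 1 / (z - of_real w)\<^sup>2 * of_real ((\<Omega> w - \<bar>w\<bar>) / 2)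
        = 1 / (z - of_real w)\<^sup>2 * of_real ((\<omega> w - \<Omega> w) / 2)"
        unfolding right_diff_distrib[symmetric] of_real_diff[symmetric] by (simp add: field_simps)
      then have "norm (1 / (z - of_real w)\<^sup>2 * of_real ((\<omega> w - \<bar>w\<bar>) / 2) - 1 / (z - of_real w)\<^sup>2 * of_real ((\<Omega> w - \<bar>w\<bar>) / 2))
        = 1 / ((u - w)\<^sup>2 + t\<^sup>2) * \<bar>(\<omega> w - \<Omega> w) / 2\<bar>"
        by (simp only: norm_mult norm_of_real n)
      also have "\<dots> \<le> 1 / ((u - w)\<^sup>2 + t\<^sup>2) * \<epsilon>" using d[of w] by (intro mult_left_mono) auto
      also have "\<dots> = \<epsilon> / t * (t / ((u - w)\<^sup>2 + t\<^sup>2))" using t by simp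
      finally show "norm (1 / (z - of_real w)\<^sup>2 * of_real ((\<omega> w - \<bar>w\<bar>) / 2) - 1 / (z - of_real w)\<^sup>2 * of_real ((\<Omega> w - \<bar>w\<bar>) / 2))
        \<le> \<epsilon> / t * (t / ((u - w)\<^sup>2 + t\<^sup>2))" .
    qed
    also have "\<dots> = \<epsilon> / t * pi"
      using Poisson_UNIV[OF t, of u] unfolding integral_mult_right_zero by (simp add: has_bochner_integral_iff)
    finally show "norm (I \<omega> - I \<Omega>) \<le> \<epsilon> * pi / t" by simp
  qed
qed

section \<open>Comparison of cumulative functions\<close>

lemma norm_exp_minus_one_le:
  fixes D :: complex
  assumes "norm D \<le> 1 / 2"
  shows "norm (exp D - 1) \<le> 2 * norm D"
proof -
  have "norm (exp D - 1) \<le> exp \<bar>Re D\<bar> * norm D" using Taylor_exp[of D 0] by simp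
  also have "exp \<bar>Re D\<bar> \<le> 2"
    using exp_bound_half[of "\<bar>Re D\<bar>"] order_trans[OF abs_Re_le_cmod assms] by simp
  finally show ?thesis by (simp add: mult_right_mono)
qed

lemma cauchy_transform_bounded:
  assumes \<Omega>: "continual_diagram \<Omega>" and ab: "a < a0" "a0 < b0" "b0 < b"
    and \<delta>: "0 < \<delta>" and lip: "lipschitz_on (1 - \<delta>) {a..b} \<Omega>"
    and f: "f \<in> borel_measurable borel" "\<And>x. x \<in> {a..b} \<Longrightarrow> 0 \<le> f x" "\<And>x. x \<in> {a..b} \<Longrightarrow> f x \<le> C"
    and dens: "\<And>A. A \<in> sets borel \<Longrightarrow> A \<subseteq> {a..b} \<Longrightarrow>
      emeasure (transition_measure \<Omega>) A = (\<integral>\<^sup>+x\<in>A. ennreal (f x) \<partial>lborel)"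
  obtains B where "1 \<le> B"
    "\<And>u t. u \<in> {a0..b0} \<Longrightarrow> 0 < t \<Longrightarrow> t \<le> 1 \<Longrightarrow> norm (cauchy_transform \<Omega> (Complex u t)) \<le> B"
proof -
  \<comment> \<open>The room between [a0, b0] and the ends of [a, b]; it serves every u at once,
    which makes the bound uniform.\<close>
  define \<rho> where "\<rho> = min (a0 - a) (b - b0)"
  define s where "s = sin (\<delta> / 2 * arctan \<rho>)"
  \<comment> \<open>At least 1, so that terms without the factor B can be absorbed later.\<close>
  define B where "B = max 1 ((C * pi + 1 / \<rho>\<^sup>2) / s)"
  have \<rho>: "0 < \<rho>" using ab by (simp add: \<rho>_def)
  show ?thesis
  proof (rule that[of B])
    show "1 \<le> B" by (simp add: B_def)
    fix u t assume u: "u \<in> {a0..b0}" and t: "0 < t" "t \<le> (1::real)"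
    define G where "G = cauchy_transform \<Omega> (Complex u t)"
    have u': "a \<le> u" "u + \<rho> \<le> b" "a + \<rho> \<le> u" "u \<le> b - \<rho>" using u ab by (auto simp: \<rho>_def)
    have s: "norm G * s \<le> - Im G" "0 < s"
      unfolding G_def s_def using norm_cauchy_transform_le_Im[OF \<Omega> \<delta> lip u'(1,2) \<rho> t] by auto
    have "- Im G \<le> C * pi + 1 / \<rho>\<^sup>2"
      unfolding G_def using transition_measure(2)[OF \<Omega>, of "Complex u t"] t
        Im_cauchy_transform_density_le[OF transition_measure(1)[OF \<Omega>] f dens u'(3,4) \<rho> t] by simp
    then have "norm G \<le> (C * pi + 1 / \<rho>\<^sup>2) / s" using s by (simp add: pos_le_divide_eq)
    then show "norm (cauchy_transform \<Omega> (Complex u t)) \<le> B" by (simp add: B_def G_def)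
  qed
qed

lemma cumulative_perturbation:
  assumes \<Omega>: "continual_diagram \<Omega>" and \<omega>: "continual_diagram \<omega>"
    and d: "\<And>w. \<bar>\<omega> w - \<Omega> w\<bar> \<le> 2 * \<epsilon>" and \<epsilon>: "0 < \<epsilon>" "8 * \<epsilon> \<le> 1"
    and B: "1 \<le> B" "\<And>t. 0 < t \<Longrightarrow> t \<le> 1 \<Longrightarrow> norm (cauchy_transform \<Omega> (Complex u t)) \<le> B"
  shows "\<bar>cumulative \<omega> u - cumulative \<Omega> u\<bar> \<le> 21 * B * (8 * \<epsilon>) * (1 - ln (8 * \<epsilon>))"
proof -
  define M M' where "M = transition_measure \<Omega>" and "M' = transition_measure \<omega>"
  have M: "real_distribution M" "real_distribution M'"
    unfolding M_def M'_def using transition_measure(1) \<Omega> \<omega> by auto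
  define G G' where "G = (\<lambda>t. LINT x|M. 1 / (Complex u t - of_real x))"
    and "G' = (\<lambda>t. LINT x|M'. 1 / (Complex u t - of_real x))"
  have G: "cauchy_transform \<Omega> (Complex u t) = G t" "cauchy_transform \<omega> (Complex u t) = G' t" if "0 < t" for t
    unfolding G_def G'_def M_def M'_def using that by (auto intro!: transition_measure(2) \<Omega> \<omega>)
  \<comment> \<open>As \<pi> < 4, for t \<ge> 8\<epsilon> the exponent satisfies |D| \<le>
    (\<eta>/t)/2 \<le> 1/2, so |exp D - 1| \<le> 2|D| \<le> \<eta>/t with no further
    constant.\<close>
  define \<eta> where "\<eta> = 8 * \<epsilon>"
  have \<eta>: "0 < \<eta>" "\<eta> \<le> 1" using \<epsilon> by (auto simp: \<eta>_def)
  have near: "norm (G t - G' t) \<le> norm (G t) * (\<eta> / t)" "norm (G' t) \<le> 2 * norm (G t)" if t: "\<eta> \<le> t" for t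
  proof -
    have t0: "0 < t" using t \<eta> by simp
    obtain D where D: "G' t = G t * exp D" "norm D \<le> \<epsilon> * pi / t"
      using cauchy_transform_perturbation[OF \<Omega> \<omega> d t0] G[OF t0] by metis
    have "\<epsilon> * pi / t \<le> \<epsilon> * 4 / t"
      using pi_less_4 \<epsilon> t0 by (intro divide_right_mono mult_left_mono) auto
    from order_trans[OF D(2) this] have D2: "norm D \<le> (\<eta> / t) / 2" by (simp add: \<eta>_def mult.commute)
    have "\<eta> / t \<le> 1" using t t0 by simp
    then have "(\<eta> / t) / 2 \<le> 1 / 2" by (rule divide_right_mono) simp
    with D2 have D1: "norm D \<le> 1 / 2" by (rule order_trans)
    have "G t - G' t = - (G t * (exp D - 1))" unfolding D(1) by (simp add: algebra_simps)
    then have "norm (G t - G' t) = norm (G t) * norm (exp D - 1)"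
      by (simp only: norm_minus_cancel norm_mult)
    also have "\<dots> \<le> norm (G t) * (\<eta> / t)"
      using norm_exp_minus_one_le[OF D1] D2 by (intro mult_left_mono) auto
    finally show "norm (G t - G' t) \<le> norm (G t) * (\<eta> / t)" .
    show "norm (G' t) \<le> 2 * norm (G t)"
      unfolding D(1) norm_mult using mult_left_mono[OF exp_bound_half[OF D1], of "norm (G t)"] by (simp add: mult.commute)
  qed
  have GB: "norm (G t) \<le> B" if "0 < t" "t \<le> 1" for t using B(2)[OF that] G(1)[OF that(1)] by simp
  have Gt: "norm (G t) \<le> 1 / t" if "0 < t" for t
  proof -
    interpret real_distribution M by (rule M)
    have "norm (G t) \<le> (LINT x|M. 1 / t)"
      unfolding G_def
    proof (rule Bochner_Integration.integral_norm_bound_integral)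
      show "integrable M (\<lambda>x. 1 / (Complex u t - of_real x))"
        by (rule integrable_inverse_shift[OF M(1)]) (use that in simp)
      show "norm (1 / (Complex u t - complex_of_real x)) \<le> 1 / t" for x
        using norm_inverse_shift_le[of "Complex u t" x] that by simp
    qed simp
    then show ?thesis using prob_space by simp
  qed
  have g1: "norm (G t - G' t) \<le> B * \<eta> * (1 / t)" if t: "\<eta> \<le> t" "t \<le> 1" for t
  proof -
    have "norm (G t - G' t) \<le> norm (G t) * (\<eta> / t)" by (rule near(1)[OF t(1)])
    also have "\<dots> \<le> B * (\<eta> / t)" using GB[of t] t \<eta> by (intro mult_right_mono) auto
    finally show ?thesis by simp
  qed
  \<comment> \<open>The transform of a probability measure is at most 1/t, which supplies the second
    power of t without local information.\<close>
  have g2: "norm (G t - G' t) \<le> B * \<eta> * (1 / t\<^sup>2)" if t: "1 \<le> t" for t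
  proof -
    have "norm (G t - G' t) \<le> norm (G t) * (\<eta> / t)" using t \<eta> by (intro near(1)) simp
    also have "\<dots> \<le> (1 / t) * (\<eta> / t)" using Gt[of t] t \<eta> by (intro mult_right_mono) auto
    also have "\<dots> = 1 * \<eta> * (1 / t\<^sup>2)" by (simp add: power2_eq_square)
    also have "\<dots> \<le> B * \<eta> * (1 / t\<^sup>2)" using B(1) \<eta> by (intro mult_right_mono) auto
    finally show ?thesis .
  qed
  \<comment> \<open>B itself would do here; 2B is the bound valid for \<open>G'\<close> and lets
    both smoothing errors be the same expression.\<close>
  have b1: "- Im (G t) \<le> 2 * B" if t: "\<eta> \<le> t" "t \<le> 1" for t
  proof -
    have "- Im (G t) \<le> norm (G t)" using abs_Im_le_cmod[of "G t"] by linarith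
    also have "\<dots> \<le> B" using GB[of t] t \<eta> by simp
    finally show ?thesis using B(1) by simp
  qed
  have b2: "- Im (G' t) \<le> 2 * B" if t: "\<eta> \<le> t" "t \<le> 1" for t
  proof -
    have "- Im (G' t) \<le> norm (G' t)" using abs_Im_le_cmod[of "G' t"] by linarith
    also have "\<dots> \<le> 2 * norm (G t)" by (rule near(2)[OF t(1)])
    also have "\<dots> \<le> 2 * B" using GB[of t] t \<eta> by simp
    finally show ?thesis .
  qed
  have tri: "\<bar>p - q\<bar> \<le> x + 2 * y" if "\<bar>s - s'\<bar> \<le> x" "\<bar>q - s\<bar> \<le> y" "\<bar>p - s'\<bar> \<le> y" for p q s s' x y :: real
    using that unfolding abs_le_iff by linarith
  have "\<bar>smoothed_cdf M u \<eta> - smoothed_cdf M' u \<eta>\<bar> \<le> B * \<eta> * - ln \<eta> + B * \<eta>"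
    using g1 g2 unfolding G_def G'_def by (rule smoothed_cdf_close[OF M \<eta>])
  moreover have "\<bar>cdf M u - smoothed_cdf M u \<eta>\<bar> \<le> 2 * \<eta> * (2 * B) + 5 * \<eta> * (2 * B * - ln \<eta>) + 2 * \<eta>"
    using b1 unfolding G_def by (rule cdf_smoothing_error[OF M(1) \<eta>])
  moreover have "\<bar>cdf M' u - smoothed_cdf M' u \<eta>\<bar> \<le> 2 * \<eta> * (2 * B) + 5 * \<eta> * (2 * B * - ln \<eta>) + 2 * \<eta>"
    using b2 unfolding G'_def by (rule cdf_smoothing_error[OF M(2) \<eta>])
  ultimately have "\<bar>cdf M' u - cdf M u\<bar> \<le> B * \<eta> * - ln \<eta> + B * \<eta> + 2 * (2 * \<eta> * (2 * B) + 5 * \<eta> * (2 * B * - ln \<eta>) + 2 * \<eta>)"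
    by (rule tri)
  \<comment> \<open>21 = 1 + 2 x 10 counts the logarithmic terms and 9 = 1 + 2 x 4 the linear ones.
    As B \<ge> 1, the remaining 4\<eta> is raised to 12 B\<eta>, so that 9 + 12 = 21 allows a common
    factor.\<close>
  also have "\<dots> = 21 * (B * \<eta> * - ln \<eta>) + 9 * (B * \<eta>) + 4 * (1 * \<eta>)" by (simp add: algebra_simps)
  also have "\<dots> \<le> 21 * (B * \<eta> * - ln \<eta>) + 9 * (B * \<eta>) + 12 * (B * \<eta>)"
  proof -
    have "1 * \<eta> \<le> B * \<eta>" using B(1) \<eta> by (intro mult_right_mono) auto
    moreover have "0 \<le> B * \<eta>" using B(1) \<eta> by simp
    ultimately show ?thesis by linarith
  qed
  also have "\<dots> = 21 * B * \<eta> * (1 - ln \<eta>)" by (simp add: algebra_simps)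
  finally show ?thesis unfolding cumulative_def cdf_def M_def M'_def \<eta>_def .
qed

text \<open>Here the logarithm of the hypothesis is spent: for \<eta> of order 1/(n^\<alpha> log n),
  log(1/\<eta>) is at most a multiple of log n, which cancels the log n in the denominator of
  \<eta>.\<close>

lemma eventually_rate_le:
  fixes \<alpha> \<epsilon> K :: real
  assumes \<alpha>: "0 < \<alpha>" and \<epsilon>: "0 < \<epsilon>" and K: "0 \<le> K"
  shows "\<forall>\<^sub>F n in sequentially. 0 < \<epsilon> / (real n powr \<alpha> * ln (real n)) \<and> 8 * (\<epsilon> / (real n powr \<alpha> * ln (real n))) \<le> 1 \<and>
    K * (8 * (\<epsilon> / (real n powr \<alpha> * ln (real n)))) * (1 - ln (8 * (\<epsilon> / (real n powr \<alpha> * ln (real n)))))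
      \<le> 8 * K * \<epsilon> * (\<alpha> + 2) * (1 / real n powr \<alpha>)"
proof -
  \<comment> \<open>With l = ln n, the thresholds give in turn l \<ge> 1, the bound \<eta> \<le> 1,
    and 1 - ln(8\<epsilon>) \<le> l. Adding ln(n^\<alpha>) = \<alpha> l and ln l \<le> l accounts
    for the factor \<alpha> + 2.\<close>
  define m where "m = max 1 (max (8 * \<epsilon>) (1 - ln (8 * \<epsilon>)))"
  have "filterlim (\<lambda>n. ln (real n)) at_top sequentially"
    by (rule filterlim_compose[OF ln_at_top filterlim_real_sequentially])
  then have "\<forall>\<^sub>F n in sequentially. m \<le> ln (real n)" unfolding filterlim_at_top by blast
  then show ?thesis using eventually_gt_at_top[of 0]
  proof eventually_elim
    case (elim n)
    define x l where "x = real n powr \<alpha>" and "l = ln (real n)"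
    have l: "1 \<le> l" "8 * \<epsilon> \<le> l" "1 - ln (8 * \<epsilon>) \<le> l" using elim by (auto simp: m_def l_def)
    have n1: "1 \<le> real n" using elim by simp
    then have x: "1 \<le> x" unfolding x_def using \<alpha> by (intro ge_one_powr_ge_zero) auto
    define \<eta> where "\<eta> = 8 * (\<epsilon> / (x * l))"
    have xl: "0 < x * l" using x l by simp
    have "8 * \<epsilon> \<le> 1 * l" using l by simp
    also have "\<dots> \<le> x * l" using x l by (intro mult_right_mono) auto
    finally have e1: "\<eta> \<le> 1" using xl by (simp add: \<eta>_def)
    have lnx: "ln x = \<alpha> * l" unfolding x_def l_def using n1 by (simp add: ln_powr)
    have "\<eta> = (8 * \<epsilon>) / (x * l)" by (simp add: \<eta>_def)
    then have "ln \<eta> = ln (8 * \<epsilon>) - (ln x + ln l)"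
      using \<epsilon> x l xl by (simp add: ln_div ln_mult)
    moreover have "ln l \<le> l" using ln_le_minus_one[of l] l by simp
    ultimately have "1 - ln \<eta> \<le> (\<alpha> + 2) * l" using l lnx by (simp add: algebra_simps)
    then have "K * \<eta> * (1 - ln \<eta>) \<le> K * \<eta> * ((\<alpha> + 2) * l)"
      using K \<epsilon> xl by (intro mult_left_mono) (auto simp: \<eta>_def)
    also have "\<dots> = 8 * K * \<epsilon> * (\<alpha> + 2) * (1 / x)" using x l by (simp add: \<eta>_def)
    finally show ?case using e1 \<epsilon> xl unfolding \<eta>_def x_def l_def by auto
  qed
qed

theorem mainTheorem1:
  fixes \<alpha> a a0 b0 b :: real
    and \<Omega> :: "real \<Rightarrow> real"
    and \<omega> :: "nat \<Rightarrow> real \<Rightarrow> real"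
  assumes "\<alpha> > 0"
    and "continual_diagram \<Omega>"
    and "a < a0" "a0 < b0" "b0 < b"
    and "\<exists>\<delta>>0. lipschitz_on (1 - \<delta>) {a..b} \<Omega>"
    and "\<exists>f C. f \<in> borel_measurable borel \<and> (\<forall>x\<in>{a..b}. 0 \<le> f x \<and> f x \<le> C) \<and>
           (\<forall>A\<in>sets borel. A \<subseteq> {a..b} \<longrightarrow>
              emeasure (transition_measure \<Omega>) A = (\<integral>\<^sup>+x\<in>A. ennreal (f x) \<partial>lborel))"
    and "\<forall>n\<ge>1. continual_diagram (\<omega> n)"
    and "\<forall>\<epsilon>>0. eventually (\<lambda>n. diag_dist \<Omega> (\<omega> n) \<le> ereal (\<epsilon> / (real n powr \<alpha> * ln (real n)))) at_top"
  shows "(\<lambda>n. SUP z\<in>{a0..b0}. \<bar>cumulative (\<omega> n) z - cumulative \<Omega> z\<bar>)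
           \<in> o(\<lambda>n. 1 / real n powr \<alpha>)"
proof (rule landau_o.smallI)
  fix c :: real assume c: "c > 0"
  note \<Omega> = assms(2)
  obtain \<delta> where \<delta>: "\<delta> > 0" "lipschitz_on (1 - \<delta>) {a..b} \<Omega>" using assms(6) by blast
  obtain f C where f: "f \<in> borel_measurable borel" "\<And>x. x \<in> {a..b} \<Longrightarrow> 0 \<le> f x" "\<And>x. x \<in> {a..b} \<Longrightarrow> f x \<le> C"
    "\<And>A. A \<in> sets borel \<Longrightarrow> A \<subseteq> {a..b} \<Longrightarrow>
      emeasure (transition_measure \<Omega>) A = (\<integral>\<^sup>+x\<in>A. ennreal (f x) \<partial>lborel)"
    using assms(7) by blast
  obtain B where B: "1 \<le> B"
    "\<And>u t. u \<in> {a0..b0} \<Longrightarrow> 0 < t \<Longrightarrow> t \<le> 1 \<Longrightarrow> norm (cauchy_transform \<Omega> (Complex u t)) \<le> B"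
    using cauchy_transform_bounded[OF \<Omega> assms(3-5) \<delta> f] by metis
  \<comment> \<open>Chosen so that the final bound is exactly c / n^\<alpha>.\<close>
  define \<epsilon> where "\<epsilon> = c / (8 * (21 * B) * (\<alpha> + 2))"
  have \<epsilon>: "0 < \<epsilon>" using c B(1) assms(1) by (simp add: \<epsilon>_def)
  have \<epsilon>c: "8 * (21 * B) * \<epsilon> * (\<alpha> + 2) = c" using B(1) assms(1) by (simp add: \<epsilon>_def)
  have K: "0 \<le> 21 * B" using B(1) by simp
  have "\<forall>\<^sub>F n in sequentially. diag_dist \<Omega> (\<omega> n) \<le> ereal (\<epsilon> / (real n powr \<alpha> * ln (real n)))"
    using assms(9) \<epsilon> by blast
  then show "\<forall>\<^sub>F n in sequentially. norm (SUP z\<in>{a0..b0}. \<bar>cumulative (\<omega> n) z - cumulative \<Omega> z\<bar>) \<le> c * norm (1 / real n powr \<alpha>)"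
    using eventually_rate_le[OF assms(1) \<epsilon> K] eventually_ge_at_top[of 1]
  proof eventually_elim
    case (elim n)
    define e where "e = \<epsilon> / (real n powr \<alpha> * ln (real n))"
    have \<omega>n: "continual_diagram (\<omega> n)" using assms(8) elim(3) by blast
    have e: "0 < e" "8 * e \<le> 1" "21 * B * (8 * e) * (1 - ln (8 * e)) \<le> c * (1 / real n powr \<alpha>)"
      using elim(2) unfolding e_def \<epsilon>c by auto
    have bound: "\<bar>cumulative (\<omega> n) z - cumulative \<Omega> z\<bar> \<le> c * (1 / real n powr \<alpha>)" if "z \<in> {a0..b0}" for z
      using cumulative_perturbation[OF \<Omega> \<omega>n uniform_distance_le_diag_dist[OF \<Omega> \<omega>n elim(1)[folded e_def]] e(1,2) B(1) B(2)[OF that]] e(3)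
      by linarith
    have a0: "a0 \<in> {a0..b0}" using assms(4) by simp
    have "(SUP z\<in>{a0..b0}. \<bar>cumulative (\<omega> n) z - cumulative \<Omega> z\<bar>) \<le> c * (1 / real n powr \<alpha>)"
      using a0 bound by (intro cSUP_least) auto
    \<comment> \<open>The norm calls for a nonnegative supremum. A real supremum is meaningful only
      for sets bounded above, so the pointwise bound is used once more, for boundedness.\<close>
    moreover have "0 \<le> (SUP z\<in>{a0..b0}. \<bar>cumulative (\<omega> n) z - cumulative \<Omega> z\<bar>)"
      by (rule cSUP_upper2[OF _ a0]) (use bound in \<open>auto intro!: bdd_aboveI2[where M="c * (1 / real n powr \<alpha>)"]\<close>)
    ultimately show ?case by simp
  qed
qed

end
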